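(* Let $Y$ be a regular diffusion on $[l,r]$ with laws $\{P_y\}_{y\in[l,r]}$ and scale function $s$, and let $\{Q_y\}_{y\in[l,r]}$ be the Föllmer measures associated with $s(Y)/s(y)$. Fix $y\in(l,r)$. (A) Suppose $s(l)>-\infty$, normalized so that $s(l)=0$ (Assumption L). 1. Suppose that $P_y(\tau_l=\mathfrak T)=0$, which is equivalent to $s(r)=\infty$. Then the family of probability measures $\{P_y(\cdot|\tau_a\le\tau_l)|_{\mathcal F_{\tau_a}}\}_{y<a<r}$ is consistent and thus has an extension $\widetilde Q_y$ on $\mathcal F$. Moreover, $\widetilde Q_y=Q_y$. 2. Suppose that $P_y(\tau_l=\mathfrak T)>0$, which is equivalent to $s(r)<\infty$, and define $\widehat Q_y=P_y(\cdot|\tau_l=\mathfrak T)$. Then $\widehat Q_y=Q_y$. 3. If $s(r)=\infty$, the family of probability measures $\{Q_y(\cdot|\tau_a\le\tau_r)|_{\mathcal F_{\tau_a}}\}_{l<a<y}$ is consistent. Its unique extension is $P_y$. (B) Suppose $s(r)<\infty$, normalized so that $s(r)=0$ (Assumption R). 1. Suppose that $P_y(\tau_r=\mathfrak T)=0$, which is equivalent to $s(l)=-\infty$. Then the family of probability measures $\{P_y(\cdot|\tau_a\le\tau_r)|_{\mathcal F_{\tau_a}}\}_{l<a<y}$ is consistent and thus has an extension $\widetilde Q_y$ on $\mathcal F$. Moreover, $\widetilde Q_y=Q_y$. 2. Suppose that $P_y(\tau_r=\mathfrak T)>0$, which is equivalent to $s(l)>-\infty$, and define $\widehat Q_y=P_y(\cdot|\tau_r=\mathfrak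 T)$. Then $\widehat Q_y=Q_y$. 3. If $s(l)=-\infty$, the family of probability measures $\{Q_y(\cdot|\tau_a\le\tau_l)|_{\mathcal F_{\tau_a}}\}_{y<a<r}$ is consistent. Its unique extension is $P_y$.
   Context: $\Omega=C_{\mathrm{abs}}$ is the space of functions $\omega:[0,\infty)\to[0,\infty]$ that are absorbed in $0$ and in $\infty$ and continuous up to the first hitting time of $\infty$, with its canonical filtration $(\mathcal F_t)_{t\ge0}$. A diffusion is a time-homogeneous strong Markov process $Y:C_{\mathrm{abs}}\times[0,\infty)\to[l,r]$ with continuous paths in a possibly infinite interval $[l,r]$, $-\infty\le l<r\le\infty$ (the values $l$ and $r$ are allowed), which is stopped once it hits $l$ or $r$. $P_y$ is the probability measure under which $Y_0=y\in[l,r]$. $Y$ is regular if $P_y(\tau_z<\infty)>0$ for all $y,z\in(l,r)$. Hitting times: $\tau_a=\inf\{t\in[0,\infty]:Y_t=a\}$ for $a\in[l,r]$, where $t=\infty$ is allowed ($Y_\infty$ being the limit of $Y_t$ as $t\uparrow\infty$), and $\inf\emptyset:=\mathfrak T$, an extra symbol satisfying $t<\mathfrak T$ for all $t\in[0,\infty]$. For a stopping time $\tau$ (with values in $[0,\infty]\cup\{\mathfrak T\}$), $\mathcal F_\tau=\{A\in\mathcal F:A\cap\{\tau\le t\}\in\mathcal F_t\ \forall t\in[0,\infty)\}$. It is assumed that $\mathcal F=\mathcal F_{\tau_l\wedge\tau_r}$. Scale function: for a regular diffusion there is a continuous, strictly increasing function $s$ on $(l,r)$, unique up to an affine transformation,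 such that $s(Y)$ is a local martingale; any such $s$ is called a scale function and is extended to $[l,r]$ by taking limits. Standing assumption: $s(l)>-\infty$ (Assumption L), and then $s$ is normalized so that $s(l)=0$, or $s(r)<\infty$ (Assumption R), and then $s$ is normalized so that $s(r)=0$. Föllmer measures: with $X:=s(Y)/s(y)$ (and $0/0:=\infty/\infty:=1$), a nonnegative local martingale under $P_y$ with $X_0=1$, $Q_y$ is the unique probability measure on $\mathcal F$ with $\mathrm dQ_y|_{\mathcal F_\tau}=X_\tau\,\mathrm dP_y|_{\mathcal F_\tau}$ for all stopping times $\tau$ for which the stopped process $X^\tau$ is a uniformly integrable $P_y$-martingale, where $X_\tau:=X^\tau_\infty$ (its existence is known). A family of measures on $(\mathcal F_{\tau_a})_a$ is consistent if the members agree on common sub-$\sigma$-algebras as $a$ varies; an extension is a probability measure on $\mathcal F$ whose restriction to each $\mathcal F_{\tau_a}$ is the given member. *)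

theory Defs
  imports "HOL-Probability.Probability"
begin

section \<open>Extended time\<close>

text \<open>Stopping times take values in \<open>[0,\<infinity>] \<union> {\<TT>}\<close>, where \<open>\<TT>\<close>
  (here \<open>Beyond\<close>) is the value of \<open>inf {}\<close> and lies strictly above \<open>\<infinity>\<close>.\<close>

datatype ext_time = Time ennreal | Beyond

instantiation ext_time :: linorder
begin

definition less_eq_ext_time :: "ext_time \<Rightarrow> ext_time \<Rightarrow> bool" where
  "x \<le> y \<longleftrightarrow> (case y of Beyond \<Rightarrow> True
      | Time v \<Rightarrow> (case x of Beyond \<Rightarrow> False | Time u \<Rightarrow> u \<le> v))"

definition less_ext_time :: "ext_time \<Rightarrow> ext_time \<Rightarrow> bool" where
  "x < y \<longleftrightarrow> x \<le> y \<and> \<not> y \<le> (x :: ext_time)"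

instance
  by standard (auto simp: less_eq_ext_time_def less_ext_time_def split: ext_time.splits)

end

text \<open>The real number \<open>\<tau>\<close> when \<open>\<tau>\<close> is finite; used only in that case.\<close>

fun time_val :: "ext_time \<Rightarrow> real" where
  "time_val (Time u) = enn2real u"
| "time_val Beyond = 0"

section \<open>The path space and its canonical filtration\<close>

type_synonym path = "real \<Rightarrow> ennreal"

text \<open>\<open>C_abs\<close>: continuity up to and including the first hitting time of \<open>\<infinity>\<close> (in the
  topology of \<open>[0,\<infinity>]\<close>) together with absorption is plain continuity on \<open>[0,\<infinity>)\<close>.
  A path that could jump to \<open>\<infinity>\<close> would make uniqueness of extensions false: a path reaching
  \<open>0\<close> would be indistinguishable, before that time, from one that jumps to \<open>\<infinity>\<close> there.
  Extensionality makes elements genuine functions on \<open>[0,\<infinity>)\<close>.\<close>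

definition C_abs :: "path set" where
  "C_abs = {\<omega> \<in> extensional {0..}. continuous_on {0..} \<omega> \<and>
     (\<forall>s t. 0 \<le> s \<longrightarrow> s \<le> t \<longrightarrow> \<omega> s \<in> {0, \<infinity>} \<longrightarrow> \<omega> t = \<omega> s)}"

text \<open>The filtration is indexed by extended time; at \<open>Time \<infinity>\<close> and at \<open>Beyond\<close> it is the
  \<open>\<sigma>\<close>-algebra generated by the whole path. Hence the library predicate
  \<^const>\<open>stopping_time\<close> says that \<open>{\<tau> \<le> t}\<close> is in \<open>F\<^sub>t\<close> for finite \<open>t\<close> and that \<open>{\<tau> \<le> \<infinity>}\<close> is
  measurable.\<close>

definition path_filt :: "ext_time \<Rightarrow> path measure" where
  "path_filt T = sigma C_abs
     {{\<omega> \<in> C_abs. \<omega> s \<in> B} | s B. 0 \<le> s \<and> Time (ennreal s) \<le> T \<and> B \<in> sets borel}"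

abbreviation path_alg :: "path measure" where
  "path_alg \<equiv> path_filt Beyond"

definition stopped_alg :: "(path \<Rightarrow> ext_time) \<Rightarrow> path measure" where
  "stopped_alg \<tau> = sigma C_abs
     {A \<in> sets path_alg. \<forall>t\<ge>0. A \<inter> {\<omega>. \<tau> \<omega> \<le> Time (ennreal t)} \<in> sets (path_filt (Time (ennreal t)))}"

section \<open>Processes\<close>

type_synonym process = "real \<Rightarrow> path \<Rightarrow> ereal"

text \<open>\<open>inf {t \<in> [0,\<infinity>]. Y\<^sub>t = a}\<close>, where \<open>Y\<^sub>\<infinity> = a\<close> means that \<open>Y\<^sub>t\<close> tends to \<open>a\<close> as \<open>t \<rightarrow> \<infinity>\<close>.\<close>

definition hit_time :: "process \<Rightarrow> ereal \<Rightarrow> path \<Rightarrow> ext_time" where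
  "hit_time Y a \<omega> =
     (let S = {ennreal t | t. 0 \<le> t \<and> Y t \<omega> = a} \<union>
              {u. u = \<infinity> \<and> ((\<lambda>t. Y t \<omega>) \<longlongrightarrow> a) at_top}
      in if S = {} then Beyond else Time (Inf S))"

definition stopped :: "process \<Rightarrow> (path \<Rightarrow> ext_time) \<Rightarrow> process" where
  "stopped X \<tau> t \<omega> = X (if \<tau> \<omega> \<le> Time (ennreal t) then time_val (\<tau> \<omega>) else t) \<omega>"

definition stopped_limit :: "process \<Rightarrow> (path \<Rightarrow> ext_time) \<Rightarrow> path \<Rightarrow> ereal" where
  "stopped_limit X \<tau> \<omega> = Lim at_top (\<lambda>t. stopped X \<tau> t \<omega>)"

definition martingale :: "path measure \<Rightarrow> process \<Rightarrow> bool" where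
  "martingale M X \<longleftrightarrow>
     (\<forall>t\<ge>0. X t \<in> borel_measurable (path_filt (Time (ennreal t))) \<and>
            (AE \<omega> in M. \<bar>X t \<omega>\<bar> \<noteq> \<infinity>) \<and>
            integrable M (\<lambda>\<omega>. real_of_ereal (X t \<omega>))) \<and>
     (\<forall>s t. 0 \<le> s \<longrightarrow> s \<le> t \<longrightarrow>
        (AE \<omega> in M. real_cond_exp M (path_filt (Time (ennreal s))) (\<lambda>\<omega>. real_of_ereal (X t \<omega>)) \<omega>
                     = real_of_ereal (X s \<omega>)))"

definition uniformly_integrable :: "path measure \<Rightarrow> process \<Rightarrow> bool" where
  "uniformly_integrable M X \<longleftrightarrow>
     (\<forall>e>0. \<exists>K::real. \<forall>t\<ge>0.
        (\<integral>\<^sup>+\<omega>\<in>{\<omega>. \<bar>X t \<omega>\<bar> > ereal K}. e2ennreal \<bar>X t \<omega>\<bar> \<partial>M) \<le> ennreal e)"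

definition local_martingale :: "path measure \<Rightarrow> process \<Rightarrow> bool" where
  "local_martingale M X \<longleftrightarrow>
     (\<exists>\<tau> :: nat \<Rightarrow> path \<Rightarrow> ext_time.
        (\<forall>n. stopping_time path_filt (\<tau> n)) \<and>
        (\<forall>n. \<forall>\<omega>\<in>C_abs. \<tau> n \<omega> \<le> \<tau> (Suc n) \<omega>) \<and>
        (AE \<omega> in M. \<forall>t\<ge>0. \<exists>n. Time (ennreal t) < \<tau> n \<omega>) \<and>
        (\<forall>n. martingale M (stopped X (\<tau> n))))"

section \<open>Diffusions\<close>

definition strong_markov :: "ereal \<Rightarrow> ereal \<Rightarrow> process \<Rightarrow> (ereal \<Rightarrow> path measure) \<Rightarrow> bool" where
  "strong_markov l r Y P \<longleftrightarrow>
     (\<forall>\<tau> y t B. stopping_time path_filt \<tau> \<longrightarrow> y \<in> {l..r} \<longrightarrow> 0 \<le> t \<longrightarrow> B \<in> sets borel \<longrightarrow>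
        (AE \<omega> in P y. \<tau> \<omega> < Time \<infinity> \<longrightarrow>
           real_cond_exp (P y) (stopped_alg \<tau>)
             (indicator {\<omega> \<in> C_abs. \<tau> \<omega> < Time \<infinity> \<and> Y (time_val (\<tau> \<omega>) + t) \<omega> \<in> B}) \<omega>
           = measure (P (Y (time_val (\<tau> \<omega>)) \<omega>)) {\<omega>' \<in> C_abs. Y t \<omega>' \<in> B}))"

definition diffusion :: "ereal \<Rightarrow> ereal \<Rightarrow> process \<Rightarrow> (ereal \<Rightarrow> path measure) \<Rightarrow> bool" where
  "diffusion l r Y P \<longleftrightarrow>
     l < r \<and>
     (\<forall>t\<ge>0. Y t \<in> borel_measurable (path_filt (Time (ennreal t)))) \<and>
     (\<forall>\<omega>\<in>C_abs. (\<forall>t\<ge>0. Y t \<omega> \<in> {l..r}) \<and> continuous_on {0..} (\<lambda>t. Y t \<omega>) \<and>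
        (\<forall>s t. 0 \<le> s \<longrightarrow> s \<le> t \<longrightarrow> Y s \<omega> \<in> {l, r} \<longrightarrow> Y t \<omega> = Y s \<omega>)) \<and>
     (\<forall>y\<in>{l..r}. prob_space (P y) \<and> sets (P y) = sets path_alg \<and> (AE \<omega> in P y. Y 0 \<omega> = y)) \<and>
     (\<forall>A\<in>sets path_alg. (\<lambda>y. measure (P y) A) \<in> borel_measurable (restrict_space borel {l..r})) \<and>
     strong_markov l r Y P"

definition regular_diffusion :: "ereal \<Rightarrow> ereal \<Rightarrow> process \<Rightarrow> (ereal \<Rightarrow> path measure) \<Rightarrow> bool" where
  "regular_diffusion l r Y P \<longleftrightarrow>
     diffusion l r Y P \<and>
     (\<forall>y\<in>{l<..<r}. \<forall>z\<in>{l<..<r}. measure (P y) {\<omega> \<in> C_abs. hit_time Y z \<omega> < Time \<infinity>} > 0)"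

text \<open>The last two conditions say that the real-valued function \<open>s\<close> on \<open>(l,r)\<close> has been extended
  to \<open>[l,r]\<close> by taking limits.\<close>

definition scale_function ::
    "ereal \<Rightarrow> ereal \<Rightarrow> process \<Rightarrow> (ereal \<Rightarrow> path measure) \<Rightarrow> (ereal \<Rightarrow> ereal) \<Rightarrow> bool" where
  "scale_function l r Y P s \<longleftrightarrow>
     (\<forall>x\<in>{l<..<r}. \<bar>s x\<bar> \<noteq> \<infinity>) \<and>
     continuous_on {l<..<r} s \<and>
     strict_mono_on {l<..<r} s \<and>
     (\<forall>y\<in>{l<..<r}. local_martingale (P y) (\<lambda>t \<omega>. s (Y t \<omega>))) \<and>
     (s \<longlongrightarrow> s l) (at_right l) \<and>
     (s \<longlongrightarrow> s r) (at_left r)"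

section \<open>Foellmer measures\<close>

text \<open>Division with \<open>0/0 = \<infinity>/\<infinity> = 1\<close>.\<close>

definition ratio :: "ereal \<Rightarrow> ereal \<Rightarrow> ereal" where
  "ratio u v = (if (u = 0 \<and> v = 0) \<or> (\<bar>u\<bar> = \<infinity> \<and> \<bar>v\<bar> = \<infinity>) then 1 else u / v)"

text \<open>Only the defining change-of-measure property: uniqueness of such a measure is not part of
  the predicate. \<open>A\<close> ranges over \<open>F\<^sub>\<tau>\<close>, so this is \<open>dQ = X\<^sub>\<tau> dM\<close> on \<open>F\<^sub>\<tau>\<close>.\<close>

definition foellmer_measure :: "path measure \<Rightarrow> process \<Rightarrow> path measure \<Rightarrow> bool" where
  "foellmer_measure M X Q \<longleftrightarrow>
     prob_space Q \<and> sets Q = sets path_alg \<and>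
     (\<forall>\<tau>. stopping_time path_filt \<tau> \<longrightarrow>
          martingale M (stopped X \<tau>) \<longrightarrow> uniformly_integrable M (stopped X \<tau>) \<longrightarrow>
          (\<forall>A\<in>sets (stopped_alg \<tau>). emeasure Q A = (\<integral>\<^sup>+\<omega>\<in>A. e2ennreal (stopped_limit X \<tau> \<omega>) \<partial>M)))"

section \<open>Conditioned families and their extensions\<close>

definition cond_restr ::
    "path measure \<Rightarrow> process \<Rightarrow> ereal \<Rightarrow> ereal \<Rightarrow> path measure" where
  "cond_restr M Y b a =
     restr_to_subalg (uniform_measure M {\<omega> \<in> C_abs. hit_time Y a \<omega> \<le> hit_time Y b \<omega>})
       (stopped_alg (hit_time Y a))"

definition consistent_family :: "ereal set \<Rightarrow> (ereal \<Rightarrow> path measure) \<Rightarrow> bool" where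
  "consistent_family I \<mu> \<longleftrightarrow>
     (\<forall>a\<in>I. prob_space (\<mu> a)) \<and>
     (\<forall>a\<in>I. \<forall>b\<in>I. \<forall>A\<in>sets (\<mu> a) \<inter> sets (\<mu> b). emeasure (\<mu> a) A = emeasure (\<mu> b) A)"

definition is_extension :: "ereal set \<Rightarrow> (ereal \<Rightarrow> path measure) \<Rightarrow> path measure \<Rightarrow> bool" where
  "is_extension I \<mu> R \<longleftrightarrow>
     prob_space R \<and> sets R = sets path_alg \<and>
     (\<forall>a\<in>I. \<forall>A\<in>sets (\<mu> a). emeasure R A = emeasure (\<mu> a) A)"

end

theory Submission
  imports Defs
begin

text \<open>Let \<open>X = s(Y)/s(y)\<close> with \<open>s(l) = 0\<close>. Up to the first visit of \<open>Y\<close> to an interior level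
  above \<open>y\<close> the nonnegative local martingale \<open>X\<close> is bounded, hence a uniformly integrable
  martingale, and \<open>Q\<^sub>y\<close> has the stopped value of \<open>X\<close> as density there. The theorem says what this
  density is.

  If \<open>s(r) = \<infinity>\<close>, almost every path converges to \<open>l\<close>, where \<open>X\<close> vanishes. Stopped at \<open>\<tau>\<^sub>a\<close> with
  \<open>a > y\<close>, \<open>X\<close> therefore equals the constant \<open>s(a)/s(y)\<close> on \<open>{\<tau>\<^sub>a \<le> \<tau>\<^sub>l}\<close> and \<open>0\<close> elsewhere: the density
  is a normalized indicator, and a change of measure by a normalized indicator is conditioning
  (\<open>conditioned_on_hitting_above\<close>). If \<open>s(r) < \<infinity>\<close>, \<open>X\<close> is bounded altogether, and its limit is a
  multiple of the indicator of the paths that do not converge to \<open>l\<close>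
  (\<open>conditioned_on_never_hitting\<close>). For the way back, stop at \<open>\<tau>\<^sub>a \<and> \<tau>\<^sub>b\<close> with \<open>a < y < b\<close> and let
  \<open>b\<close> tend to \<open>r\<close>: on the event that \<open>a\<close> is reached the density is the constant \<open>s(a)/s(y)\<close>, and
  \<open>a\<close> is reached almost surely under \<open>P\<^sub>y\<close>, so that conditioning \<open>Q\<^sub>y\<close> on reaching \<open>a\<close> restores
  \<open>P\<^sub>y\<close> (\<open>conditioned_back\<close>).

  Four facts carry this. Optional stopping holds for continuous local martingales that are
  bounded up to the stopping time (\<open>local_martingale_bounded_stopping\<close>). The strong Markov property
  and regularity force the path out of every compact subinterval (\<open>exit_compact\<close>). Optional
  stopping bounds the probability of coming back from \<open>a\<close> to \<open>c > a\<close> by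
  \<open>(s(a) - s(l)) / (s(c) - s(l))\<close>, which excludes oscillation, so that paths converge to an endpoint
  (\<open>limit_exists\<close>); under \<open>Q\<^sub>y\<close> the probability of coming back from \<open>b\<close> to \<open>c < b\<close> is at most
  \<open>s(c)/s(b)\<close>, whence convergence to \<open>r\<close> (\<open>Q_limit_r\<close>). Finally, if the whole \<open>\<sigma>\<close>-algebra is that of \<open>\<tau>\<^sub>l \<and> \<tau>\<^sub>r\<close>, the
  coordinate path must be absorbed at the moment at which \<open>Y\<close> reaches an endpoint; by
  continuity it is then the limit of its pieces stopped at levels tending to that endpoint, and a
  probability measure under which all these levels are reached is determined by its restrictions to
  the corresponding \<open>\<sigma>\<close>-algebras (\<open>extension_unique\<close>).

  The normalization \<open>s(r) = 0\<close> is reduced to \<open>s(l) = 0\<close> by passing to \<open>-Y\<close> and \<open>-s(-x)\<close>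
  (\<open>reflected_laws\<close>).\<close>

section \<open>Path space, filtration and stopping times\<close>

abbreviation filt :: "real \<Rightarrow> path measure" where
  "filt t \<equiv> path_filt (Time (ennreal t))"

lemma ext_time_simps [simp]:
  "Time u \<le> Time v \<longleftrightarrow> u \<le> v" "Time u < Time v \<longleftrightarrow> u < v"
  "x \<le> Beyond" "Beyond \<le> Time u \<longleftrightarrow> False" "Time u < Beyond" "Beyond < x \<longleftrightarrow> False"
  by (auto simp: less_eq_ext_time_def less_ext_time_def split: ext_time.splits)

lemma space_path_filt [simp]: "space (path_filt T) = C_abs"
  unfolding path_filt_def by (rule space_measure_of) auto

lemma sets_path_filt:
  "sets (path_filt T) = sigma_sets C_abs
     {{\<omega> \<in> C_abs. \<omega> s \<in> B} | s B. 0 \<le> s \<and> Time (ennreal s) \<le> T \<and> B \<in> sets borel}"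
  unfolding path_filt_def by (rule sets_measure_of) auto

lemma path_filt_mono: "T \<le> T' \<Longrightarrow> sets (path_filt T) \<subseteq> sets (path_filt T')"
  unfolding sets_path_filt by (rule sigma_sets_mono') (use order_trans in blast)

lemma filt_mono: "s \<le> t \<Longrightarrow> sets (filt s) \<subseteq> sets (filt t)"
  by (rule path_filt_mono) (simp add: ennreal_leI)

lemma filt_path_alg: "sets (path_filt T) \<subseteq> sets path_alg"
  by (rule path_filt_mono) simp

lemma measurable_path_filt_mono:
  "T \<le> T' \<Longrightarrow> f \<in> measurable (path_filt T) N \<Longrightarrow> f \<in> measurable (path_filt T') N"
  using path_filt_mono[of T T'] by (auto simp: measurable_def)

lemma measurable_filt_path_alg:
  "f \<in> measurable (path_filt T) N \<Longrightarrow> f \<in> measurable path_alg N"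
  by (rule measurable_path_filt_mono) auto

lemma measurable_coordinate:
  assumes "0 \<le> t" shows "(\<lambda>\<omega>. \<omega> t) \<in> borel_measurable (filt t)"
proof (rule measurableI)
  fix B :: "ennreal set" assume "B \<in> sets borel"
  then show "(\<lambda>\<omega>. \<omega> t) -` B \<inter> space (filt t) \<in> sets (filt t)"
    unfolding sets_path_filt using assms
    by (intro sigma_sets.Basic) (auto intro!: exI[of _ t] exI[of _ B])
qed simp

lemma subalgebra_path_filt:
  "sets M = sets path_alg \<Longrightarrow> subalgebra M (path_filt T)"
  using filt_path_alg[of T] sets_eq_imp_space_eq[of M path_alg] by (auto simp: subalgebra_def)

text \<open>A Galmarino-type test: an event known at time \<open>T\<close> cannot separate two paths that agree up to
  \<open>T\<close>. It is what turns the assumption on the \<open>\<sigma>\<close>-algebra of \<open>\<tau>\<^sub>l \<and> \<tau>\<^sub>r\<close> into a statement about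
  single paths.\<close>

lemma path_filt_determined:
  assumes "D \<in> sets (path_filt T)" "\<omega> \<in> C_abs" "\<omega>' \<in> C_abs"
    and "\<And>u. 0 \<le> u \<Longrightarrow> Time (ennreal u) \<le> T \<Longrightarrow> \<omega> u = \<omega>' u"
  shows "\<omega> \<in> D \<longleftrightarrow> \<omega>' \<in> D"
  using assms(1) unfolding sets_path_filt
  by (induction rule: sigma_sets.induct) (use assms(2-) in auto)

lemma stopping_time_le_sets:
  assumes "stopping_time path_filt \<tau>" shows "{\<omega>\<in>C_abs. \<tau> \<omega> \<le> T} \<in> sets (path_filt T)"
  using stopping_timeD[OF assms, of T] by (simp add: pred_def)

lemma stopping_timeI_finite:
  assumes "\<And>t. 0 \<le> t \<Longrightarrow> {\<omega>\<in>C_abs. \<tau> \<omega> \<le> Time (ennreal t)} \<in> sets (filt t)"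
    and "{\<omega>\<in>C_abs. \<tau> \<omega> \<le> Time \<infinity>} \<in> sets path_alg"
  shows "stopping_time path_filt \<tau>"
proof
  fix T show "Measurable.pred (path_filt T) (\<lambda>\<omega>. \<tau> \<omega> \<le> T)"
  proof (cases T)
    case (Time u)
    show ?thesis
    proof (cases u)
      case (real t)
      then show ?thesis using assms(1)[of t] Time by (simp add: pred_def)
    next
      case top
      have "path_filt (Time \<infinity>) = path_alg" unfolding path_filt_def by simp
      then show ?thesis using assms(2) Time top by (simp add: pred_def)
    qed
  qed simp
qed

lemma stopping_time_le_filt:
  assumes "stopping_time path_filt \<tau>" "s \<le> t"
  shows "{\<omega>\<in>C_abs. \<tau> \<omega> \<le> Time (ennreal s)} \<in> sets (filt t)"
  using stopping_time_le_sets[OF assms(1)] filt_mono[OF assms(2)] by blast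

lemma space_stopped_alg [simp]: "space (stopped_alg \<tau>) = C_abs"
  unfolding stopped_alg_def using sets.sets_into_space[of _ path_alg]
  by (intro space_measure_of) auto

text \<open>The defining collection of sets is closed under complements because the events \<open>{\<tau> \<le> t}\<close>
  are known at time \<open>t\<close>; hence generating a \<open>\<sigma>\<close>-algebra from it adds nothing.\<close>

lemma sets_stopped_alg:
  assumes st: "stopping_time path_filt \<tau>"
  shows "sets (stopped_alg \<tau>) = {A \<in> sets path_alg.
    \<forall>t\<ge>0. A \<inter> {\<omega>. \<tau> \<omega> \<le> Time (ennreal t)} \<in> sets (filt t)}" (is "_ = ?S")
proof -
  have "sigma_algebra C_abs ?S"
    unfolding sigma_algebra_iff2
  proof (intro conjI ballI allI impI)
    show "?S \<subseteq> Pow C_abs" using sets.sets_into_space[of _ path_alg] by auto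
    show "{} \<in> ?S" by auto
    fix A assume A: "A \<in> ?S"
    have "(C_abs - A) \<inter> {\<omega>. \<tau> \<omega> \<le> Time (ennreal t)} \<in> sets (filt t)" if "t \<ge> 0" for t
    proof -
      have "(C_abs - A) \<inter> {\<omega>. \<tau> \<omega> \<le> Time (ennreal t)}
        = {\<omega>\<in>C_abs. \<tau> \<omega> \<le> Time (ennreal t)} - (A \<inter> {\<omega>. \<tau> \<omega> \<le> Time (ennreal t)})" by auto
      then show ?thesis using stopping_time_le_sets[OF st, of "Time (ennreal t)"] A that by auto
    qed
    then show "C_abs - A \<in> ?S" using A sets.compl_sets[of A path_alg] by auto
  next
    fix A :: "nat \<Rightarrow> path set" assume A: "range A \<subseteq> ?S"
    have "(\<Union>i. A i) \<inter> {\<omega>. \<tau> \<omega> \<le> Time (ennreal t)} \<in> sets (filt t)" if "t \<ge> 0" for t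
    proof -
      have eq: "(\<Union>i. A i) \<inter> {\<omega>. \<tau> \<omega> \<le> Time (ennreal t)} = (\<Union>i. A i \<inter> {\<omega>. \<tau> \<omega> \<le> Time (ennreal t)})"
        by auto
      have "A i \<inter> {\<omega>. \<tau> \<omega> \<le> Time (ennreal t)} \<in> sets (filt t)" for i using A that by auto
      then show ?thesis unfolding eq by (intro sets.countable_UN) auto
    qed
    then show "(\<Union>i. A i) \<in> ?S" using A by auto
  qed
  then show ?thesis unfolding stopped_alg_def by (rule sigma_algebra.sets_measure_of_eq)
qed

lemma stopped_alg_subset: "stopping_time path_filt \<tau> \<Longrightarrow> sets (stopped_alg \<tau>) \<subseteq> sets path_alg"
  by (auto simp: sets_stopped_alg)

lemma subalgebra_stopped_alg:
  "stopping_time path_filt \<tau> \<Longrightarrow> sets M = sets path_alg \<Longrightarrow> subalgebra M (stopped_alg \<tau>)"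
  using stopped_alg_subset[of \<tau>] sets_eq_imp_space_eq[of M path_alg] by (auto simp: subalgebra_def)

lemma stopped_algI:
  assumes "stopping_time path_filt \<tau>" "A \<in> sets path_alg"
    "\<And>t. 0 \<le> t \<Longrightarrow> A \<inter> {\<omega>. \<tau> \<omega> \<le> Time (ennreal t)} \<in> sets (filt t)"
  shows "A \<in> sets (stopped_alg \<tau>)"
  using assms by (simp add: sets_stopped_alg)

lemma stopped_algD:
  assumes "stopping_time path_filt \<tau>" "A \<in> sets (stopped_alg \<tau>)" "0 \<le> t"
  shows "A \<inter> {\<omega>. \<tau> \<omega> \<le> Time (ennreal t)} \<in> sets (filt t)"
  using assms by (simp add: sets_stopped_alg)

text \<open>The real time \<open>min \<tau> t\<close>. The values \<open>\<infinity>\<close> and \<open>Beyond\<close> of \<open>\<tau>\<close> are indistinguishable here.\<close>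

definition trunc :: "(path \<Rightarrow> ext_time) \<Rightarrow> real \<Rightarrow> path \<Rightarrow> real" where
  "trunc \<tau> t \<omega> = (if \<tau> \<omega> \<le> Time (ennreal t) then time_val (\<tau> \<omega>) else t)"

lemma stopped_eq_trunc: "stopped X \<tau> t \<omega> = X (trunc \<tau> t \<omega>) \<omega>"
  by (simp add: stopped_def trunc_def)

lemma time_val_nonneg [simp]: "0 \<le> time_val T"
  by (cases T) auto

lemma le_Time_iff:
  assumes "0 \<le> t"
  shows "T \<le> Time (ennreal t) \<longleftrightarrow> T < Time \<infinity> \<and> time_val T \<le> t"
proof (cases T)
  case (Time u)
  then show ?thesis using assms by (cases u) (auto simp: ennreal_le_iff top_unique)
qed simp

lemma Time_time_val: "T < Time \<infinity> \<Longrightarrow> Time (ennreal (time_val T)) = T"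
  by (cases T) auto

lemma trunc_eq_min:
  assumes "0 \<le> t"
  shows "trunc \<tau> t \<omega> = (if \<tau> \<omega> < Time \<infinity> then min (time_val (\<tau> \<omega>)) t else t)"
  using assms unfolding trunc_def by (auto simp: le_Time_iff)

lemma trunc_bounds: "0 \<le> t \<Longrightarrow> 0 \<le> trunc \<tau> t \<omega>" "0 \<le> t \<Longrightarrow> trunc \<tau> t \<omega> \<le> t"
  by (auto simp: trunc_eq_min)

text \<open>Polymorphic in the state space, since both \<open>Y\<close> (extended real values) and the coordinate
  process (values in \<open>[0,\<infinity>]\<close>) are stopped below.\<close>

definition cont_adapted :: "(real \<Rightarrow> path \<Rightarrow> 'a::topological_space) \<Rightarrow> bool" where
  "cont_adapted Z \<longleftrightarrow> (\<forall>t\<ge>0. Z t \<in> borel_measurable (filt t)) \<and>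
     (\<forall>\<omega>\<in>C_abs. continuous_on {0..} (\<lambda>t. Z t \<omega>))"

lemma cont_adapted_coordinate: "cont_adapted (\<lambda>t \<omega>. \<omega> t)"
  unfolding cont_adapted_def by (auto simp: measurable_coordinate) (simp add: C_abs_def)

text \<open>The time \<open>min \<tau> t\<close> is approximated from above on the grid of multiples of \<open>1/(k+1)\<close>, cut off
  at \<open>t\<close>. The approximation takes finitely many values, and whether it takes the value with
  index \<open>j\<close> is known at that very grid time, so discrete-time arguments apply to it.\<close>

definition grid_index :: "(path \<Rightarrow> ext_time) \<Rightarrow> real \<Rightarrow> nat \<Rightarrow> path \<Rightarrow> nat" where
  "grid_index \<tau> t k \<omega> =
     (LEAST j. \<tau> \<omega> \<le> Time (ennreal (real j / real (Suc k))) \<or> t \<le> real j / real (Suc k))"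

definition grid_time :: "real \<Rightarrow> nat \<Rightarrow> nat \<Rightarrow> real" where
  "grid_time t k j = min t (real j / real (Suc k))"

lemma grid_time_bounds: "0 \<le> t \<Longrightarrow> 0 \<le> grid_time t k j" "grid_time t k j \<le> t"
  by (auto simp: grid_time_def)

definition grid_bound :: "real \<Rightarrow> nat \<Rightarrow> nat" where
  "grid_bound t k = nat \<lceil>t * real (Suc k)\<rceil>"

lemma grid_bound_ge: "t \<le> real (grid_bound t k) / real (Suc k)"
  unfolding grid_bound_def by (simp add: pos_le_divide_eq del: of_nat_Suc) linarith

lemma grid_index_le: "grid_index \<tau> t k \<omega> \<le> j \<longleftrightarrow>
   \<tau> \<omega> \<le> Time (ennreal (real j / real (Suc k))) \<or> t \<le> real j / real (Suc k)" (is "_ \<longleftrightarrow> ?P j")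
proof
  have mono: "?P j" if "?P i" "i \<le> j" for i j
  proof -
    have "real i / real (Suc k) \<le> real j / real (Suc k)"
      using that(2) by (simp add: divide_right_mono)
    moreover from this have "Time (ennreal (real i / real (Suc k))) \<le> Time (ennreal (real j / real (Suc k)))"
      by (simp only: ext_time_simps) (rule ennreal_leI)
    ultimately show ?thesis using that(1) by (metis order_trans)
  qed
  assume "grid_index \<tau> t k \<omega> \<le> j"
  moreover have "?P (grid_index \<tau> t k \<omega>)"
    unfolding grid_index_def by (rule LeastI[where P="?P" and k="grid_bound t k"]) (simp only: grid_bound_ge simp_thms)
  ultimately show "?P j" by (rule mono[rotated])
next
  assume "?P j" then show "grid_index \<tau> t k \<omega> \<le> j"
    unfolding grid_index_def by (rule Least_le)
qed

lemma grid_index_bound: "grid_index \<tau> t k \<omega> \<le> grid_bound t k"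
  using grid_bound_ge by (simp add: grid_index_le del: of_nat_Suc)

lemma grid_index_sets:
  assumes st: "stopping_time path_filt \<tau>"
  shows "{\<omega>\<in>C_abs. grid_index \<tau> t k \<omega> = j} \<in> sets (filt (grid_time t k j))"
proof -
  have le: "{\<omega>\<in>C_abs. grid_index \<tau> t k \<omega> \<le> i} \<in> sets (filt (grid_time t k i))" for i
  proof (cases "t \<le> real i / real (Suc k)")
    case True
    then have "{\<omega>\<in>C_abs. grid_index \<tau> t k \<omega> \<le> i} = space (filt (grid_time t k i))"
      by (auto simp: grid_index_le simp del: of_nat_Suc)
    then show ?thesis by (simp only: sets.top)
  next
    case False
    then show ?thesis using stopping_time_le_sets[OF st, of "Time (ennreal (real i / real (Suc k)))"]
      by (simp add: grid_index_le grid_time_def min_def del: of_nat_Suc)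
  qed
  show ?thesis
  proof (cases j)
    case 0
    then show ?thesis using le[of 0] by simp
  next
    case (Suc i)
    have "grid_time t k i \<le> grid_time t k j"
      unfolding grid_time_def by (intro min.mono divide_right_mono) (auto simp: Suc)
    then have "{\<omega>\<in>C_abs. grid_index \<tau> t k \<omega> \<le> i} \<in> sets (filt (grid_time t k j))"
      using le[of i] filt_mono by blast
    moreover have "{\<omega>\<in>C_abs. grid_index \<tau> t k \<omega> = j} =
      {\<omega>\<in>C_abs. grid_index \<tau> t k \<omega> \<le> j} - {\<omega>\<in>C_abs. grid_index \<tau> t k \<omega> \<le> i}" using Suc by auto
    ultimately show ?thesis using le[of j] by auto
  qed
qed

lemma grid_tendsto_trunc:
  assumes "0 \<le> t"
  shows "(\<lambda>k. grid_time t k (grid_index \<tau> t k \<omega>)) \<longlonglongrightarrow> trunc \<tau> t \<omega>"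
proof (rule tendsto_sandwich)
  have b: "trunc \<tau> t \<omega> \<le> grid_time t k (grid_index \<tau> t k \<omega>) \<and>
     grid_time t k (grid_index \<tau> t k \<omega>) \<le> trunc \<tau> t \<omega> + 1 / real (Suc k)" for k
  proof -
    let ?j = "grid_index \<tau> t k \<omega>" and ?K = "real (Suc k)"
    have 1: "\<tau> \<omega> \<le> Time (ennreal (real ?j / ?K)) \<or> t \<le> real ?j / ?K"
      by (rule iffD1[OF grid_index_le order_refl])
    have nn: "0 \<le> real i / ?K" for i by simp
    have "trunc \<tau> t \<omega> \<le> real ?j / ?K"
      using 1
    proof
      assume "\<tau> \<omega> \<le> Time (ennreal (real ?j / ?K))"
      then have "\<tau> \<omega> < Time \<infinity> \<and> time_val (\<tau> \<omega>) \<le> real ?j / ?K" by (rule iffD1[OF le_Time_iff[OF nn]])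
      then show ?thesis unfolding trunc_eq_min[OF assms] by (simp only: if_True min.coboundedI1)
    next
      assume "t \<le> real ?j / ?K"
      then show ?thesis by (rule order_trans[OF trunc_bounds(2)[OF assms]])
    qed
    moreover have "grid_time t k ?j \<le> trunc \<tau> t \<omega> + 1 / ?K"
    proof (cases ?j)
      case 0
      have "0 \<le> 1 / ?K" by simp
      then show ?thesis using 0 assms trunc_bounds(1)[OF assms, of \<tau> \<omega>] by (simp add: grid_time_def del: of_nat_Suc)
    next
      case (Suc i)
      then have "\<not> ?j \<le> i" by simp
      then have n: "\<not> \<tau> \<omega> \<le> Time (ennreal (real i / ?K))" "\<not> t \<le> real i / ?K"
        by (simp_all add: grid_index_le del: of_nat_Suc)
      have "real i / ?K \<le> trunc \<tau> t \<omega>"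
        using n(2) iffD2[OF le_Time_iff[OF nn, of "\<tau> \<omega>" i]] n(1)
        by (auto simp: trunc_eq_min[OF assms] simp del: of_nat_Suc) (metis linear)
      moreover have "real ?j / ?K = real i / ?K + 1 / ?K" unfolding Suc by (simp add: add_divide_distrib)
      ultimately show ?thesis unfolding grid_time_def by linarith
    qed
    ultimately show ?thesis using trunc_bounds(2)[OF assms, of \<tau> \<omega>] by (simp add: grid_time_def)
  qed
  show "\<forall>\<^sub>F k in sequentially. trunc \<tau> t \<omega> \<le> grid_time t k (grid_index \<tau> t k \<omega>)"
    "\<forall>\<^sub>F k in sequentially. grid_time t k (grid_index \<tau> t k \<omega>) \<le> trunc \<tau> t \<omega> + 1 / real (Suc k)"
    using b by auto
  show "(\<lambda>k. trunc \<tau> t \<omega>) \<longlonglongrightarrow> trunc \<tau> t \<omega>" by simp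
  show "(\<lambda>k. trunc \<tau> t \<omega> + 1 / real (Suc k)) \<longlonglongrightarrow> trunc \<tau> t \<omega>"
    using tendsto_add[OF tendsto_const LIMSEQ_Suc[OF lim_1_over_n]] by simp
qed

lemma cont_adapted_grid_tendsto:
  assumes "cont_adapted Z" "\<omega> \<in> C_abs" "0 \<le> t"
  shows "(\<lambda>k. Z (grid_time t k (grid_index \<tau> t k \<omega>)) \<omega>) \<longlonglongrightarrow> Z (trunc \<tau> t \<omega>) \<omega>"
proof -
  have "continuous_on {0..} (\<lambda>t. Z t \<omega>)" using assms by (auto simp: cont_adapted_def)
  from continuous_on_tendsto_compose[OF this grid_tendsto_trunc[OF assms(3)]] show ?thesis
    using trunc_bounds[OF assms(3)] grid_time_bounds(1)[OF assms(3)] by auto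
qed

text \<open>Adapted continuous processes are progressively measurable: along the grid the stopped value is
  a countable case distinction, and continuity passes to the limit.\<close>

lemma measurable_trunc:
  fixes Z :: "real \<Rightarrow> path \<Rightarrow> 'a::{complete_linorder, second_countable_topology, linorder_topology}"
  assumes Z: "cont_adapted Z" and st: "stopping_time path_filt \<tau>" and t: "0 \<le> t"
  shows "(\<lambda>\<omega>. Z (trunc \<tau> t \<omega>) \<omega>) \<in> borel_measurable (filt t)"
proof (rule borel_measurable_LIMSEQ_order)
  show "(\<lambda>k. Z (grid_time t k (grid_index \<tau> t k \<omega>)) \<omega>) \<longlonglongrightarrow> Z (trunc \<tau> t \<omega>) \<omega>"
    if "\<omega> \<in> space (filt t)" for \<omega>
    using that cont_adapted_grid_tendsto[OF Z _ t] by simp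
next
  fix k
  show "(\<lambda>\<omega>. Z (grid_time t k (grid_index \<tau> t k \<omega>)) \<omega>) \<in> borel_measurable (filt t)"
  proof (rule measurable_compose_countable)
    show "Z (grid_time t k i) \<in> borel_measurable (filt t)" for i
      using Z grid_time_bounds(1)[OF t, of k i] grid_time_bounds(2)[of t k i]
      by (auto simp: cont_adapted_def intro!: measurable_path_filt_mono[of "Time (ennreal (grid_time t k i))" "Time (ennreal t)"] ennreal_leI)
    show "grid_index \<tau> t k \<in> measurable (filt t) (count_space UNIV)"
    proof (rule measurable_count_space_eq_countable[THEN iffD2])
      show "grid_index \<tau> t k \<in> space (filt t) \<rightarrow> UNIV \<and> (\<forall>a\<in>UNIV. grid_index \<tau> t k -` {a} \<inter> space (filt t) \<in> sets (filt t))"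
      proof (intro conjI ballI)
        fix a show "grid_index \<tau> t k -` {a} \<inter> space (filt t) \<in> sets (filt t)"
          using grid_index_sets[OF st, of t k a] filt_mono[OF grid_time_bounds(2), of t k a]
          by (auto simp: vimage_def Int_def conj_commute)
      qed simp
    qed simp
  qed
qed

section \<open>Bounded optional stopping for continuous local martingales\<close>

lemma trunc_continuous:
  "continuous_on {0..} (\<lambda>t. trunc \<tau> t \<omega>)"
proof -
  have "continuous_on {0..} (\<lambda>t. if \<tau> \<omega> < Time \<infinity> then min (time_val (\<tau> \<omega>)) t else t)"
    by (cases "\<tau> \<omega> < Time \<infinity>") (auto intro!: continuous_intros)
  then show ?thesis by (rule continuous_on_eq) (auto simp: trunc_eq_min)
qed

lemma cont_adapted_stopped:
  assumes Z: "cont_adapted Z" and st: "stopping_time path_filt \<tau>"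
  shows "cont_adapted (stopped Z \<tau>)"
  unfolding cont_adapted_def
proof safe
  fix t :: real assume "0 \<le> t"
  then show "stopped Z \<tau> t \<in> borel_measurable (filt t)"
    using measurable_trunc[OF Z st] by (simp add: stopped_eq_trunc[abs_def])
next
  fix \<omega> assume "\<omega> \<in> C_abs"
  then have "continuous_on {0..} (\<lambda>t. Z t \<omega>)" using Z by (auto simp: cont_adapted_def)
  then have "continuous_on {0..} (\<lambda>t. Z (trunc \<tau> t \<omega>) \<omega>)"
    by (rule continuous_on_compose2[OF _ trunc_continuous]) (auto simp: trunc_bounds)
  then show "continuous_on {0..} (\<lambda>t. stopped Z \<tau> t \<omega>)" by (simp add: stopped_eq_trunc)
qed

lemma trunc_trunc:
  assumes "0 \<le> t" shows "trunc \<tau> (trunc \<sigma> t \<omega>) \<omega> = trunc \<sigma> (trunc \<tau> t \<omega>) \<omega>"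
  using trunc_bounds[OF assms] by (simp add: trunc_eq_min assms min.commute min.left_commute)

lemma martingale_set_integral:
  assumes M: "prob_space M" "sets M = sets path_alg" and N: "martingale M N"
    and "0 \<le> s" "s \<le> t" "A \<in> sets (filt s)"
  shows "(\<integral>\<omega>\<in>A. real_of_ereal (N t \<omega>) \<partial>M) = (\<integral>\<omega>\<in>A. real_of_ereal (N s \<omega>) \<partial>M)"
proof -
  interpret M: prob_space M by fact
  interpret finite_measure_subalgebra M "filt s"
    by unfold_locales (rule subalgebra_path_filt[OF M(2)])
  have A: "A \<in> sets M" using assms(6) subalg by (auto simp: subalgebra_def)
  have "(\<integral>\<omega>\<in>A. real_of_ereal (N t \<omega>) \<partial>M) =
    (\<integral>\<omega>\<in>A. real_cond_exp M (filt s) (\<lambda>\<omega>. real_of_ereal (N t \<omega>)) \<omega> \<partial>M)"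
    using N assms by (intro real_cond_exp_intA) (auto simp: martingale_def)
  also have "\<dots> = (\<integral>\<omega>\<in>A. real_of_ereal (N s \<omega>) \<partial>M)"
  proof (rule set_lebesgue_integral_cong_AE)
    show "(\<lambda>x. real_of_ereal (N s x)) \<in> borel_measurable M"
      using N assms by (auto simp: martingale_def)
    show "real_cond_exp M (filt s) (\<lambda>\<omega>. real_of_ereal (N t \<omega>)) \<in> borel_measurable M"
      by (rule measurable_from_subalg[OF subalg]) simp
    have "AE x in M. real_cond_exp M (filt s) (\<lambda>\<omega>. real_of_ereal (N t \<omega>)) x = real_of_ereal (N s x)"
      using N assms(4,5) unfolding martingale_def by blast
    then show "AE x\<in>A in M. real_cond_exp M (filt s) (\<lambda>\<omega>. real_of_ereal (N t \<omega>)) x = real_of_ereal (N s x)"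
      by eventually_elim simp
  qed (rule A)
  finally show ?thesis .
qed

text \<open>Let \<open>G\<close> be the value of the martingale \<open>x\<close> at the grid approximation of \<open>\<sigma>\<close> and let \<open>B\<close> be the
  part of \<open>A\<close> on which \<open>\<sigma>\<close> exceeds \<open>s\<close>. Only the limit of \<open>G\<close> is bounded, not \<open>G\<close> itself. The
  identity \<open>E[G; B] = E[x\<^sub>t; B]\<close> may however be restricted to the event \<open>\<bar>G\<bar> \<le> C\<close>, which is known at
  the grid time. For \<open>C\<close> above the bound \<open>K\<close> this event is eventually certain, so that bounded
  convergence applies on the left and domination by \<open>\<bar>x\<^sub>t\<bar>\<close> on the right. No uniform integrability
  of the discretized values has to be established.\<close>

lemma martingale_bounded_stopping:
  assumes M: "prob_space M" "sets M = sets path_alg"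
    and N: "cont_adapted N" "martingale M N" and st: "stopping_time path_filt \<sigma>"
    and bound: "AE \<omega> in M. \<forall>t\<ge>0. \<bar>N (trunc \<sigma> t \<omega>) \<omega>\<bar> \<le> ereal K"
    and st': "0 \<le> s" "s \<le> t" and A: "A \<in> sets (filt s)"
  shows "(\<integral>\<omega>\<in>A. real_of_ereal (N (trunc \<sigma> t \<omega>) \<omega>) \<partial>M) = (\<integral>\<omega>\<in>A. real_of_ereal (N (trunc \<sigma> s \<omega>) \<omega>) \<partial>M)"
proof -
  interpret M: prob_space M by fact
  define x where "x u \<omega> = real_of_ereal (N u \<omega>)" for u \<omega>
  have t: "0 \<le> t" using st' by simp
  have int_x: "integrable M (x u)" if "0 \<le> u" for u
    using N(2) that by (auto simp: martingale_def x_def[abs_def])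
  have subM: "B \<in> sets (filt u) \<Longrightarrow> B \<in> sets M" for B u
    using filt_path_alg M(2) by blast
  have meas_x: "x u \<in> borel_measurable (filt u)" if "0 \<le> u" for u
    using N(1) that by (auto simp: x_def[abs_def] cont_adapted_def)
  have spM: "space M = C_abs" using sets_eq_imp_space_eq[OF M(2)] by simp
  have eqx: "(\<integral>\<omega>. indicator B \<omega> * x t \<omega> \<partial>M) = (\<integral>\<omega>. indicator B \<omega> * x u \<omega> \<partial>M)"
    if "0 \<le> u" "u \<le> t" "B \<in> sets (filt u)" for u B
    using martingale_set_integral[OF M N(2) that] by (simp add: set_lebesgue_integral_def x_def)
  define xs where "xs u \<omega> = x (trunc \<sigma> u \<omega>) \<omega>" for u \<omega>
  have meas_xs: "xs u \<in> borel_measurable M" if "0 \<le> u" for u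
  proof -
    have "(\<lambda>\<omega>. N (trunc \<sigma> u \<omega>) \<omega>) \<in> borel_measurable (filt u)" using measurable_trunc[OF N(1) st that] .
    then have "xs u \<in> borel_measurable (filt u)" by (simp add: xs_def[abs_def] x_def)
    then show ?thesis by (rule measurable_from_subalg[OF subalgebra_path_filt[OF M(2)]])
  qed
  have bound_xs: "AE \<omega> in M. \<bar>xs u \<omega>\<bar> \<le> K" if "0 \<le> u" for u
    using bound
  proof eventually_elim
    case (elim \<omega>)
    then have "\<bar>N (trunc \<sigma> u \<omega>) \<omega>\<bar> \<le> ereal K" using that by blast
    then show ?case by (cases "N (trunc \<sigma> u \<omega>) \<omega>") (auto simp: xs_def x_def)
  qed
  have int_xs: "integrable M (xs u)" if "0 \<le> u" for u
    by (rule M.integrable_const_bound[of _ K]) (use bound_xs[OF that] meas_xs[OF that] in auto)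
  define G where "G k \<omega> = x (grid_time t k (grid_index \<sigma> t k \<omega>)) \<omega>" for k \<omega>
  \<comment> \<open>strictly above \<open>K\<close>, so that convergence of \<open>G\<close> forces \<open>\<bar>G\<bar> \<le> C\<close> eventually\<close>
  define C where "C = \<bar>K\<bar> + 1"
  define B where "B = A \<inter> {\<omega>\<in>C_abs. \<not> \<sigma> \<omega> \<le> Time (ennreal s)}"
  have A_sub: "A \<subseteq> C_abs" using sets.sets_into_space[OF A] by simp
  have B: "B \<in> sets (filt s)"
  proof -
    have "B = A - {\<omega>\<in>C_abs. \<sigma> \<omega> \<le> Time (ennreal s)}" using A_sub by (auto simp: B_def)
    then show ?thesis using A stopping_time_le_sets[OF st, of "Time (ennreal s)"] by auto
  qed
  define S where "S k j = B \<inter> {\<omega>\<in>C_abs. grid_index \<sigma> t k \<omega> = j} \<inter> {\<omega>\<in>C_abs. \<bar>x (grid_time t k j) \<omega>\<bar> \<le> C}" for k j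
  have S_sets: "S k j \<in> sets (filt (grid_time t k j))" for k j
  proof (cases "s \<le> grid_time t k j")
    case True
    have "{\<omega>\<in>space (filt (grid_time t k j)). \<bar>x (grid_time t k j) \<omega>\<bar> \<le> C} \<in> sets (filt (grid_time t k j))"
      using meas_x[OF grid_time_bounds(1)[OF t, of k j]] by measurable
    then show ?thesis unfolding S_def using grid_index_sets[OF st, of t k j] B filt_mono[OF True] by auto
  next
    case False
    \<comment> \<open>on \<open>B\<close> the grid time is at least \<open>s\<close>, as it lies above \<open>\<sigma>\<close> unless it is \<open>t\<close>\<close>
    have "S k j = {}"
    proof (rule ccontr)
      assume "S k j \<noteq> {}"
      then obtain \<omega> where w: "\<not> \<sigma> \<omega> \<le> Time (ennreal s)" "grid_index \<sigma> t k \<omega> \<le> j" by (auto simp: S_def B_def)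
      have j: "real j / real (Suc k) \<le> s" "\<not> t \<le> real j / real (Suc k)" using False st' by (auto simp: grid_time_def min_def split: if_splits)
      then have "\<sigma> \<omega> \<le> Time (ennreal (real j / real (Suc k)))" using w(2) by (simp only: grid_index_le simp_thms)
      moreover have "Time (ennreal (real j / real (Suc k))) \<le> Time (ennreal s)"
        using j(1) by (simp only: ext_time_simps) (rule ennreal_leI)
      ultimately show False using w(1) by (metis order_trans)
    qed
    then show ?thesis by simp
  qed
  have G_bounds: "0 \<le> grid_time t k j" "grid_time t k j \<le> t" for k j using grid_time_bounds t by auto
  have sum_S: "(\<Sum>j\<le>grid_bound t k. indicator (S k j) \<omega> * f j) = indicator B \<omega> * (indicator {\<omega>. \<bar>G k \<omega>\<bar> \<le> C} \<omega> * f (grid_index \<sigma> t k \<omega>))"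
    if "\<omega> \<in> space M" for k \<omega> and f :: "nat \<Rightarrow> real"
  proof -
    have "(\<Sum>j\<le>grid_bound t k. indicator (S k j) \<omega> * f j) =
       (\<Sum>j\<in>{grid_index \<sigma> t k \<omega>}. indicator (S k j) \<omega> * f j)"
      by (rule sum.mono_neutral_right) (use grid_index_bound in \<open>auto simp: S_def indicator_def\<close>)
    also have "\<dots> = indicator B \<omega> * (indicator {\<omega>. \<bar>G k \<omega>\<bar> \<le> C} \<omega> * f (grid_index \<sigma> t k \<omega>))"
      using that spM by (auto simp: S_def G_def indicator_def)
    finally show ?thesis .
  qed
  have int_S: "integrable M (\<lambda>\<omega>. indicator (S k j) \<omega> * x u \<omega>)" if "0 \<le> u" for k j u
    using integrable_mult_indicator[OF subM[OF S_sets[of k j]] int_x[OF that]] by simp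
  have key: "(\<integral>\<omega>. indicator B \<omega> * (indicator {\<omega>. \<bar>G k \<omega>\<bar> \<le> C} \<omega> * G k \<omega>) \<partial>M) =
     (\<integral>\<omega>. indicator B \<omega> * (indicator {\<omega>. \<bar>G k \<omega>\<bar> \<le> C} \<omega> * x t \<omega>) \<partial>M)" for k
  proof -
    have "(\<integral>\<omega>. indicator B \<omega> * (indicator {\<omega>. \<bar>G k \<omega>\<bar> \<le> C} \<omega> * G k \<omega>) \<partial>M)
       = (\<integral>\<omega>. (\<Sum>j\<le>grid_bound t k. indicator (S k j) \<omega> * x (grid_time t k j) \<omega>) \<partial>M)"
      by (rule Bochner_Integration.integral_cong[OF refl]) (simp only: sum_S, simp add: G_def)
    also have "\<dots> = (\<Sum>j\<le>grid_bound t k. \<integral>\<omega>. indicator (S k j) \<omega> * x (grid_time t k j) \<omega> \<partial>M)"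
      by (rule Bochner_Integration.integral_sum) (rule int_S[OF G_bounds(1)])
    also have "\<dots> = (\<Sum>j\<le>grid_bound t k. \<integral>\<omega>. indicator (S k j) \<omega> * x t \<omega> \<partial>M)"
      using eqx[OF G_bounds S_sets] by simp
    also have "\<dots> = (\<integral>\<omega>. (\<Sum>j\<le>grid_bound t k. indicator (S k j) \<omega> * x t \<omega>) \<partial>M)"
      by (rule Bochner_Integration.integral_sum[symmetric]) (rule int_S[OF t])
    also have "\<dots> = (\<integral>\<omega>. indicator B \<omega> * (indicator {\<omega>. \<bar>G k \<omega>\<bar> \<le> C} \<omega> * x t \<omega>) \<partial>M)"
      by (rule Bochner_Integration.integral_cong[OF refl]) (simp only: sum_S)
    finally show ?thesis .
  qed
  have meas_sumS: "(\<lambda>\<omega>. indicator B \<omega> * (indicator {\<omega>. \<bar>G k \<omega>\<bar> \<le> C} \<omega> * G k \<omega>)) \<in> borel_measurable M"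
    "(\<lambda>\<omega>. indicator B \<omega> * (indicator {\<omega>. \<bar>G k \<omega>\<bar> \<le> C} \<omega> * x t \<omega>)) \<in> borel_measurable M" for k
  proof -
    have "(\<lambda>\<omega>. \<Sum>j\<le>grid_bound t k. indicator (S k j) \<omega> * x (grid_time t k j) \<omega>) \<in> borel_measurable M"
      by (intro borel_measurable_sum borel_measurable_integrable int_S G_bounds)
    then show "(\<lambda>\<omega>. indicator B \<omega> * (indicator {\<omega>. \<bar>G k \<omega>\<bar> \<le> C} \<omega> * G k \<omega>)) \<in> borel_measurable M"
      by (rule measurable_cong[THEN iffD1, rotated]) (simp only: sum_S, simp add: G_def)
    have "(\<lambda>\<omega>. \<Sum>j\<le>grid_bound t k. indicator (S k j) \<omega> * x t \<omega>) \<in> borel_measurable M"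
      by (intro borel_measurable_sum borel_measurable_integrable int_S t)
    then show "(\<lambda>\<omega>. indicator B \<omega> * (indicator {\<omega>. \<bar>G k \<omega>\<bar> \<le> C} \<omega> * x t \<omega>)) \<in> borel_measurable M"
      by (rule measurable_cong[THEN iffD1, rotated]) (simp only: sum_S)
  qed
  have G_lim: "AE \<omega> in M. (\<lambda>k. G k \<omega>) \<longlonglongrightarrow> xs t \<omega>"
    using bound AE_space
  proof eventually_elim
    case (elim \<omega>)
    let ?z = "N (trunc \<sigma> t \<omega>) \<omega>"
    have "\<bar>?z\<bar> \<le> ereal K" using elim t by blast
    then have z: "?z = ereal (real_of_ereal ?z)" by (cases ?z) auto
    have "(\<lambda>k. N (grid_time t k (grid_index \<sigma> t k \<omega>)) \<omega>) \<longlonglongrightarrow> ereal (real_of_ereal ?z)"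
      using cont_adapted_grid_tendsto[OF N(1) _ t, of \<omega> \<sigma>] elim spM z by simp
    from lim_real_of_ereal[OF this] show ?case by (simp add: G_def x_def xs_def)
  qed
  have G_small: "AE \<omega> in M. \<forall>\<^sub>F k in sequentially. \<bar>G k \<omega>\<bar> \<le> C"
    using G_lim bound_xs[OF t]
  proof eventually_elim
    case (elim \<omega>)
    have "(\<lambda>k. \<bar>G k \<omega>\<bar>) \<longlonglongrightarrow> \<bar>xs t \<omega>\<bar>" using elim(1) by (rule tendsto_rabs)
    moreover have "\<bar>xs t \<omega>\<bar> < C" using elim(2) by (auto simp: C_def)
    ultimately have "\<forall>\<^sub>F k in sequentially. \<bar>G k \<omega>\<bar> < C" by (rule order_tendstoD(2))
    then show ?case by eventually_elim simp
  qed
  have l1: "(\<lambda>k. \<integral>\<omega>. indicator B \<omega> * (indicator {\<omega>. \<bar>G k \<omega>\<bar> \<le> C} \<omega> * G k \<omega>) \<partial>M) \<longlonglongrightarrow>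
     (\<integral>\<omega>. indicator B \<omega> * xs t \<omega> \<partial>M)"
  proof (rule integral_dominated_convergence[where w="\<lambda>_. C"])
    show "AE \<omega> in M. (\<lambda>k. indicator B \<omega> * (indicator {\<omega>. \<bar>G k \<omega>\<bar> \<le> C} \<omega> * G k \<omega>)) \<longlonglongrightarrow> indicator B \<omega> * xs t \<omega>"
      using G_small G_lim
    proof eventually_elim
      case (elim \<omega>)
      have "\<forall>\<^sub>F k in sequentially. indicator B \<omega> * G k \<omega> = indicator B \<omega> * (indicator {\<omega>. \<bar>G k \<omega>\<bar> \<le> C} \<omega> * G k \<omega>)"
        using elim(1) by eventually_elim simp
      from Lim_transform_eventually[OF tendsto_mult_left[OF elim(2)] this] show ?case .
    qed
    show "AE \<omega> in M. norm (indicator B \<omega> * (indicator {\<omega>. \<bar>G k \<omega>\<bar> \<le> C} \<omega> * G k \<omega>)) \<le> C" for k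
      by (rule AE_I2) (auto simp: indicator_def C_def)
  qed (use meas_sumS meas_xs[OF t] subM[OF B] in auto)
  have l2: "(\<lambda>k. \<integral>\<omega>. indicator B \<omega> * (indicator {\<omega>. \<bar>G k \<omega>\<bar> \<le> C} \<omega> * x t \<omega>) \<partial>M) \<longlonglongrightarrow>
     (\<integral>\<omega>. indicator B \<omega> * x t \<omega> \<partial>M)"
  proof (rule integral_dominated_convergence[where w="\<lambda>\<omega>. \<bar>x t \<omega>\<bar>"])
    show "AE \<omega> in M. (\<lambda>k. indicator B \<omega> * (indicator {\<omega>. \<bar>G k \<omega>\<bar> \<le> C} \<omega> * x t \<omega>)) \<longlonglongrightarrow> indicator B \<omega> * x t \<omega>"
      using G_small
    proof eventually_elim
      case (elim \<omega>)
      have "\<forall>\<^sub>F k in sequentially. indicator B \<omega> * x t \<omega> = indicator B \<omega> * (indicator {\<omega>. \<bar>G k \<omega>\<bar> \<le> C} \<omega> * x t \<omega>)"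
        using elim(1) by eventually_elim simp
      from Lim_transform_eventually[OF tendsto_const this] show ?case .
    qed
    show "AE \<omega> in M. norm (indicator B \<omega> * (indicator {\<omega>. \<bar>G k \<omega>\<bar> \<le> C} \<omega> * x t \<omega>)) \<le> \<bar>x t \<omega>\<bar>" for k
      by (rule AE_I2) (auto simp: indicator_def)
  qed (use meas_sumS int_x[OF t] subM[OF B] in auto)
  have "(\<integral>\<omega>. indicator B \<omega> * xs t \<omega> \<partial>M) = (\<integral>\<omega>. indicator B \<omega> * x t \<omega> \<partial>M)"
    using LIMSEQ_unique[OF l1] l2 unfolding key by blast
  also have "\<dots> = (\<integral>\<omega>. indicator B \<omega> * x s \<omega> \<partial>M)" by (rule eqx[OF st' B])
  also have "\<dots> = (\<integral>\<omega>. indicator B \<omega> * xs s \<omega> \<partial>M)"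
    by (rule Bochner_Integration.integral_cong[OF refl]) (auto simp: B_def indicator_def xs_def trunc_def)
  finally have B_eq: "(\<integral>\<omega>. indicator B \<omega> * xs t \<omega> \<partial>M) = (\<integral>\<omega>. indicator B \<omega> * xs s \<omega> \<partial>M)" .
  have AB: "A - B \<in> sets M" using A B subM by blast
  have split: "(\<integral>\<omega>. indicator A \<omega> * xs u \<omega> \<partial>M) = (\<integral>\<omega>. indicator B \<omega> * xs u \<omega> \<partial>M) + (\<integral>\<omega>. indicator (A - B) \<omega> * xs u \<omega> \<partial>M)"
    if "0 \<le> u" for u
  proof -
    have "(\<integral>\<omega>. indicator A \<omega> * xs u \<omega> \<partial>M) = (\<integral>\<omega>. indicator B \<omega> * xs u \<omega> + indicator (A - B) \<omega> * xs u \<omega> \<partial>M)"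
      by (rule Bochner_Integration.integral_cong[OF refl]) (auto simp: indicator_def B_def)
    also have "\<dots> = (\<integral>\<omega>. indicator B \<omega> * xs u \<omega> \<partial>M) + (\<integral>\<omega>. indicator (A - B) \<omega> * xs u \<omega> \<partial>M)"
      using integrable_mult_indicator[OF subM[OF B] int_xs[OF that]] integrable_mult_indicator[OF AB int_xs[OF that]]
      by (intro Bochner_Integration.integral_add) auto
    finally show ?thesis .
  qed
  have "(\<integral>\<omega>. indicator (A - B) \<omega> * xs t \<omega> \<partial>M) = (\<integral>\<omega>. indicator (A - B) \<omega> * xs s \<omega> \<partial>M)"
  proof (rule Bochner_Integration.integral_cong[OF refl])
    fix \<omega>
    have "trunc \<sigma> t \<omega> = trunc \<sigma> s \<omega>" if "\<omega> \<in> A - B"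
    proof -
      have "\<sigma> \<omega> < Time \<infinity>" "time_val (\<sigma> \<omega>) \<le> s" using that A_sub le_Time_iff[OF st'(1)] by (auto simp: B_def)
      then show ?thesis using st' by (simp add: trunc_eq_min t)
    qed
    then show "indicator (A - B) \<omega> * xs t \<omega> = indicator (A - B) \<omega> * xs s \<omega>"
      by (cases "\<omega> \<in> A - B") (simp_all add: xs_def indicator_def)
  qed
  then have "(\<integral>\<omega>. indicator A \<omega> * xs t \<omega> \<partial>M) = (\<integral>\<omega>. indicator A \<omega> * xs s \<omega> \<partial>M)"
    using split[OF t] split[OF st'(1)] B_eq by simp
  then show ?thesis by (simp add: set_lebesgue_integral_def xs_def x_def)
qed

text \<open>Stopping additionally along a localizing sequence gives the identity for martingales, and the
  sequence is removed by bounded convergence: almost surely it eventually exceeds any given time.\<close>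

lemma local_martingale_bounded_stopping:
  assumes M: "prob_space M" "sets M = sets path_alg"
    and Z: "cont_adapted Z" "local_martingale M Z" and st: "stopping_time path_filt \<sigma>"
    and bound: "AE \<omega> in M. \<forall>t\<ge>0. \<bar>Z (trunc \<sigma> t \<omega>) \<omega>\<bar> \<le> ereal K"
    and st': "0 \<le> s" "s \<le> t" and A: "A \<in> sets (filt s)"
  shows "(\<integral>\<omega>\<in>A. real_of_ereal (Z (trunc \<sigma> t \<omega>) \<omega>) \<partial>M) = (\<integral>\<omega>\<in>A. real_of_ereal (Z (trunc \<sigma> s \<omega>) \<omega>) \<partial>M)"
proof -
  interpret M: prob_space M by fact
  from Z(2) obtain \<tau> where \<tau>: "\<And>n. stopping_time path_filt (\<tau> n)"
    "\<And>n \<omega>. \<omega> \<in> C_abs \<Longrightarrow> \<tau> n \<omega> \<le> \<tau> (Suc n) \<omega>"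
    "AE \<omega> in M. \<forall>t\<ge>0. \<exists>n. Time (ennreal t) < \<tau> n \<omega>"
    "\<And>n. martingale M (stopped Z (\<tau> n))" unfolding local_martingale_def by auto
  have t: "0 \<le> t" using st' by simp
  have spM: "space M = C_abs" using sets_eq_imp_space_eq[OF M(2)] by simp
  have AM: "A \<in> sets M" using A filt_path_alg M(2) by blast
  define N where "N n = stopped Z (\<tau> n)" for n
  have N_eq: "N n (trunc \<sigma> u \<omega>) \<omega> = Z (trunc \<sigma> (trunc (\<tau> n) u \<omega>) \<omega>) \<omega>" if "0 \<le> u" for n u \<omega>
    using trunc_trunc[OF that] by (simp add: N_def stopped_eq_trunc)
  have Nb: "AE \<omega> in M. \<forall>t\<ge>0. \<bar>N n (trunc \<sigma> t \<omega>) \<omega>\<bar> \<le> ereal K" for n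
    using bound by eventually_elim (auto simp: N_eq trunc_bounds)
  have Nc: "cont_adapted (N n)" for n unfolding N_def by (rule cont_adapted_stopped[OF Z(1) \<tau>(1)])
  have N_id: "(\<integral>\<omega>\<in>A. real_of_ereal (N n (trunc \<sigma> t \<omega>) \<omega>) \<partial>M) = (\<integral>\<omega>\<in>A. real_of_ereal (N n (trunc \<sigma> s \<omega>) \<omega>) \<partial>M)" for n
    by (rule martingale_bounded_stopping[OF M Nc _ st Nb st' A]) (simp add: N_def \<tau>(4))
  have meas: "(\<lambda>\<omega>. real_of_ereal (Y (trunc \<sigma> u \<omega>) \<omega>)) \<in> borel_measurable M" if "cont_adapted Y" "0 \<le> u" for u and Y :: process
    using measurable_trunc[OF that(1) st that(2)]
    by (intro borel_measurable_real_of_ereal measurable_from_subalg[OF subalgebra_path_filt[OF M(2)]])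
  have lim: "(\<lambda>n. \<integral>\<omega>\<in>A. real_of_ereal (N n (trunc \<sigma> u \<omega>) \<omega>) \<partial>M) \<longlonglongrightarrow> (\<integral>\<omega>\<in>A. real_of_ereal (Z (trunc \<sigma> u \<omega>) \<omega>) \<partial>M)"
    if u: "0 \<le> u" for u
    unfolding set_lebesgue_integral_def
  proof (rule integral_dominated_convergence[where w="\<lambda>_. \<bar>K\<bar>"])
    show "AE \<omega> in M. (\<lambda>n. indicat_real A \<omega> *\<^sub>R real_of_ereal (N n (trunc \<sigma> u \<omega>) \<omega>)) \<longlonglongrightarrow> indicat_real A \<omega> *\<^sub>R real_of_ereal (Z (trunc \<sigma> u \<omega>) \<omega>)"
      using \<tau>(3) AE_space
    proof eventually_elim
      case (elim \<omega>)
      then obtain m where m: "Time (ennreal u) < \<tau> m \<omega>" using u by blast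
      have mono: "\<tau> m \<omega> \<le> \<tau> n \<omega>" if "m \<le> n" for n
        by (rule lift_Suc_mono_le[of "\<lambda>n. \<tau> n \<omega>", OF _ that]) (use \<tau>(2) elim spM in auto)
      have "trunc (\<tau> n) u \<omega> = u" if "m \<le> n" for n
        using m mono[OF that] by (auto simp: trunc_def)
      then have "\<forall>\<^sub>F n in sequentially. indicat_real A \<omega> *\<^sub>R real_of_ereal (Z (trunc \<sigma> u \<omega>) \<omega>) = indicat_real A \<omega> *\<^sub>R real_of_ereal (N n (trunc \<sigma> u \<omega>) \<omega>)"
        unfolding eventually_sequentially by (intro exI[of _ m] allI impI) (simp add: N_eq[OF u])
      from Lim_transform_eventually[OF tendsto_const this] show ?case .
    qed
    show "AE \<omega> in M. norm (indicat_real A \<omega> *\<^sub>R real_of_ereal (N n (trunc \<sigma> u \<omega>) \<omega>)) \<le> \<bar>K\<bar>" for n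
      using Nb[of n]
    proof eventually_elim
      case (elim \<omega>)
      then have "\<bar>N n (trunc \<sigma> u \<omega>) \<omega>\<bar> \<le> ereal K" using u by blast
      then show ?case by (cases "N n (trunc \<sigma> u \<omega>) \<omega>") (auto simp: indicator_def)
    qed
  qed (use meas[OF Nc u] meas[OF Z(1) u] AM in auto)
  show ?thesis using LIMSEQ_unique[OF lim[OF t]] lim[OF st'(1)] unfolding N_id by blast
qed

lemma bounded_martingaleI:
  assumes M: "prob_space M" "sets M = sets path_alg"
    and meas: "\<And>t. 0 \<le> t \<Longrightarrow> W t \<in> borel_measurable (filt t)"
    and bound: "\<And>t. 0 \<le> t \<Longrightarrow> AE \<omega> in M. \<bar>W t \<omega>\<bar> \<le> ereal K"
    and eq: "\<And>s t A. 0 \<le> s \<Longrightarrow> s \<le> t \<Longrightarrow> A \<in> sets (filt s) \<Longrightarrow>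
      (\<integral>\<omega>\<in>A. real_of_ereal (W t \<omega>) \<partial>M) = (\<integral>\<omega>\<in>A. real_of_ereal (W s \<omega>) \<partial>M)"
  shows "martingale M W" "uniformly_integrable M W"
proof -
  interpret M: prob_space M by fact
  have int: "integrable M (\<lambda>\<omega>. real_of_ereal (W t \<omega>))" if "0 \<le> t" for t
  proof (rule M.integrable_const_bound[of _ K])
    show "AE \<omega> in M. norm (real_of_ereal (W t \<omega>)) \<le> K"
      using bound[OF that]
    proof eventually_elim
      case (elim \<omega>) then show ?case by (cases "W t \<omega>") auto
    qed
    show "(\<lambda>\<omega>. real_of_ereal (W t \<omega>)) \<in> borel_measurable M"
      by (intro borel_measurable_real_of_ereal measurable_from_subalg[OF subalgebra_path_filt[OF M(2)] meas[OF that]])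
  qed
  show "martingale M W"
    unfolding martingale_def
  proof (intro conjI allI impI)
    fix t :: real assume t: "0 \<le> t"
    show "W t \<in> borel_measurable (filt t)" by (rule meas[OF t])
    show "integrable M (\<lambda>\<omega>. real_of_ereal (W t \<omega>))" by (rule int[OF t])
    show "AE \<omega> in M. \<bar>W t \<omega>\<bar> \<noteq> \<infinity>" using bound[OF t] by eventually_elim auto
  next
    fix s t :: real assume st: "0 \<le> s" "s \<le> t"
    interpret finite_measure_subalgebra M "filt s"
      by unfold_locales (rule subalgebra_path_filt[OF M(2)])
    show "AE \<omega> in M. real_cond_exp M (filt s) (\<lambda>\<omega>. real_of_ereal (W t \<omega>)) \<omega> = real_of_ereal (W s \<omega>)"
      by (rule real_cond_exp_charact) (use eq[OF st] int st meas in auto)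
  qed
  show "uniformly_integrable M W"
    unfolding uniformly_integrable_def
  proof (intro allI impI exI[of _ K])
    fix e t :: real assume "0 < e" "0 \<le> t"
    have "(\<integral>\<^sup>+\<omega>\<in>{\<omega>. ereal K < \<bar>W t \<omega>\<bar>}. e2ennreal \<bar>W t \<omega>\<bar> \<partial>M) = (\<integral>\<^sup>+\<omega>. 0 \<partial>M)"
      by (rule nn_integral_cong_AE) (use bound[OF \<open>0 \<le> t\<close>] in \<open>eventually_elim, auto simp: indicator_def not_le[symmetric]\<close>)
    then show "(\<integral>\<^sup>+\<omega>\<in>{\<omega>. ereal K < \<bar>W t \<omega>\<bar>}. e2ennreal \<bar>W t \<omega>\<bar> \<partial>M) \<le> ennreal e" by simp
  qed
qed

lemma stopped_scaled_martingale:
  fixes c :: real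
  assumes M: "prob_space M" "sets M = sets path_alg"
    and Z: "cont_adapted Z" "local_martingale M Z" and st: "stopping_time path_filt \<sigma>"
    and bound: "AE \<omega> in M. \<forall>t\<ge>0. \<bar>Z (trunc \<sigma> t \<omega>) \<omega>\<bar> \<le> ereal K" and c: "c \<noteq> 0"
  shows "martingale M (stopped (\<lambda>t \<omega>. Z t \<omega> / ereal c) \<sigma>)"
    "uniformly_integrable M (stopped (\<lambda>t \<omega>. Z t \<omega> / ereal c) \<sigma>)"
proof -
  let ?W = "stopped (\<lambda>t \<omega>. Z t \<omega> / ereal c) \<sigma>"
  have meas: "?W t \<in> borel_measurable (filt t)" if "0 \<le> t" for t
    using measurable_trunc[OF Z(1) st that] unfolding stopped_eq_trunc[abs_def]
    by (intro borel_measurable_ereal_divide) auto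
  have bound': "AE \<omega> in M. \<bar>?W t \<omega>\<bar> \<le> ereal (K / \<bar>c\<bar>)" if "0 \<le> t" for t
    using bound
  proof eventually_elim
    case (elim \<omega>)
    then have "\<bar>Z (trunc \<sigma> t \<omega>) \<omega>\<bar> \<le> ereal K" using that by blast
    then show ?case unfolding stopped_eq_trunc using c
      by (cases "Z (trunc \<sigma> t \<omega>) \<omega>") (auto intro!: divide_right_mono)
  qed
  have eq: "(\<integral>\<omega>\<in>A. real_of_ereal (?W t \<omega>) \<partial>M) = (\<integral>\<omega>\<in>A. real_of_ereal (?W s \<omega>) \<partial>M)"
    if st': "0 \<le> s" "s \<le> t" "A \<in> sets (filt s)" for s t A
  proof -
    have *: "real_of_ereal (?W u \<omega>) = real_of_ereal (Z (trunc \<sigma> u \<omega>) \<omega>) / c" for u \<omega>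
      unfolding stopped_eq_trunc by (cases "Z (trunc \<sigma> u \<omega>) \<omega>") (use c in auto)
    show ?thesis unfolding * using local_martingale_bounded_stopping[OF M Z st bound st']
      by simp
  qed
  show "martingale M ?W" "uniformly_integrable M ?W"
    using bounded_martingaleI[OF M meas bound' eq] by blast+
qed

section \<open>Hitting times of continuous absorbed processes\<close>

lemma dyadic_floor:
  fixes x :: real
  assumes "0 \<le> x"
  shows "(\<lambda>n. real (nat \<lfloor>x * 2 ^ n\<rfloor>) / 2 ^ n) \<longlonglongrightarrow> x"
    and "real (nat \<lfloor>x * 2 ^ n\<rfloor>) / 2 ^ n \<le> x"
proof -
  have l_fin: "real (nat \<lfloor>x * 2 ^ n\<rfloor>) = of_int \<lfloor>x * 2 ^ n\<rfloor>" for n using assms by simp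
  show le: "real (nat \<lfloor>x * 2 ^ n\<rfloor>) / 2 ^ n \<le> x" for n
    unfolding l_fin by (simp add: pos_divide_le_eq)
  have ge: "x - (1/2) ^ n \<le> real (nat \<lfloor>x * 2 ^ n\<rfloor>) / 2 ^ n" for n
  proof -
    have "x * 2 ^ n - 1 \<le> of_int \<lfloor>x * 2 ^ n\<rfloor>" by linarith
    then have "(x * 2 ^ n - 1) / 2 ^ n \<le> of_int \<lfloor>x * 2 ^ n\<rfloor> / 2 ^ n" by (rule divide_right_mono) simp
    then show ?thesis unfolding l_fin by (simp add: diff_divide_distrib power_one_over)
  qed
  show "(\<lambda>n. real (nat \<lfloor>x * 2 ^ n\<rfloor>) / 2 ^ n) \<longlonglongrightarrow> x"
  proof (rule tendsto_sandwich)
    have "(\<lambda>n. x - (1/2::real) ^ n) \<longlonglongrightarrow> x - 0" by (intro tendsto_intros LIMSEQ_power_zero) simp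
    then show "(\<lambda>n. x - (1/2::real) ^ n) \<longlonglongrightarrow> x" by simp
    show "(\<lambda>n. x) \<longlonglongrightarrow> x" by simp
  qed (use le ge in auto)
qed

lemma dyadic_INF_le:
  fixes f :: "real \<Rightarrow> ereal"
  assumes f: "continuous_on {0..} f" and "0 \<le> q" "q \<le> v" "v \<le> t"
  shows "(INF p. f (min t (q + real (fst p) / 2 ^ snd p))) \<le> f v"
    and "f v \<le> (SUP p. f (min t (q + real (fst p) / 2 ^ snd p)))"
proof -
  define i where "i n = nat \<lfloor>(v - q) * 2 ^ n\<rfloor>" for n :: nat
  have d: "(\<lambda>n. real (i n) / 2 ^ n) \<longlonglongrightarrow> v - q" "\<And>n. real (i n) / 2 ^ n \<le> v - q"
    unfolding i_def using dyadic_floor[of "v - q"] assms by auto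
  have eq: "min t (q + real (i n) / 2 ^ n) = q + real (i n) / 2 ^ n" for n using d(2)[of n] assms(4) by auto
  have "(\<lambda>n. q + real (i n) / 2 ^ n) \<longlonglongrightarrow> q + (v - q)" by (intro tendsto_intros d)
  then have "(\<lambda>n. min t (q + real (i n) / 2 ^ n)) \<longlonglongrightarrow> v" unfolding eq by simp
  from continuous_on_tendsto_compose[OF f this]
  have l: "(\<lambda>n. f (min t (q + real (i n) / 2 ^ n))) \<longlonglongrightarrow> f v" using assms by auto
  have le: "(INF p. f (min t (q + real (fst p) / 2 ^ snd p))) \<le> f (min t (q + real (i n) / 2 ^ n))" for n
    by (rule INF_lower2[of "(i n, n)"]) auto
  show "(INF p. f (min t (q + real (fst p) / 2 ^ snd p))) \<le> f v"
    by (rule LIMSEQ_le_const[OF l]) (use le in auto)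
  have ge: "f (min t (q + real (i n) / 2 ^ n)) \<le> (SUP p. f (min t (q + real (fst p) / 2 ^ snd p)))" for n
    by (rule SUP_upper2[of "(i n, n)"]) auto
  show "f v \<le> (SUP p. f (min t (q + real (fst p) / 2 ^ snd p)))"
    by (rule LIMSEQ_le_const2[OF l]) (use ge in auto)
qed

text \<open>By compactness and connectedness, a continuous function attains \<open>c\<close> exactly if \<open>c\<close> lies between
  its extreme values. These are determined by countably many times, which is why first visits are
  measurable without completing the filtration.\<close>

lemma exists_level_iff:
  fixes f :: "real \<Rightarrow> ereal"
  assumes f: "continuous_on {0..} f" and qt: "0 \<le> q" "q \<le> t"
  shows "(\<exists>v. q \<le> v \<and> v \<le> t \<and> f v = c) \<longleftrightarrow>
    (INF p. f (min t (q + real (fst p) / 2 ^ snd p))) \<le> c \<and> c \<le> (SUP p. f (min t (q + real (fst p) / 2 ^ snd p)))"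
    (is "_ \<longleftrightarrow> ?I \<le> c \<and> c \<le> ?S")
proof
  assume "\<exists>v. q \<le> v \<and> v \<le> t \<and> f v = c"
  then show "?I \<le> c \<and> c \<le> ?S" using dyadic_INF_le[OF f qt(1)] by auto
next
  assume c: "?I \<le> c \<and> c \<le> ?S"
  have cont: "continuous_on {q..t} f" by (rule continuous_on_subset[OF f]) (use qt in auto)
  have ne: "{q..t} \<noteq> {}" using qt by auto
  have mem: "min t (q + real (fst p) / 2 ^ snd p) \<in> {q..t}" for p :: "nat \<times> nat" using qt by auto
  obtain m where m: "m \<in> {q..t}" "\<And>u. u \<in> {q..t} \<Longrightarrow> f m \<le> f u"
    using continuous_attains_inf[OF compact_Icc ne cont] by blast
  obtain M where M: "M \<in> {q..t}" "\<And>u. u \<in> {q..t} \<Longrightarrow> f u \<le> f M"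
    using continuous_attains_sup[OF compact_Icc ne cont] by blast
  have "f m \<le> ?I" by (rule INF_greatest) (use m(2)[OF mem] in auto)
  then have mc: "f m \<le> c" using c by (auto intro: order_trans)
  have "?S \<le> f M" by (rule SUP_least) (use M(2)[OF mem] in auto)
  then have cM: "c \<le> f M" using c by (auto intro: order_trans)
  have "connected (f ` {q..t})" by (rule connected_continuous_image[OF cont]) simp
  then have "c \<in> f ` {q..t}"
    by (rule connectedD_interval[of _ "f m" "f M"]) (use m(1) M(1) mc cM in auto)
  then show "\<exists>v. q \<le> v \<and> v \<le> t \<and> f v = c" by auto
qed

text \<open>Convergence expressed through countably many times, to make it a measurable event.\<close>

lemma tendsto_at_top_iff:
  fixes f :: "real \<Rightarrow> ereal"
  assumes f: "continuous_on {0..} f"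
  shows "(f \<longlongrightarrow> e) at_top \<longleftrightarrow>
    e \<le> (SUP N::nat. INF p::nat\<times>nat. f (real N + real (fst p) / 2 ^ snd p)) \<and>
    (INF N::nat. SUP p::nat\<times>nat. f (real N + real (fst p) / 2 ^ snd p)) \<le> e"
proof -
  let ?I = "\<lambda>N::nat. INF p::nat\<times>nat. f (real N + real (fst p) / 2 ^ snd p)"
  let ?S = "\<lambda>N::nat. SUP p::nat\<times>nat. f (real N + real (fst p) / 2 ^ snd p)"
  have b: "?I N \<le> f v \<and> f v \<le> ?S N" if "real N \<le> v" for N v
  proof -
    define i where "i n = nat \<lfloor>(v - N) * 2 ^ n\<rfloor>" for n :: nat
    have "(\<lambda>n. N + real (i n) / 2 ^ n) \<longlonglongrightarrow> N + (v - N)"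
      unfolding i_def using dyadic_floor(1)[of "v - N"] that by (intro tendsto_intros) auto
    then have "(\<lambda>n. N + real (i n) / 2 ^ n) \<longlonglongrightarrow> v" by simp
    from continuous_on_tendsto_compose[OF f this]
    have l: "(\<lambda>n. f (real N + real (i n) / 2 ^ n)) \<longlonglongrightarrow> f v" using that by auto
    have "?I N \<le> f (real N + real (i n) / 2 ^ n)" for n by (rule INF_lower2[of "(i n, n)"]) auto
    moreover have "f (real N + real (i n) / 2 ^ n) \<le> ?S N" for n by (rule SUP_upper2[of "(i n, n)"]) auto
    ultimately show ?thesis using LIMSEQ_le_const[OF l, of "?I N"] LIMSEQ_le_const2[OF l, of "?S N"] by blast
  qed
  show ?thesis
  proof
    assume lim: "(f \<longlongrightarrow> e) at_top"
    have "e \<le> (SUP N. ?I N)"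
    proof (rule dense_le)
      fix c assume "c < e"
      with lim have "\<forall>\<^sub>F v in at_top. c < f v" by (rule order_tendstoD)
      then obtain T where T: "\<And>v. T \<le> v \<Longrightarrow> c < f v" by (auto simp: eventually_at_top_linorder)
      obtain N :: nat where N: "T \<le> N" using real_arch_simple by blast
      have "c \<le> ?I N"
      proof (rule INF_greatest)
        fix p :: "nat \<times> nat"
        have "0 \<le> real (fst p) / 2 ^ snd p" by simp
        then have "T \<le> real N + real (fst p) / 2 ^ snd p" using N by linarith
        then show "c \<le> f (real N + real (fst p) / 2 ^ snd p)" by (rule less_imp_le[OF T])
      qed
      then show "c \<le> (SUP N. ?I N)" by (rule SUP_upper2[OF UNIV_I])
    qed
    moreover have "(INF N. ?S N) \<le> e"
    proof (rule dense_ge)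
      fix c assume "e < c"
      with lim have "\<forall>\<^sub>F v in at_top. f v < c" by (rule order_tendstoD)
      then obtain T where T: "\<And>v. T \<le> v \<Longrightarrow> f v < c" by (auto simp: eventually_at_top_linorder)
      obtain N :: nat where N: "T \<le> N" using real_arch_simple by blast
      have "?S N \<le> c"
      proof (rule SUP_least)
        fix p :: "nat \<times> nat"
        have "0 \<le> real (fst p) / 2 ^ snd p" by simp
        then have "T \<le> real N + real (fst p) / 2 ^ snd p" using N by linarith
        then show "f (real N + real (fst p) / 2 ^ snd p) \<le> c" by (rule less_imp_le[OF T])
      qed
      then show "(INF N. ?S N) \<le> c" by (rule INF_lower2[OF UNIV_I])
    qed
    ultimately show "e \<le> (SUP N. ?I N) \<and> (INF N. ?S N) \<le> e" ..
  next
    assume *: "e \<le> (SUP N. ?I N) \<and> (INF N. ?S N) \<le> e"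
    show "(f \<longlongrightarrow> e) at_top"
    proof (rule order_tendstoI)
      fix c assume "c < e"
      then have "c < (SUP N. ?I N)" using * by auto
      then obtain N where "c < ?I N" by (auto simp: less_SUP_iff)
      then have "\<forall>v\<ge>real N. c < f v" using b by (meson less_le_trans)
      then show "\<forall>\<^sub>F v in at_top. c < f v" by (auto simp: eventually_at_top_linorder)
    next
      fix c assume "e < c"
      then have "(INF N. ?S N) < c" using * by auto
      then obtain N where "?S N < c" by (auto simp: INF_less_iff)
      then have "\<forall>v\<ge>real N. f v < c" using b by (meson le_less_trans)
      then show "\<forall>\<^sub>F v in at_top. f v < c" by (auto simp: eventually_at_top_linorder)
    qed
  qed
qed

text \<open>Oscillation of a path between an endpoint and an interior level \<open>c\<close> will be excluded by showing
  that almost surely this time is \<open>Beyond\<close> for some \<open>a\<close> close to the endpoint.\<close>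

definition return_time :: "process \<Rightarrow> ereal \<Rightarrow> ereal \<Rightarrow> path \<Rightarrow> ext_time" where
  "return_time Y a c \<omega> =
     (let S = {v. 0 \<le> v \<and> (\<exists>u. 0 \<le> u \<and> u \<le> v \<and> Y u \<omega> = a) \<and> Y v \<omega> = c}
      in if S = {} then Beyond else Time (ennreal (Inf S)))"

locale absorbed_paths =
  fixes l r :: ereal and Y :: process
  assumes lr: "l < r"
    and cont_adapted: "cont_adapted Y"
    and range: "\<And>\<omega> t. \<omega> \<in> C_abs \<Longrightarrow> 0 \<le> t \<Longrightarrow> Y t \<omega> \<in> {l..r}"
    and absorbed: "\<And>\<omega> s t. \<omega> \<in> C_abs \<Longrightarrow> 0 \<le> s \<Longrightarrow> s \<le> t \<Longrightarrow> Y s \<omega> \<in> {l, r} \<Longrightarrow> Y t \<omega> = Y s \<omega>"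
begin

lemma cont: "\<omega> \<in> C_abs \<Longrightarrow> continuous_on {0..} (\<lambda>t. Y t \<omega>)"
  using cont_adapted by (simp add: cont_adapted_def)

lemma meas: "0 \<le> t \<Longrightarrow> Y t \<in> borel_measurable (filt t)"
  using cont_adapted by (simp add: cont_adapted_def)

lemma meas_mono: "0 \<le> s \<Longrightarrow> s \<le> t \<Longrightarrow> Y s \<in> borel_measurable (filt t)"
  by (rule measurable_path_filt_mono[OF _ meas]) (auto intro: ennreal_leI)

lemma level_attained:
  assumes w: "\<omega> \<in> C_abs" and "0 \<le> u" "Y u \<omega> = a"
  shows "let i = Inf {v. 0 \<le> v \<and> Y v \<omega> = a} in 0 \<le> i \<and> i \<le> u \<and> Y i \<omega> = a \<and> (\<forall>v\<ge>0. Y v \<omega> = a \<longrightarrow> i \<le> v)"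
proof -
  let ?H = "{v. 0 \<le> v \<and> Y v \<omega> = a}"
  have "closed ({0..} \<inter> (\<lambda>t. Y t \<omega>) -` {a})"
    by (rule continuous_closed_preimage[OF cont[OF w]]) auto
  moreover have "{0..} \<inter> (\<lambda>t. Y t \<omega>) -` {a} = ?H" by auto
  ultimately have c: "closed ?H" by simp
  have bdd: "bdd_below ?H" by (rule bdd_belowI[of _ 0]) auto
  have "Inf ?H \<in> ?H" by (rule closed_contains_Inf[OF _ bdd c]) (use assms in auto)
  then show ?thesis using cInf_lower[OF _ bdd] assms by (auto simp: Let_def)
qed

text \<open>Level sets of a continuous path are closed, so the infimum is attained whenever it is finite.\<close>

lemma hit_time_le_iff:
  assumes w: "\<omega> \<in> C_abs" and t: "0 \<le> t"
  shows "hit_time Y a \<omega> \<le> Time (ennreal t) \<longleftrightarrow> (\<exists>u. 0 \<le> u \<and> u \<le> t \<and> Y u \<omega> = a)"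
proof -
  define S where "S = {ennreal t | t. 0 \<le> t \<and> Y t \<omega> = a} \<union> {u. u = \<infinity> \<and> ((\<lambda>t. Y t \<omega>) \<longlongrightarrow> a) at_top}"
  have hit: "hit_time Y a \<omega> = (if S = {} then Beyond else Time (Inf S))" by (simp add: hit_time_def S_def)
  show ?thesis
  proof
    assume h: "hit_time Y a \<omega> \<le> Time (ennreal t)"
    then have I: "Inf S \<le> ennreal t" "S \<noteq> {}" by (auto simp: hit split: if_splits)
    have "\<exists>u\<ge>0. Y u \<omega> = a"
    proof (rule ccontr)
      assume "\<not> (\<exists>u\<ge>0. Y u \<omega> = a)"
      then have "S \<subseteq> {\<infinity>}" by (auto simp: S_def)
      then have "S = {\<infinity>}" using I(2) by auto
      then show False using I(1) by (simp add: top_unique)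
    qed
    then obtain u where u: "0 \<le> u" "Y u \<omega> = a" by blast
    define i where "i = Inf {v. 0 \<le> v \<and> Y v \<omega> = a}"
    have i: "0 \<le> i" "Y i \<omega> = a" "\<And>v. v \<ge> 0 \<Longrightarrow> Y v \<omega> = a \<Longrightarrow> i \<le> v"
      using level_attained[OF w u] by (auto simp: i_def Let_def)
    have "ennreal i \<le> Inf S" by (rule Inf_greatest) (use i(3) in \<open>auto simp: S_def intro: ennreal_leI\<close>)
    then have "ennreal i \<le> ennreal t" using I(1) by simp
    then have "i \<le> t" using t by (simp add: ennreal_le_iff)
    then show "\<exists>u. 0 \<le> u \<and> u \<le> t \<and> Y u \<omega> = a" using i by blast
  next
    assume "\<exists>u. 0 \<le> u \<and> u \<le> t \<and> Y u \<omega> = a"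
    then obtain u where u: "0 \<le> u" "u \<le> t" "Y u \<omega> = a" by blast
    then have "ennreal u \<in> S" by (auto simp: S_def)
    then have "Inf S \<le> ennreal u" "S \<noteq> {}" by (auto intro: Inf_lower)
    then show "hit_time Y a \<omega> \<le> Time (ennreal t)" using u by (auto simp: hit intro: order_trans ennreal_leI)
  qed
qed

lemma hit_time_less_infinity_iff:
  assumes w: "\<omega> \<in> C_abs"
  shows "hit_time Y a \<omega> < Time \<infinity> \<longleftrightarrow> (\<exists>u\<ge>0. Y u \<omega> = a)"
proof
  assume h: "hit_time Y a \<omega> < Time \<infinity>"
  then have "hit_time Y a \<omega> \<le> Time (ennreal (time_val (hit_time Y a \<omega>)))" by (simp add: Time_time_val)
  then show "\<exists>u\<ge>0. Y u \<omega> = a" using hit_time_le_iff[OF w time_val_nonneg] by blast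
next
  assume "\<exists>u\<ge>0. Y u \<omega> = a"
  then obtain u where "u \<ge> 0" "Y u \<omega> = a" by blast
  then have "hit_time Y a \<omega> \<le> Time (ennreal u)" using hit_time_le_iff[OF w] by blast
  then show "hit_time Y a \<omega> < Time \<infinity>" by (rule le_less_trans) simp
qed

lemma hit_time_le_infinity_iff:
  assumes w: "\<omega> \<in> C_abs"
  shows "hit_time Y a \<omega> \<le> Time \<infinity> \<longleftrightarrow> (\<exists>u\<ge>0. Y u \<omega> = a) \<or> ((\<lambda>t. Y t \<omega>) \<longlongrightarrow> a) at_top"
  unfolding hit_time_def Let_def by (auto simp: top_unique)

lemma hit_time_Beyond_iff:
  "\<omega> \<in> C_abs \<Longrightarrow> hit_time Y a \<omega> = Beyond \<longleftrightarrow> \<not> hit_time Y a \<omega> \<le> Time \<infinity>"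
  by (cases "hit_time Y a \<omega>") auto

lemma at_hit_time:
  assumes w: "\<omega> \<in> C_abs" and h: "hit_time Y a \<omega> < Time \<infinity>"
  shows "Y (time_val (hit_time Y a \<omega>)) \<omega> = a"
    and "0 \<le> u \<Longrightarrow> Y u \<omega> = a \<Longrightarrow> time_val (hit_time Y a \<omega>) \<le> u"
proof -
  show *: "time_val (hit_time Y a \<omega>) \<le> u" if "0 \<le> u" "Y u \<omega> = a" for u
  proof -
    have "hit_time Y a \<omega> \<le> Time (ennreal u)" using that hit_time_le_iff[OF w] by blast
    then show ?thesis using le_Time_iff[OF that(1)] by blast
  qed
  have "hit_time Y a \<omega> \<le> Time (ennreal (time_val (hit_time Y a \<omega>)))" using h by (simp add: Time_time_val)
  then obtain u where "0 \<le> u" "u \<le> time_val (hit_time Y a \<omega>)" "Y u \<omega> = a"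
    using hit_time_le_iff[OF w time_val_nonneg] by blast
  then show "Y (time_val (hit_time Y a \<omega>)) \<omega> = a" using *[of u] by (metis order_antisym)
qed

lemma level_sets:
  assumes "0 \<le> q" "q \<le> t"
  shows "{\<omega>\<in>C_abs. \<exists>v. q \<le> v \<and> v \<le> t \<and> Y v \<omega> = c} \<in> sets (filt t)"
proof -
  have m: "Y (min t (q + real (fst p) / 2 ^ snd p)) \<in> borel_measurable (filt t)" for p :: "nat \<times> nat"
    by (rule meas_mono) (use assms in auto)
  have "{\<omega>\<in>C_abs. \<exists>v. q \<le> v \<and> v \<le> t \<and> Y v \<omega> = c} = {\<omega>\<in>space (filt t).
     (INF p::nat\<times>nat. Y (min t (q + real (fst p) / 2 ^ snd p)) \<omega>) \<le> c \<and>
     c \<le> (SUP p::nat\<times>nat. Y (min t (q + real (fst p) / 2 ^ snd p)) \<omega>)}"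
    using exists_level_iff[OF cont assms] by auto
  also have "\<dots> \<in> sets (filt t)"
    using m by measurable
  finally show ?thesis .
qed

lemma tendsto_sets: "{\<omega>\<in>C_abs. ((\<lambda>t. Y t \<omega>) \<longlongrightarrow> e) at_top} \<in> sets path_alg"
proof -
  have m: "Y (real N + real (fst p) / 2 ^ snd p) \<in> borel_measurable path_alg" for N and p :: "nat \<times> nat"
    by (rule measurable_filt_path_alg[OF meas]) auto
  have "{\<omega>\<in>C_abs. ((\<lambda>t. Y t \<omega>) \<longlongrightarrow> e) at_top} = {\<omega>\<in>space path_alg.
    e \<le> (SUP N::nat. INF p::nat\<times>nat. Y (real N + real (fst p) / 2 ^ snd p) \<omega>) \<and>
    (INF N::nat. SUP p::nat\<times>nat. Y (real N + real (fst p) / 2 ^ snd p) \<omega>) \<le> e}"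
    using tendsto_at_top_iff[OF cont] by auto
  also have "\<dots> \<in> sets path_alg" using m by measurable
  finally show ?thesis .
qed

lemma hit_ever_sets: "{\<omega>\<in>C_abs. \<exists>u\<ge>0. Y u \<omega> = a} \<in> sets path_alg"
proof -
  have "{\<omega>\<in>C_abs. \<exists>u\<ge>0. Y u \<omega> = a} = (\<Union>N::nat. {\<omega>\<in>C_abs. \<exists>u. 0 \<le> u \<and> u \<le> real N \<and> Y u \<omega> = a})"
    by (auto intro: real_arch_simple) (metis real_arch_simple)
  moreover have "{\<omega>\<in>C_abs. \<exists>u. 0 \<le> u \<and> u \<le> real N \<and> Y u \<omega> = a} \<in> sets path_alg" for N
    using level_sets[of 0 "real N"] filt_path_alg by auto
  ultimately show ?thesis by (simp only:) (intro sets.countable_UN, auto)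
qed

lemma stopping_time_hit_time: "stopping_time path_filt (hit_time Y a)"
proof (rule stopping_timeI_finite)
  fix t :: real assume t: "0 \<le> t"
  show "{\<omega>\<in>C_abs. hit_time Y a \<omega> \<le> Time (ennreal t)} \<in> sets (filt t)"
    using level_sets[OF order_refl t, of a] hit_time_le_iff[OF _ t] by (simp cong: conj_cong)
next
  have "{\<omega>\<in>C_abs. hit_time Y a \<omega> \<le> Time \<infinity>} =
    {\<omega>\<in>C_abs. \<exists>u\<ge>0. Y u \<omega> = a} \<union> {\<omega>\<in>C_abs. ((\<lambda>t. Y t \<omega>) \<longlongrightarrow> a) at_top}"
    using hit_time_le_infinity_iff by auto
  then show "{\<omega>\<in>C_abs. hit_time Y a \<omega> \<le> Time \<infinity>} \<in> sets path_alg"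
    using hit_ever_sets tendsto_sets by auto
qed

lemma return_time_le_iff:
  assumes w: "\<omega> \<in> C_abs" and t: "0 \<le> t"
  shows "return_time Y a c \<omega> \<le> Time (ennreal t) \<longleftrightarrow>
    (\<exists>u v. 0 \<le> u \<and> u \<le> v \<and> v \<le> t \<and> Y u \<omega> = a \<and> Y v \<omega> = c)"
proof -
  define S where "S = {v. 0 \<le> v \<and> (\<exists>u. 0 \<le> u \<and> u \<le> v \<and> Y u \<omega> = a) \<and> Y v \<omega> = c}"
  have ret: "return_time Y a c \<omega> = (if S = {} then Beyond else Time (ennreal (Inf S)))"
    by (simp only: return_time_def S_def Let_def)
  have bdd: "bdd_below S" by (rule bdd_belowI[of _ 0]) (auto simp: S_def)
  have closed: "closed S"
  proof (cases "\<exists>u\<ge>0. Y u \<omega> = a")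
    case True
    then obtain u where u: "u \<ge> 0" "Y u \<omega> = a" by blast
    define i where "i = Inf {v. 0 \<le> v \<and> Y v \<omega> = a}"
    have i: "0 \<le> i" "Y i \<omega> = a" "\<And>v. v \<ge> 0 \<Longrightarrow> Y v \<omega> = a \<Longrightarrow> i \<le> v"
      using level_attained[OF w u] by (auto simp: i_def Let_def)
    have "closed ({i..} \<inter> (\<lambda>t. Y t \<omega>) -` {c})"
      by (rule continuous_closed_preimage[OF continuous_on_subset[OF cont[OF w]]]) (use i(1) in auto)
    moreover have "{i..} \<inter> (\<lambda>t. Y t \<omega>) -` {c} = S"
    proof (intro set_eqI iffI)
      fix v assume "v \<in> {i..} \<inter> (\<lambda>t. Y t \<omega>) -` {c}"
      then show "v \<in> S" using i unfolding S_def by (auto intro!: exI[of _ i])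
    next
      fix v assume "v \<in> S"
      then obtain u where "0 \<le> u" "u \<le> v" "Y u \<omega> = a" "Y v \<omega> = c" by (auto simp: S_def)
      then show "v \<in> {i..} \<inter> (\<lambda>t. Y t \<omega>) -` {c}" using i(3)[of u] by auto
    qed
    ultimately show ?thesis by simp
  next
    case False
    then have "S = {}" by (auto simp: S_def)
    then show ?thesis by simp
  qed
  show ?thesis
  proof
    assume "return_time Y a c \<omega> \<le> Time (ennreal t)"
    then have S: "S \<noteq> {}" "ennreal (Inf S) \<le> ennreal t" by (auto simp: ret split: if_splits)
    then have "Inf S \<in> S" using closed_contains_Inf[OF _ bdd closed] by blast
    moreover have "Inf S \<le> t" using S t by (simp add: ennreal_le_iff)
    ultimately show "\<exists>u v. 0 \<le> u \<and> u \<le> v \<and> v \<le> t \<and> Y u \<omega> = a \<and> Y v \<omega> = c" by (auto simp: S_def)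
  next
    assume "\<exists>u v. 0 \<le> u \<and> u \<le> v \<and> v \<le> t \<and> Y u \<omega> = a \<and> Y v \<omega> = c"
    then obtain u v where "0 \<le> u" "u \<le> v" "v \<le> t" "Y u \<omega> = a" "Y v \<omega> = c" by blast
    then have v: "v \<in> S" "v \<le> t" unfolding S_def by auto
    then have "Inf S \<le> t" using cInf_lower[OF v(1) bdd] by simp
    then show "return_time Y a c \<omega> \<le> Time (ennreal t)" using v by (auto simp: ret intro: ennreal_leI)
  qed
qed

lemma return_time_less_infinity: "return_time Y a c \<omega> \<le> Time \<infinity> \<Longrightarrow> return_time Y a c \<omega> < Time \<infinity>"
  by (auto simp: return_time_def Let_def split: if_splits)

lemma return_time_less_infinity_iff:
  assumes w: "\<omega> \<in> C_abs"
  shows "return_time Y a c \<omega> < Time \<infinity> \<longleftrightarrow> (\<exists>u v. 0 \<le> u \<and> u \<le> v \<and> Y u \<omega> = a \<and> Y v \<omega> = c)"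
proof
  assume h: "return_time Y a c \<omega> < Time \<infinity>"
  then have "return_time Y a c \<omega> \<le> Time (ennreal (time_val (return_time Y a c \<omega>)))" by (simp add: Time_time_val)
  then show "\<exists>u v. 0 \<le> u \<and> u \<le> v \<and> Y u \<omega> = a \<and> Y v \<omega> = c"
    using return_time_le_iff[OF w time_val_nonneg] by blast
next
  assume "\<exists>u v. 0 \<le> u \<and> u \<le> v \<and> Y u \<omega> = a \<and> Y v \<omega> = c"
  then obtain u v where "0 \<le> u" "u \<le> v" "Y u \<omega> = a" "Y v \<omega> = c" by blast
  then have "return_time Y a c \<omega> \<le> Time (ennreal v)" using return_time_le_iff[OF w, of v] by force
  then show "return_time Y a c \<omega> < Time \<infinity>" by (rule le_less_trans) simp
qed

lemma at_return_time:
  assumes w: "\<omega> \<in> C_abs" and h: "return_time Y a c \<omega> < Time \<infinity>"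
  shows "Y (time_val (return_time Y a c \<omega>)) \<omega> = c"
proof -
  let ?v = "time_val (return_time Y a c \<omega>)"
  have "return_time Y a c \<omega> \<le> Time (ennreal ?v)" using h by (simp add: Time_time_val)
  then obtain u v where uv: "0 \<le> u" "u \<le> v" "v \<le> ?v" "Y u \<omega> = a" "Y v \<omega> = c"
    using return_time_le_iff[OF w time_val_nonneg] by blast
  then have "return_time Y a c \<omega> \<le> Time (ennreal v)" using return_time_le_iff[OF w, of v] by force
  then have "?v \<le> v" using le_Time_iff[of v] uv by auto
  then show ?thesis using uv by (metis order_antisym)
qed

text \<open>As \<open>a\<close> and \<open>c\<close> differ, the two visits happen at different times, and a rational time fits in
  between. This writes the event as a countable union of events about separate time intervals.\<close>

lemma stopping_time_return_time:
  assumes "a \<noteq> c" shows "stopping_time path_filt (return_time Y a c)"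
proof -
  have fin: "{\<omega>\<in>C_abs. return_time Y a c \<omega> \<le> Time (ennreal t)} \<in> sets (filt t)" if t: "0 \<le> t" for t
  proof -
    let ?Q = "{q\<in>\<rat>. 0 \<le> q \<and> q \<le> t}"
    have "{\<omega>\<in>C_abs. return_time Y a c \<omega> \<le> Time (ennreal t)} =
      (\<Union>q\<in>?Q. {\<omega>\<in>C_abs. \<exists>u. 0 \<le> u \<and> u \<le> q \<and> Y u \<omega> = a} \<inter> {\<omega>\<in>C_abs. \<exists>v. q \<le> v \<and> v \<le> t \<and> Y v \<omega> = c})" (is "?L = ?R")
    proof (intro set_eqI iffI)
      fix \<omega> assume "\<omega> \<in> ?L"
      then obtain u v where w: "\<omega> \<in> C_abs" and uv: "0 \<le> u" "u \<le> v" "v \<le> t" "Y u \<omega> = a" "Y v \<omega> = c"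
        using return_time_le_iff[OF _ t] by auto
      then have "u < v" using assms by (cases "u = v") auto
      then obtain q where q: "q \<in> \<rat>" "u < q" "q < v" using Rats_dense_in_real by blast
      have "\<exists>u. 0 \<le> u \<and> u \<le> q \<and> Y u \<omega> = a" using uv q by (intro exI[of _ u]) auto
      moreover have "\<exists>v. q \<le> v \<and> v \<le> t \<and> Y v \<omega> = c" using uv q by (intro exI[of _ v]) auto
      ultimately show "\<omega> \<in> ?R" using w uv q by (intro UN_I[of q]) auto
    next
      fix \<omega> assume "\<omega> \<in> ?R"
      then obtain q u v where w: "\<omega> \<in> C_abs" "0 \<le> u" "u \<le> q" "q \<le> v" "v \<le> t" "Y u \<omega> = a" "Y v \<omega> = c" by auto
      have "\<exists>u v. 0 \<le> u \<and> u \<le> v \<and> v \<le> t \<and> Y u \<omega> = a \<and> Y v \<omega> = c"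
        using w by (intro exI[of _ u] exI[of _ v]) auto
      then show "\<omega> \<in> ?L" using return_time_le_iff[OF w(1) t] w(1) by simp
    qed
    also have "\<dots> \<in> sets (filt t)"
    proof (rule sets.countable_UN'')
      show "countable ?Q" by (rule countable_subset[OF _ countable_rat]) auto
      fix q assume q: "q \<in> ?Q"
      have "{\<omega>\<in>C_abs. \<exists>u. 0 \<le> u \<and> u \<le> q \<and> Y u \<omega> = a} \<in> sets (filt t)"
        using level_sets[of 0 q a] filt_mono[of q t] q by auto
      then show "{\<omega>\<in>C_abs. \<exists>u. 0 \<le> u \<and> u \<le> q \<and> Y u \<omega> = a} \<inter> {\<omega>\<in>C_abs. \<exists>v. q \<le> v \<and> v \<le> t \<and> Y v \<omega> = c} \<in> sets (filt t)"
        using level_sets[of q t c] q by auto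
    qed
    finally show ?thesis .
  qed
  show ?thesis
  proof (rule stopping_timeI_finite[OF fin])
    have "{\<omega>\<in>C_abs. return_time Y a c \<omega> \<le> Time \<infinity>} = (\<Union>N::nat. {\<omega>\<in>C_abs. return_time Y a c \<omega> \<le> Time (ennreal (real N))})"
    proof (intro set_eqI iffI)
      fix \<omega> assume w: "\<omega> \<in> {\<omega>\<in>C_abs. return_time Y a c \<omega> \<le> Time \<infinity>}"
      obtain N :: nat where "time_val (return_time Y a c \<omega>) \<le> N" using real_arch_simple by blast
      then have "return_time Y a c \<omega> \<le> Time (ennreal (real N))"
        using w return_time_less_infinity by (subst le_Time_iff) auto
      then show "\<omega> \<in> (\<Union>N::nat. {\<omega>\<in>C_abs. return_time Y a c \<omega> \<le> Time (ennreal (real N))})" using w by blast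
    next
      fix \<omega> assume "\<omega> \<in> (\<Union>N::nat. {\<omega>\<in>C_abs. return_time Y a c \<omega> \<le> Time (ennreal (real N))})"
      then show "\<omega> \<in> {\<omega>\<in>C_abs. return_time Y a c \<omega> \<le> Time \<infinity>}" by (auto intro: order_trans)
    qed
    moreover have "{\<omega>\<in>C_abs. return_time Y a c \<omega> \<le> Time (ennreal (real N))} \<in> sets path_alg" for N
      using fin[of "real N"] filt_path_alg by auto
    ultimately show "{\<omega>\<in>C_abs. return_time Y a c \<omega> \<le> Time \<infinity>} \<in> sets path_alg"
      by (simp only:) (intro sets.countable_UN, auto)
  qed simp
qed

lemma endpoint_hit_iff:
  assumes w: "\<omega> \<in> C_abs" and e: "e \<in> {l, r}"
  shows "hit_time Y e \<omega> \<le> Time \<infinity> \<longleftrightarrow> ((\<lambda>t. Y t \<omega>) \<longlongrightarrow> e) at_top"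
proof -
  have "((\<lambda>t. Y t \<omega>) \<longlongrightarrow> e) at_top" if u: "0 \<le> u" "Y u \<omega> = e" for u
  proof -
    have "\<forall>\<^sub>F t in at_top. Y t \<omega> = e"
      using absorbed[OF w u(1)] u(2) e by (auto simp: eventually_at_top_linorder)
    then show ?thesis by (rule tendsto_eventually)
  qed
  then show ?thesis using hit_time_le_infinity_iff[OF w] by auto
qed

lemma crossing:
  assumes w: "\<omega> \<in> C_abs" and "0 \<le> u" "u \<le> v" "Y u \<omega> \<le> a \<and> a \<le> Y v \<omega> \<or> Y v \<omega> \<le> a \<and> a \<le> Y u \<omega>"
  shows "\<exists>q. u \<le> q \<and> q \<le> v \<and> Y q \<omega> = a"
proof -
  have "continuous_on {u..v} (\<lambda>t. Y t \<omega>)" by (rule continuous_on_subset[OF cont[OF w]]) (use assms in auto)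
  then have "connected ((\<lambda>t. Y t \<omega>) ` {u..v})" by (rule connected_continuous_image) simp
  then have "a \<in> (\<lambda>t. Y t \<omega>) ` {u..v}"
    using connectedD_interval[of _ "Y u \<omega>" "Y v \<omega>" a] connectedD_interval[of _ "Y v \<omega>" "Y u \<omega>" a] assms by force
  then show ?thesis by auto
qed

end

lemma trunc_le: "\<tau> \<omega> \<le> Time (ennreal u) \<Longrightarrow> 0 \<le> u \<Longrightarrow> 0 \<le> t \<Longrightarrow> trunc \<tau> t \<omega> \<le> u"
  using le_Time_iff[of u "\<tau> \<omega>"] by (auto simp: trunc_eq_min)

lemma stopping_time_less_sets:
  assumes S: "stopping_time path_filt \<sigma>" and T: "stopping_time path_filt \<tau>"
  shows "{\<omega>\<in>C_abs. \<sigma> \<omega> < \<tau> \<omega>} \<in> sets path_alg"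
proof -
  have m: "{\<omega>\<in>C_abs. \<rho> \<omega> \<le> x} \<in> sets path_alg" if "stopping_time path_filt \<rho>" for \<rho> x
    using stopping_time_le_sets[OF that] filt_path_alg by blast
  let ?Q = "insert (Time \<infinity>) ((\<lambda>q. Time (ennreal q)) ` \<rat>)"
  have "{\<omega>\<in>C_abs. \<sigma> \<omega> < \<tau> \<omega>} = (\<Union>x\<in>?Q. {\<omega>\<in>C_abs. \<sigma> \<omega> \<le> x} - {\<omega>\<in>C_abs. \<tau> \<omega> \<le> x})" (is "?L = ?R")
  proof (intro set_eqI iffI)
    fix \<omega> assume w: "\<omega> \<in> ?L"
    have "\<exists>x\<in>?Q. \<sigma> \<omega> \<le> x \<and> \<not> \<tau> \<omega> \<le> x"
    proof (cases "\<tau> \<omega>")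
      case Beyond
      then show ?thesis using w by (cases "\<sigma> \<omega>") auto
    next
      case (Time v)
      then obtain u where u: "\<sigma> \<omega> = Time u" "u < v" using w by (cases "\<sigma> \<omega>") auto
      obtain a b where ab: "u < a" "a < b" "b < v" using u(2) dense by metis
      then obtain ra rb where rab: "a = ennreal ra" "0 \<le> ra" "b = ennreal rb" "0 \<le> rb"
        by (metis ennreal_cases less_top top.extremum_strict not_less_iff_gr_or_eq infinity_ennreal_def)
      then have "ra < rb" using ab by (simp add: ennreal_less_iff)
      then obtain q where q: "q \<in> \<rat>" "ra < q" "q < rb" using Rats_dense_in_real by blast
      then have "ennreal q > a" "ennreal q < b" using rab by (auto simp: ennreal_less_iff)
      then have "u \<le> ennreal q" "ennreal q < v" using ab by auto
      then show ?thesis using q u Time by (intro bexI[of _ "Time (ennreal q)"]) (auto simp: not_le)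
    qed
    then show "\<omega> \<in> ?R" using w by blast
  next
    fix \<omega> assume "\<omega> \<in> ?R"
    then show "\<omega> \<in> ?L" by (auto simp: not_le intro: le_less_trans)
  qed
  also have "\<dots> \<in> sets path_alg"
    by (rule sets.countable_UN'') (use m S T in \<open>auto intro!: sets.Diff countable_insert countable_image countable_rat\<close>)
  finally show ?thesis .
qed

lemma stopping_times_le_sets: 
  assumes S: "stopping_time path_filt \<sigma>" and T: "stopping_time path_filt \<tau>"
  shows "{\<omega>\<in>C_abs. \<sigma> \<omega> \<le> \<tau> \<omega>} \<in> sets path_alg"
proof -
  have "{\<omega>\<in>C_abs. \<sigma> \<omega> \<le> \<tau> \<omega>} = space path_alg - {\<omega>\<in>C_abs. \<tau> \<omega> < \<sigma> \<omega>}" by auto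
  then show ?thesis using stopping_time_less_sets[OF T S] by (metis sets.compl_sets)
qed

section \<open>The strong Markov property and exit from compact intervals\<close>

lemma finite_time_iff: "T < Time \<infinity> \<longleftrightarrow> (\<exists>N::nat. T \<le> Time (ennreal (real N)))"
proof
  assume "T < Time \<infinity>"
  moreover obtain N :: nat where "time_val T \<le> real N" using real_arch_simple by blast
  ultimately have "T \<le> Time (ennreal (real N))" by (simp add: le_Time_iff)
  then show "\<exists>N::nat. T \<le> Time (ennreal (real N))" ..
qed (auto intro: le_less_trans)

lemma le_Time_less_infinity: "T \<le> Time (ennreal t) \<Longrightarrow> T < Time \<infinity>"
  by (erule le_less_trans) simp

definition delayed :: "(path \<Rightarrow> ext_time) \<Rightarrow> real \<Rightarrow> path \<Rightarrow> ext_time" where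
  "delayed \<tau> d \<omega> = (case \<tau> \<omega> of Time u \<Rightarrow> Time (u + ennreal d) | Beyond \<Rightarrow> Beyond)"

lemma delayed_less_infinity: "delayed \<tau> d \<omega> < Time \<infinity> \<longleftrightarrow> \<tau> \<omega> < Time \<infinity>"
  by (cases "\<tau> \<omega>") (auto simp: delayed_def less_top[symmetric])

lemma time_val_delayed: "0 \<le> d \<Longrightarrow> \<tau> \<omega> < Time \<infinity> \<Longrightarrow> time_val (delayed \<tau> d \<omega>) = time_val (\<tau> \<omega>) + d"
  by (cases "\<tau> \<omega>") (auto simp: delayed_def enn2real_plus)

lemma delayed_le_iff:
  assumes "0 \<le> d" "0 \<le> t"
  shows "delayed \<tau> d \<omega> \<le> Time (ennreal t) \<longleftrightarrow> d \<le> t \<and> \<tau> \<omega> \<le> Time (ennreal (t - d))"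
proof -
  have "delayed \<tau> d \<omega> \<le> Time (ennreal t) \<longleftrightarrow> \<tau> \<omega> < Time \<infinity> \<and> time_val (\<tau> \<omega>) + d \<le> t"
    by (simp only: le_Time_iff[OF assms(2)] delayed_less_infinity time_val_delayed[OF assms(1)] cong: conj_cong)
  also have "\<dots> \<longleftrightarrow> d \<le> t \<and> \<tau> \<omega> < Time \<infinity> \<and> time_val (\<tau> \<omega>) \<le> t - d"
    using time_val_nonneg[of "\<tau> \<omega>"] by argo
  also have "\<dots> \<longleftrightarrow> d \<le> t \<and> \<tau> \<omega> \<le> Time (ennreal (t - d))"
    using le_Time_iff[of "t - d" "\<tau> \<omega>"] by (cases "d \<le> t") simp_all
  finally show ?thesis .
qed

lemma stopping_time_delayed:
  assumes st: "stopping_time path_filt \<tau>" and d: "0 \<le> d"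
  shows "stopping_time path_filt (delayed \<tau> d)"
proof (rule stopping_timeI_finite)
  fix t :: real assume t: "0 \<le> t"
  show "{\<omega>\<in>C_abs. delayed \<tau> d \<omega> \<le> Time (ennreal t)} \<in> sets (filt t)"
  proof (cases "d \<le> t")
    case True
    then show ?thesis using stopping_time_le_filt[OF st, of "t - d" t] d by (simp add: delayed_le_iff[OF d t])
  qed (simp add: delayed_le_iff[OF d t])
next
  have "{\<omega>\<in>C_abs. delayed \<tau> d \<omega> \<le> Time \<infinity>} = {\<omega>\<in>C_abs. \<tau> \<omega> \<le> Time \<infinity>}"
  proof -
    have "delayed \<tau> d \<omega> \<le> Time \<infinity> \<longleftrightarrow> \<tau> \<omega> \<le> Time \<infinity>" for \<omega> by (cases "\<tau> \<omega>") (auto simp: delayed_def)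
    then show ?thesis by simp
  qed
  then show "{\<omega>\<in>C_abs. delayed \<tau> d \<omega> \<le> Time \<infinity>} \<in> sets path_alg"
    using stopping_time_le_sets[OF st, of "Time \<infinity>"] filt_path_alg by auto
qed

lemma stopped_alg_delayed:
  assumes st: "stopping_time path_filt \<tau>" and d: "0 \<le> d" and A: "A \<in> sets (stopped_alg \<tau>)"
  shows "A \<in> sets (stopped_alg (delayed \<tau> d))"
proof (rule stopped_algI[OF stopping_time_delayed[OF st d]])
  show "A \<in> sets path_alg" using A stopped_alg_subset[OF st] by auto
  fix t :: real assume t: "0 \<le> t"
  show "A \<inter> {\<omega>. delayed \<tau> d \<omega> \<le> Time (ennreal t)} \<in> sets (filt t)"
  proof (cases "d \<le> t")
    case True
    have "A \<inter> {\<omega>. \<tau> \<omega> \<le> Time (ennreal (t - d))} \<in> sets (filt (t - d))" using stopped_algD[OF st A] True by auto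
    then have "A \<inter> {\<omega>. \<tau> \<omega> \<le> Time (ennreal (t - d))} \<in> sets (filt t)" using filt_mono[of "t - d" t] d by auto
    then show ?thesis using True by (simp add: delayed_le_iff[OF d t])
  qed (simp add: delayed_le_iff[OF d t])
qed

lemma stopping_time_finite_sets:
  assumes st: "stopping_time path_filt \<tau>"
  shows "{\<omega>\<in>C_abs. \<tau> \<omega> < Time \<infinity>} \<in> sets (stopped_alg \<tau>)"
proof (rule stopped_algI[OF st])
  have "{\<omega>\<in>C_abs. \<tau> \<omega> < Time \<infinity>} = (\<Union>N::nat. {\<omega>\<in>C_abs. \<tau> \<omega> \<le> Time (ennreal (real N))})"
    using finite_time_iff by auto
  also have "\<dots> \<in> sets path_alg"
    by (intro sets.countable_UN) (use stopping_time_le_sets[OF st] filt_path_alg in auto)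
  finally show "{\<omega>\<in>C_abs. \<tau> \<omega> < Time \<infinity>} \<in> sets path_alg" .
  fix t :: real assume t: "0 \<le> t"
  have "{\<omega>\<in>C_abs. \<tau> \<omega> < Time \<infinity>} \<inter> {\<omega>. \<tau> \<omega> \<le> Time (ennreal t)} = {\<omega>\<in>C_abs. \<tau> \<omega> \<le> Time (ennreal t)}"
    using le_Time_iff[OF t] by auto
  then show "{\<omega>\<in>C_abs. \<tau> \<omega> < Time \<infinity>} \<inter> {\<omega>. \<tau> \<omega> \<le> Time (ennreal t)} \<in> sets (filt t)"
    using stopping_time_le_sets[OF st, of "Time (ennreal t)"] by simp
qed

lemma value_at_stopping_time_sets:
  fixes Z :: "real \<Rightarrow> path \<Rightarrow> 'a::{complete_linorder, second_countable_topology, linorder_topology}"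
  assumes Z: "cont_adapted Z" and st: "stopping_time path_filt \<tau>" and B: "B \<in> sets borel"
  shows "{\<omega>\<in>C_abs. \<tau> \<omega> < Time \<infinity> \<and> Z (time_val (\<tau> \<omega>)) \<omega> \<in> B} \<in> sets (stopped_alg \<tau>)" (is "?D \<in> _")
proof (rule stopped_algI[OF st])
  have t_sets: "?D \<inter> {\<omega>. \<tau> \<omega> \<le> Time (ennreal t)} \<in> sets (filt t)" if t: "0 \<le> t" for t
  proof -
    have "?D \<inter> {\<omega>. \<tau> \<omega> \<le> Time (ennreal t)} =
       {\<omega>\<in>C_abs. \<tau> \<omega> \<le> Time (ennreal t)} \<inter> ((\<lambda>\<omega>. Z (trunc \<tau> t \<omega>) \<omega>) -` B \<inter> space (filt t))"
      by (auto simp: trunc_def dest: le_Time_less_infinity)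
    then show ?thesis using measurable_sets[OF measurable_trunc[OF Z st t] B] stopping_time_le_sets[OF st, of "Time (ennreal t)"]
      by simp
  qed
  then show "\<And>t. 0 \<le> t \<Longrightarrow> ?D \<inter> {\<omega>. \<tau> \<omega> \<le> Time (ennreal t)} \<in> sets (filt t)" .
  have "?D = (\<Union>N::nat. ?D \<inter> {\<omega>. \<tau> \<omega> \<le> Time (ennreal (real N))})"
    using finite_time_iff by auto
  also have "\<dots> \<in> sets path_alg"
    by (intro sets.countable_UN'' countableI_type subsetD[OF filt_path_alg t_sets]) simp
  finally show "?D \<in> sets path_alg" .
qed

locale regular_laws =
  fixes l r :: ereal and Y :: process and P :: "ereal \<Rightarrow> path measure"
  assumes regular: "regular_diffusion l r Y P"
begin

lemma diff: "diffusion l r Y P"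
  using regular by (simp add: regular_diffusion_def)

sublocale absorbed_paths l r Y
proof
  show "l < r" using diff by (simp add: diffusion_def)
  show "cont_adapted Y" using diff by (simp add: diffusion_def cont_adapted_def)
  fix \<omega> :: path and s t :: real
  show "\<omega> \<in> C_abs \<Longrightarrow> 0 \<le> t \<Longrightarrow> Y t \<omega> \<in> {l..r}" using diff unfolding diffusion_def by blast
  show "\<omega> \<in> C_abs \<Longrightarrow> 0 \<le> s \<Longrightarrow> s \<le> t \<Longrightarrow> Y s \<omega> \<in> {l, r} \<Longrightarrow> Y t \<omega> = Y s \<omega>"
    using diff unfolding diffusion_def by blast
qed

lemma prob: "y \<in> {l..r} \<Longrightarrow> prob_space (P y)"
  and sets_P: "y \<in> {l..r} \<Longrightarrow> sets (P y) = sets path_alg"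
  and start: "y \<in> {l..r} \<Longrightarrow> AE \<omega> in P y. Y 0 \<omega> = y"
  and kernel: "A \<in> sets path_alg \<Longrightarrow> (\<lambda>y. measure (P y) A) \<in> borel_measurable (restrict_space borel {l..r})"
  and strong_markov: "strong_markov l r Y P"
  using diff unfolding diffusion_def by blast+

lemma space_P: "y \<in> {l..r} \<Longrightarrow> space (P y) = C_abs"
  using sets_eq_imp_space_eq[OF sets_P] by simp

lemma kernel_subprob: "P \<in> measurable (restrict_space borel {l..r}) (subprob_algebra path_alg)"
proof (rule measurable_subprob_algebra)
  fix z assume "z \<in> space (restrict_space borel {l..r})"
  then have z: "z \<in> {l..r}" by (simp add: space_restrict_space)
  then show "subprob_space (P z)" "sets (P z) = sets path_alg"
    using prob sets_P prob_space_imp_subprob_space by auto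
next
  fix A assume A: "A \<in> sets path_alg"
  have "(\<lambda>z. ennreal (measure (P z) A)) \<in> borel_measurable (restrict_space borel {l..r})"
    using kernel[OF A] by measurable
  then show "(\<lambda>z. emeasure (P z) A) \<in> borel_measurable (restrict_space borel {l..r})"
    by (rule measurable_cong[THEN iffD1, rotated])
      (simp add: space_restrict_space, metis finite_measure.emeasure_eq_measure prob prob_space.finite_measure atLeastAtMost_iff)
qed

text \<open>The default \<open>z\<close> off \<open>{\<tau> < \<infinity>}\<close> is taken to be a state, so that \<open>P (value_at z \<tau> \<omega>)\<close> is always
  one of the laws of the diffusion.\<close>

definition value_at :: "ereal \<Rightarrow> (path \<Rightarrow> ext_time) \<Rightarrow> path \<Rightarrow> ereal" where
  "value_at z \<tau> \<omega> = (if \<tau> \<omega> < Time \<infinity> then Y (time_val (\<tau> \<omega>)) \<omega> else z)"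

lemma value_at_range: "z \<in> {l..r} \<Longrightarrow> \<omega> \<in> C_abs \<Longrightarrow> value_at z \<tau> \<omega> \<in> {l..r}"
  using range[of \<omega> "time_val (\<tau> \<omega>)"] by (auto simp: value_at_def)

lemma measurable_value_at:
  assumes st: "stopping_time path_filt \<tau>" and z: "z \<in> {l..r}"
  shows "value_at z \<tau> \<in> measurable path_alg (restrict_space borel {l..r})"
proof (rule measurable_restrict_space2)
  show "value_at z \<tau> \<in> space path_alg \<rightarrow> {l..r}" using value_at_range[OF z] by auto
  show "value_at z \<tau> \<in> borel_measurable path_alg"
  proof (rule measurableI)
    fix B :: "ereal set" assume B: "B \<in> sets borel"
    have 1: "{\<omega>\<in>C_abs. \<tau> \<omega> < Time \<infinity> \<and> Y (time_val (\<tau> \<omega>)) \<omega> \<in> B} \<in> sets path_alg"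
      using value_at_stopping_time_sets[OF cont_adapted st B] stopped_alg_subset[OF st] by blast
    have 2: "C_abs - {\<omega>\<in>C_abs. \<tau> \<omega> < Time \<infinity>} \<in> sets path_alg"
      using stopping_time_finite_sets[OF st] stopped_alg_subset[OF st] by (metis sets.compl_sets space_path_filt subsetD)
    have "value_at z \<tau> -` B \<inter> space path_alg = {\<omega>\<in>C_abs. \<tau> \<omega> < Time \<infinity> \<and> Y (time_val (\<tau> \<omega>)) \<omega> \<in> B} \<union>
      (if z \<in> B then C_abs - {\<omega>\<in>C_abs. \<tau> \<omega> < Time \<infinity>} else {})"
      by (auto simp: value_at_def split: if_splits)
    then show "value_at z \<tau> -` B \<inter> space path_alg \<in> sets path_alg" using 1 2 by simp
  qed simp
qed

text \<open>The strong Markov hypothesis, a statement about conditional expectations, integrated over an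
  event of the \<open>\<sigma>\<close>-algebra of \<open>\<tau>\<close>.\<close>

lemma markov_sets:
  assumes st: "stopping_time path_filt \<tau>" and y: "y \<in> {l..r}" and t: "0 \<le> t" and B: "B \<in> sets borel"
    and A: "A \<in> sets (stopped_alg \<tau>)" "A \<subseteq> {\<omega>. \<tau> \<omega> < Time \<infinity>}"
  shows "(\<integral>\<^sup>+\<omega>. indicator A \<omega> * indicator B (value_at y (delayed \<tau> t) \<omega>) \<partial>P y) =
    (\<integral>\<^sup>+\<omega>. indicator A \<omega> * (\<integral>\<^sup>+\<omega>'. indicator B (Y t \<omega>') \<partial>P (value_at y \<tau> \<omega>)) \<partial>P y)"
proof -
  interpret Py: prob_space "P y" by (rule prob[OF y])
  have sub: "subalgebra (P y) (stopped_alg \<tau>)" by (rule subalgebra_stopped_alg[OF st sets_P[OF y]])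
  interpret finite_measure_subalgebra "P y" "stopped_alg \<tau>" by unfold_locales (rule sub)
  let ?D = "{\<omega> \<in> C_abs. \<tau> \<omega> < Time \<infinity> \<and> Y (time_val (\<tau> \<omega>) + t) \<omega> \<in> B}"
  let ?E = "{\<omega>' \<in> C_abs. Y t \<omega>' \<in> B}"
  have AP: "A \<in> sets (P y)" using A(1) sub by (auto simp: subalgebra_def)
  have A_C: "A \<subseteq> C_abs" using sets.sets_into_space[OF A(1)] by simp
  have "?D = {\<omega>\<in>C_abs. delayed \<tau> t \<omega> < Time \<infinity> \<and> Y (time_val (delayed \<tau> t \<omega>)) \<omega> \<in> B}"
    by (auto simp: delayed_less_infinity time_val_delayed t simp del: infinity_ennreal_def)
  then have D: "?D \<in> sets (P y)"
    using value_at_stopping_time_sets[OF cont_adapted stopping_time_delayed[OF st t] B] stopped_alg_subset[OF stopping_time_delayed[OF st t]]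
    unfolding sets_P[OF y] by auto
  have E: "?E \<in> sets path_alg"
    using measurable_sets[OF measurable_filt_path_alg[OF meas[OF t]] B] by (simp add: vimage_def Int_def conj_commute)
  have va: "value_at y \<tau> \<in> measurable (P y) (restrict_space borel {l..r})"
    using measurable_value_at[OF st y] measurable_cong_sets[OF sets_P[OF y] refl] by blast
  have kernelva: "(\<lambda>\<omega>. measure (P (value_at y \<tau> \<omega>)) ?E) \<in> borel_measurable (P y)"
    by (rule measurable_compose[OF va kernel[OF E]])
  have vr: "\<omega> \<in> space (P y) \<Longrightarrow> value_at y \<tau> \<omega> \<in> {l..r}" for \<omega>
    using value_at_range[OF y] space_P[OF y] by auto
  have nnE: "(\<integral>\<^sup>+\<omega>'. indicator B (Y t \<omega>') \<partial>P z) = ennreal (measure (P z) ?E)" if z: "z \<in> {l..r}" for z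
  proof -
    interpret Pz: prob_space "P z" by (rule prob[OF z])
    have "(\<integral>\<^sup>+\<omega>'. indicator B (Y t \<omega>') \<partial>P z) = (\<integral>\<^sup>+\<omega>'. indicator ?E \<omega>' \<partial>P z)"
      by (rule nn_integral_cong) (auto simp: indicator_def space_P[OF z])
    then show ?thesis using E by (simp add: sets_P[OF z] Pz.emeasure_eq_measure)
  qed
  have le1: "norm (measure (P (value_at y \<tau> \<omega>)) ?E) \<le> 1" if "\<omega> \<in> space (P y)" for \<omega>
    using prob_space.prob_le_1[OF prob[OF vr[OF that]]] by simp
  have int_k: "integrable (P y) (\<lambda>\<omega>. measure (P (value_at y \<tau> \<omega>)) ?E)"
    by (rule Py.integrable_const_bound[of _ 1]) (use le1 kernelva in auto)
  have "(\<integral>\<^sup>+\<omega>. indicator A \<omega> * indicator B (value_at y (delayed \<tau> t) \<omega>) \<partial>P y) = (\<integral>\<^sup>+\<omega>. indicator (A \<inter> ?D) \<omega> \<partial>P y)"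
    by (rule nn_integral_cong) (use A(2) A_C in \<open>auto simp: indicator_def value_at_def delayed_less_infinity time_val_delayed t simp del: infinity_ennreal_def\<close>)
  also have "\<dots> = ennreal (measure (P y) (A \<inter> ?D))"
    using AP D by (simp add: Py.emeasure_eq_measure)
  also have "measure (P y) (A \<inter> ?D) = (\<integral>\<omega>\<in>A. indicator ?D \<omega> \<partial>P y)"
    using AP D by (simp add: set_lebesgue_integral_def indicator_inter_arith[symmetric] Int_commute)
  also have "\<dots> = (\<integral>\<omega>\<in>A. real_cond_exp (P y) (stopped_alg \<tau>) (indicator ?D) \<omega> \<partial>P y)"
    by (rule real_cond_exp_intA) (use A(1) D in \<open>auto intro: Py.integrable_const_bound[of _ 1]\<close>)
  also have "\<dots> = (\<integral>\<omega>\<in>A. measure (P (value_at y \<tau> \<omega>)) ?E \<partial>P y)"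
  proof (rule set_lebesgue_integral_cong_AE[OF AP])
    show "real_cond_exp (P y) (stopped_alg \<tau>) (indicator ?D) \<in> borel_measurable (P y)"
      by (rule measurable_from_subalg[OF sub]) simp
    have "AE \<omega> in P y. \<tau> \<omega> < Time \<infinity> \<longrightarrow> real_cond_exp (P y) (stopped_alg \<tau>) (indicator ?D) \<omega>
        = measure (P (Y (time_val (\<tau> \<omega>)) \<omega>)) ?E"
      using strong_markov st y t B unfolding strong_markov_def by blast
    then show "AE \<omega>\<in>A in P y. real_cond_exp (P y) (stopped_alg \<tau>) (indicator ?D) \<omega> = measure (P (value_at y \<tau> \<omega>)) ?E"
      by eventually_elim (use A(2) in \<open>auto simp: value_at_def\<close>)
  qed (rule kernelva)
  also have "ennreal \<dots> = (\<integral>\<^sup>+\<omega>. ennreal (indicator A \<omega> * measure (P (value_at y \<tau> \<omega>)) ?E) \<partial>P y)"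
    unfolding set_lebesgue_integral_def real_scaleR_def
    by (rule nn_integral_eq_integral[symmetric]) (use integrable_mult_indicator[OF AP int_k] in auto)
  also have "\<dots> = (\<integral>\<^sup>+\<omega>. indicator A \<omega> * (\<integral>\<^sup>+\<omega>'. indicator B (Y t \<omega>') \<partial>P (value_at y \<tau> \<omega>)) \<partial>P y)"
    by (rule nn_integral_cong) (simp add: nnE[OF vr] ennreal_mult ennreal_indicator)
  finally show ?thesis .
qed

lemma measurable_kernel_integral:
  assumes g: "g \<in> borel_measurable borel" and t: "0 \<le> t" and st: "stopping_time path_filt \<tau>" and y: "y \<in> {l..r}"
  shows "(\<lambda>\<omega>. \<integral>\<^sup>+\<omega>'. g (Y t \<omega>') \<partial>P (value_at y \<tau> \<omega>)) \<in> borel_measurable (P y)"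
proof -
  have "(\<lambda>\<omega>'. g (Y t \<omega>')) \<in> borel_measurable path_alg"
    by (rule measurable_compose[OF measurable_filt_path_alg[OF meas[OF t]] g])
  then have "(\<lambda>M. \<integral>\<^sup>+\<omega>'. g (Y t \<omega>') \<partial>M) \<in> borel_measurable (subprob_algebra path_alg)"
    by (rule nn_integral_measurable_subprob_algebra)
  from measurable_compose[OF kernel_subprob this]
  have k: "(\<lambda>z. \<integral>\<^sup>+\<omega>'. g (Y t \<omega>') \<partial>P z) \<in> borel_measurable (restrict_space borel {l..r})" .
  have va: "value_at y \<tau> \<in> measurable (P y) (restrict_space borel {l..r})"
    using measurable_value_at[OF st y] measurable_cong_sets[OF sets_P[OF y] refl] by blast
  show ?thesis by (rule measurable_compose[OF va k])
qed

lemma markov_function: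
  assumes g: "g \<in> borel_measurable borel"
    and st: "stopping_time path_filt \<tau>" and y: "y \<in> {l..r}" and t: "0 \<le> t"
    and A: "A \<in> sets (stopped_alg \<tau>)" "A \<subseteq> {\<omega>. \<tau> \<omega> < Time \<infinity>}"
  shows "(\<integral>\<^sup>+\<omega>. indicator A \<omega> * g (value_at y (delayed \<tau> t) \<omega>) \<partial>P y) =
    (\<integral>\<^sup>+\<omega>. indicator A \<omega> * (\<integral>\<^sup>+\<omega>'. g (Y t \<omega>') \<partial>P (value_at y \<tau> \<omega>)) \<partial>P y)"
  using g
proof (induction rule: borel_measurable_induct)
  have AP: "A \<in> sets (P y)" using A(1) stopped_alg_subset[OF st] sets_P[OF y] by auto
  have va: "(\<lambda>\<omega>. f (value_at y (delayed \<tau> t) \<omega>)) \<in> borel_measurable (P y)" if "f \<in> borel_measurable borel" for f :: "ereal \<Rightarrow> ennreal"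
  proof -
    have "value_at y (delayed \<tau> t) \<in> measurable (P y) (restrict_space borel {l..r})"
      using measurable_value_at[OF stopping_time_delayed[OF st t] y] measurable_cong_sets[OF sets_P[OF y] refl] by blast
    then have "value_at y (delayed \<tau> t) \<in> borel_measurable (P y)" by (rule measurable_restrict_space2_iff[THEN iffD1, THEN conjunct1])
    from measurable_compose[OF this that] show ?thesis .
  qed
  have mk: "(\<lambda>\<omega>. \<integral>\<^sup>+\<omega>'. f (Y t \<omega>') \<partial>P (value_at y \<tau> \<omega>)) \<in> borel_measurable (P y)" if "f \<in> borel_measurable borel" for f
    by (rule measurable_kernel_integral[OF that t st y])
  have mY: "(\<lambda>\<omega>'. f (Y t \<omega>')) \<in> borel_measurable (P z)" if "f \<in> borel_measurable borel" "z \<in> {l..r}" for f :: "ereal \<Rightarrow> ennreal" and z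
    using measurable_compose[OF measurable_filt_path_alg[OF meas[OF t]] that(1)] measurable_cong_sets[OF sets_P[OF that(2)] refl] by blast
  have vr: "\<omega> \<in> space (P y) \<Longrightarrow> value_at y \<tau> \<omega> \<in> {l..r}" for \<omega>
    using value_at_range[OF y] space_P[OF y] by auto
  {
    case (cong f g)
    then show ?case by (simp add: ext)
  next
    case (set B)
    then show ?case using markov_sets[OF st y t _ A] by simp
  next
    case (mult u c)
    have "(\<integral>\<^sup>+\<omega>. indicator A \<omega> * (c * u (value_at y (delayed \<tau> t) \<omega>)) \<partial>P y)
      = (\<integral>\<^sup>+\<omega>. c * (indicator A \<omega> * u (value_at y (delayed \<tau> t) \<omega>)) \<partial>P y)" by (simp add: mult_ac)
    also have "\<dots> = c * (\<integral>\<^sup>+\<omega>. indicator A \<omega> * u (value_at y (delayed \<tau> t) \<omega>) \<partial>P y)"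
      by (rule nn_integral_cmult) (use va[OF mult(2)] AP in auto)
    also have "\<dots> = (\<integral>\<^sup>+\<omega>. c * (indicator A \<omega> * (\<integral>\<^sup>+\<omega>'. u (Y t \<omega>') \<partial>P (value_at y \<tau> \<omega>))) \<partial>P y)"
      unfolding mult by (rule nn_integral_cmult[symmetric]) (use mk[OF mult(2)] AP in auto)
    also have "\<dots> = (\<integral>\<^sup>+\<omega>. indicator A \<omega> * (\<integral>\<^sup>+\<omega>'. c * u (Y t \<omega>') \<partial>P (value_at y \<tau> \<omega>)) \<partial>P y)"
      by (rule nn_integral_cong) (simp add: nn_integral_cmult[OF mY[OF mult(2) vr]] mult_ac)
    finally show ?case .
  next
    case (add u v)
    have "(\<integral>\<^sup>+\<omega>. indicator A \<omega> * (v (value_at y (delayed \<tau> t) \<omega>) + u (value_at y (delayed \<tau> t) \<omega>)) \<partial>P y)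
      = (\<integral>\<^sup>+\<omega>. indicator A \<omega> * v (value_at y (delayed \<tau> t) \<omega>) + indicator A \<omega> * u (value_at y (delayed \<tau> t) \<omega>) \<partial>P y)"
      by (simp add: distrib_left)
    also have "\<dots> = (\<integral>\<^sup>+\<omega>. indicator A \<omega> * v (value_at y (delayed \<tau> t) \<omega>) \<partial>P y) + (\<integral>\<^sup>+\<omega>. indicator A \<omega> * u (value_at y (delayed \<tau> t) \<omega>) \<partial>P y)"
      by (rule nn_integral_add) (use va[OF add(1)] va[OF add(3)] AP in auto)
    also have "\<dots> = (\<integral>\<^sup>+\<omega>. indicator A \<omega> * (\<integral>\<^sup>+\<omega>'. v (Y t \<omega>') \<partial>P (value_at y \<tau> \<omega>)) + indicator A \<omega> * (\<integral>\<^sup>+\<omega>'. u (Y t \<omega>') \<partial>P (value_at y \<tau> \<omega>)) \<partial>P y)"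
      unfolding add by (rule nn_integral_add[symmetric]) (use mk[OF add(1)] mk[OF add(3)] AP in auto)
    also have "\<dots> = (\<integral>\<^sup>+\<omega>. indicator A \<omega> * (\<integral>\<^sup>+\<omega>'. v (Y t \<omega>') + u (Y t \<omega>') \<partial>P (value_at y \<tau> \<omega>)) \<partial>P y)"
      by (rule nn_integral_cong) (simp add: nn_integral_add[OF mY[OF add(3) vr] mY[OF add(1) vr]] distrib_left)
    finally show ?case .
  next
    case (seq U)
    have inc: "incseq (\<lambda>i \<omega>. indicator A \<omega> * U i (f \<omega>))" for f :: "path \<Rightarrow> ereal"
      using seq(3) by (auto simp: incseq_def le_fun_def intro!: mult_left_mono)
    have "(\<integral>\<^sup>+\<omega>. indicator A \<omega> * (SUP i. U i) (value_at y (delayed \<tau> t) \<omega>) \<partial>P y)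
      = (\<integral>\<^sup>+\<omega>. (SUP i. indicator A \<omega> * U i (value_at y (delayed \<tau> t) \<omega>)) \<partial>P y)"
      by (simp add: SUP_mult_left_ennreal image_comp)
    also have "\<dots> = (SUP i. \<integral>\<^sup>+\<omega>. indicator A \<omega> * U i (value_at y (delayed \<tau> t) \<omega>) \<partial>P y)"
      by (rule nn_integral_monotone_convergence_SUP[OF inc]) (use va[OF seq(1)] AP in auto)
    also have "\<dots> = (SUP i. \<integral>\<^sup>+\<omega>. indicator A \<omega> * (\<integral>\<^sup>+\<omega>'. U i (Y t \<omega>') \<partial>P (value_at y \<tau> \<omega>)) \<partial>P y)"
      unfolding seq ..
    also have "\<dots> = (\<integral>\<^sup>+\<omega>. (SUP i. indicator A \<omega> * (\<integral>\<^sup>+\<omega>'. U i (Y t \<omega>') \<partial>P (value_at y \<tau> \<omega>))) \<partial>P y)"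
      by (rule nn_integral_monotone_convergence_SUP[symmetric])
        (use mk[OF seq(1)] AP seq(3) in \<open>auto simp: incseq_def le_fun_def intro!: mult_left_mono nn_integral_mono\<close>)
    also have "\<dots> = (\<integral>\<^sup>+\<omega>. indicator A \<omega> * (\<integral>\<^sup>+\<omega>'. (SUP i. U i) (Y t \<omega>') \<partial>P (value_at y \<tau> \<omega>)) \<partial>P y)"
    proof (rule nn_integral_cong)
      fix \<omega> assume w: "\<omega> \<in> space (P y)"
      have "(\<integral>\<^sup>+\<omega>'. (SUP i. U i) (Y t \<omega>') \<partial>P (value_at y \<tau> \<omega>)) = (\<integral>\<^sup>+\<omega>'. (SUP i. U i (Y t \<omega>')) \<partial>P (value_at y \<tau> \<omega>))"
        by (simp add: image_comp)
      also have "\<dots> = (SUP i. \<integral>\<^sup>+\<omega>'. U i (Y t \<omega>') \<partial>P (value_at y \<tau> \<omega>))"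
        by (rule nn_integral_monotone_convergence_SUP)
          (use mY[OF seq(1) vr[OF w]] seq(3) in \<open>auto simp: incseq_def le_fun_def\<close>)
      finally show "(SUP i. indicator A \<omega> * (\<integral>\<^sup>+\<omega>'. U i (Y t \<omega>') \<partial>P (value_at y \<tau> \<omega>))) =
         indicator A \<omega> * (\<integral>\<^sup>+\<omega>'. (SUP i. U i) (Y t \<omega>') \<partial>P (value_at y \<tau> \<omega>))"
        by (simp add: SUP_mult_left_ennreal)
    qed
    finally show ?case .
  }
qed

definition grid_stay :: "ereal set \<Rightarrow> real \<Rightarrow> nat \<Rightarrow> path set" where
  "grid_stay C d m = {\<omega>\<in>C_abs. \<forall>k\<le>m. Y (real k * d) \<omega> \<in> C}"

text \<open>Regularity is exploited through the event of staying in a set forever after a stopping time. The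
  strong Markov hypothesis concerns one later time only, so this event is approached through
  finitely many equidistant times.\<close>

definition grid_stay_after :: "(path \<Rightarrow> ext_time) \<Rightarrow> ereal set \<Rightarrow> real \<Rightarrow> nat \<Rightarrow> path set" where
  "grid_stay_after \<tau> C d m = {\<omega>\<in>C_abs. \<tau> \<omega> < Time \<infinity> \<and> (\<forall>k\<le>m. Y (time_val (\<tau> \<omega>) + real k * d) \<omega> \<in> C)}"

lemma grid_stay_sets:
  assumes "C \<in> sets borel" "0 \<le> d" "real m * d \<le> t"
  shows "grid_stay C d m \<in> sets (filt t)"
proof -
  have "Y (real k * d) -` C \<inter> space (filt t) \<in> sets (filt t)" if "k \<le> m" for k
  proof (rule measurable_sets[OF meas_mono assms(1)])
    have "real k * d \<le> real m * d" using that assms(2) by (intro mult_right_mono) auto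
    then show "real k * d \<le> t" using assms(3) by simp
  qed (use assms(2) in simp)
  then have "(\<Inter>k\<in>{..m}. Y (real k * d) -` C \<inter> space (filt t)) \<in> sets (filt t)"
    by (intro sets.finite_INT) auto
  moreover have "(\<Inter>k\<in>{..m}. Y (real k * d) -` C \<inter> space (filt t)) = grid_stay C d m"
    by (auto simp: grid_stay_def)
  ultimately show ?thesis by simp
qed

lemma grid_stay_path_alg: "C \<in> sets borel \<Longrightarrow> 0 \<le> d \<Longrightarrow> grid_stay C d m \<in> sets path_alg"
  using grid_stay_sets[of C d m "real m * d"] filt_path_alg by auto

lemma grid_stay_after_Suc:
  assumes "0 \<le> d"
  shows "grid_stay_after \<tau> C d (Suc m) =
    {\<omega>\<in>C_abs. \<tau> \<omega> < Time \<infinity> \<and> Y (time_val (\<tau> \<omega>)) \<omega> \<in> C} \<inter> grid_stay_after (delayed \<tau> d) C d m"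
proof -
  have "(\<forall>k\<le>Suc m. Y (T + real k * d) \<omega> \<in> C) \<longleftrightarrow> Y T \<omega> \<in> C \<and> (\<forall>k\<le>m. Y (T + d + real k * d) \<omega> \<in> C)" for T \<omega>
  proof -
    have "(\<forall>k\<le>Suc m. Y (T + real k * d) \<omega> \<in> C) \<longleftrightarrow> Y (T + real 0 * d) \<omega> \<in> C \<and> (\<forall>k\<le>m. Y (T + real (Suc k) * d) \<omega> \<in> C)"
      by (metis Suc_le_mono bot_nat_0.extremum not0_implies_Suc)
    then show ?thesis by (simp add: algebra_simps)
  qed
  then show ?thesis unfolding grid_stay_after_def
    by (auto simp: delayed_less_infinity time_val_delayed assms simp del: infinity_ennreal_def)
qed

lemma grid_stay_after_sets:
  assumes C: "C \<in> sets borel" and d: "0 \<le> d"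
  shows "stopping_time path_filt \<tau> \<Longrightarrow> grid_stay_after \<tau> C d m \<in> sets path_alg"
proof (induction m arbitrary: \<tau>)
  case 0
  then show ?case using value_at_stopping_time_sets[OF cont_adapted 0 C] stopped_alg_subset[OF 0]
    by (auto simp: grid_stay_after_def)
next
  case (Suc m)
  then show ?case unfolding grid_stay_after_Suc[OF d]
    using value_at_stopping_time_sets[OF cont_adapted Suc(2) C] stopped_alg_subset[OF Suc(2)]
      Suc(1)[OF stopping_time_delayed[OF Suc(2) d]] by auto
qed

lemma grid_stay_eq: "grid_stay C d m = grid_stay_after (\<lambda>_. Time (ennreal 0)) C d m"
  by (simp add: grid_stay_after_def grid_stay_def)

lemma measurable_grid_stay_prob:
  assumes "C \<in> sets borel" "0 \<le> d"
  shows "(\<lambda>z. emeasure (P z) (grid_stay C d m)) \<in> borel_measurable (restrict_space borel {l..r})"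
  by (rule measurable_emeasure_kernel[OF kernel_subprob]) (rule grid_stay_path_alg[OF assms])

text \<open>The one-time Markov property is applied at \<open>\<tau>\<close>, \<open>\<tau> + d\<close>, \<open>\<tau> + 2d\<close> and so on. In the inductive
  step the remaining grid points start at \<open>\<tau> + d\<close>, so the induction hypothesis has to cover all
  stopping times; it is also used for the deterministic time \<open>d\<close> under every law, to recognize
  the resulting integral as the probability of staying along the longer grid.\<close>

lemma markov_grid_stay:
  assumes C: "C \<in> sets borel" and d: "0 \<le> d"
  shows "stopping_time path_filt \<tau> \<Longrightarrow> y \<in> {l..r} \<Longrightarrow> A \<in> sets (stopped_alg \<tau>) \<Longrightarrow> A \<subseteq> {\<omega>. \<tau> \<omega> < Time \<infinity>} \<Longrightarrow>
    emeasure (P y) (A \<inter> grid_stay_after \<tau> C d m) =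
    (\<integral>\<^sup>+\<omega>. indicator A \<omega> * emeasure (P (value_at y \<tau> \<omega>)) (grid_stay C d m) \<partial>P y)"
proof (induction m arbitrary: \<tau> y A)
  case (0 \<tau> y A)
  have sub: "A \<subseteq> C_abs" using sets.sets_into_space[OF 0(3)] by simp
  have "emeasure (P z) (grid_stay C d 0) = indicator C z" if z: "z \<in> {l..r}" for z
  proof -
    interpret Pz: prob_space "P z" by (rule prob[OF z])
    have "emeasure (P z) (grid_stay C d 0) = emeasure (P z) (if z \<in> C then space (P z) else {})"
    proof (rule emeasure_eq_AE)
      show "AE \<omega> in P z. \<omega> \<in> grid_stay C d 0 \<longleftrightarrow> \<omega> \<in> (if z \<in> C then space (P z) else {})"
        using start[OF z] AE_space by eventually_elim (auto simp: grid_stay_def space_P[OF z])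
    qed (use grid_stay_path_alg[OF C d] sets_P[OF z] in auto)
    then show ?thesis using Pz.emeasure_space_1 by auto
  qed
  then have *: "emeasure (P (value_at y \<tau> \<omega>)) (grid_stay C d 0) = indicator C (value_at y \<tau> \<omega>)" if "\<omega> \<in> C_abs" for \<omega>
    using value_at_range[OF 0(2) that] by blast
  have m: "A \<inter> grid_stay_after \<tau> C d 0 \<in> sets (P y)"
    using grid_stay_after_sets[OF C d 0(1)] stopped_alg_subset[OF 0(1)] 0(3) sets_P[OF 0(2)] by auto
  have "emeasure (P y) (A \<inter> grid_stay_after \<tau> C d 0) = (\<integral>\<^sup>+\<omega>. indicator (A \<inter> grid_stay_after \<tau> C d 0) \<omega> \<partial>P y)"
    using m by simp
  also have "\<dots> = (\<integral>\<^sup>+\<omega>. indicator A \<omega> * emeasure (P (value_at y \<tau> \<omega>)) (grid_stay C d 0) \<partial>P y)"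
  proof (rule nn_integral_cong)
    fix \<omega> assume "\<omega> \<in> space (P y)"
    then have w: "\<omega> \<in> C_abs" using space_P[OF 0(2)] by simp
    show "indicator (A \<inter> grid_stay_after \<tau> C d 0) \<omega> = indicator A \<omega> * emeasure (P (value_at y \<tau> \<omega>)) (grid_stay C d 0)"
      unfolding *[OF w] using w 0(4) by (auto simp: indicator_def grid_stay_after_def value_at_def)
  qed
  finally show ?case .
next
  case (Suc m)
  let ?h = "\<lambda>m z. emeasure (P z) (grid_stay C d m)"
  \<comment> \<open>outside the state space \<open>P\<close> is arbitrary, so \<open>?h m\<close> is cut off to be a Borel function\<close>
  let ?g = "\<lambda>z. if z \<in> {l..r} then ?h m z else 0"
  have g: "?g \<in> borel_measurable borel"
    by (rule measurable_restrict_space_iff[THEN iffD1, rotated 2]) (use measurable_grid_stay_prob[OF C d] in auto)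
  let ?D = "\<lambda>\<tau>. {\<omega>\<in>C_abs. \<tau> \<omega> < Time \<infinity> \<and> Y (time_val (\<tau> \<omega>)) \<omega> \<in> C}"
  have step: "emeasure (P y) (A \<inter> grid_stay_after \<tau> C d (Suc m)) =
     (\<integral>\<^sup>+\<omega>. indicator (A \<inter> ?D \<tau>) \<omega> * (\<integral>\<^sup>+\<omega>'. ?g (Y d \<omega>') \<partial>P (value_at y \<tau> \<omega>)) \<partial>P y)"
    if st: "stopping_time path_filt \<tau>" and y: "y \<in> {l..r}" and A: "A \<in> sets (stopped_alg \<tau>)" "A \<subseteq> {\<omega>. \<tau> \<omega> < Time \<infinity>}" for \<tau> y A
  proof -
    have A': "A \<inter> ?D \<tau> \<in> sets (stopped_alg \<tau>)" using A value_at_stopping_time_sets[OF cont_adapted st C] by auto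
    have fin: "A \<inter> ?D \<tau> \<subseteq> {\<omega>. delayed \<tau> d \<omega> < Time \<infinity>}" using A(2) by (auto simp: delayed_less_infinity simp del: infinity_ennreal_def)
    have "emeasure (P y) (A \<inter> grid_stay_after \<tau> C d (Suc m)) = emeasure (P y) ((A \<inter> ?D \<tau>) \<inter> grid_stay_after (delayed \<tau> d) C d m)"
      by (simp only: grid_stay_after_Suc[OF d] Int_assoc)
    also have "\<dots> = (\<integral>\<^sup>+\<omega>. indicator (A \<inter> ?D \<tau>) \<omega> * ?h m (value_at y (delayed \<tau> d) \<omega>) \<partial>P y)"
      by (rule Suc.IH[OF stopping_time_delayed[OF st d] y stopped_alg_delayed[OF st d A'] fin])
    also have "\<dots> = (\<integral>\<^sup>+\<omega>. indicator (A \<inter> ?D \<tau>) \<omega> * ?g (value_at y (delayed \<tau> d) \<omega>) \<partial>P y)"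
      by (rule nn_integral_cong) (use value_at_range[OF y] space_P[OF y] in auto)
    also have "\<dots> = (\<integral>\<^sup>+\<omega>. indicator (A \<inter> ?D \<tau>) \<omega> * (\<integral>\<^sup>+\<omega>'. ?g (Y d \<omega>') \<partial>P (value_at y \<tau> \<omega>)) \<partial>P y)"
      by (rule markov_function[OF g st y d A']) (use A(2) in auto)
    finally show ?thesis .
  qed
  have h: "?h (Suc m) z = indicator C z * (\<integral>\<^sup>+\<omega>'. ?g (Y d \<omega>') \<partial>P z)" if z: "z \<in> {l..r}" for z
  proof -
    interpret Pz: prob_space "P z" by (rule prob[OF z])
    let ?t0 = "\<lambda>_::path. Time (ennreal 0)"
    have st0: "stopping_time path_filt ?t0" by (rule stopping_time_const)
    have top: "C_abs \<in> sets (stopped_alg ?t0)" using sets.top[of "stopped_alg ?t0"] by simp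
    have sub: "grid_stay_after ?t0 C d (Suc m) \<subseteq> C_abs" by (auto simp: grid_stay_after_def)
    then have "?h (Suc m) z = emeasure (P z) (C_abs \<inter> grid_stay_after ?t0 C d (Suc m))"
      unfolding grid_stay_eq by (simp add: Int_absorb1)
    also have "\<dots> = (\<integral>\<^sup>+\<omega>. indicator (C_abs \<inter> ?D ?t0) \<omega> * (\<integral>\<^sup>+\<omega>'. ?g (Y d \<omega>') \<partial>P (value_at z ?t0 \<omega>)) \<partial>P z)"
      by (rule step[OF st0 z top]) auto
    also have "\<dots> = (\<integral>\<^sup>+\<omega>. indicator C z * (\<integral>\<^sup>+\<omega>'. ?g (Y d \<omega>') \<partial>P z) \<partial>P z)"
    proof (rule nn_integral_cong_AE)
      show "AE \<omega> in P z. indicator (C_abs \<inter> ?D ?t0) \<omega> * (\<integral>\<^sup>+\<omega>'. ?g (Y d \<omega>') \<partial>P (value_at z ?t0 \<omega>))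
         = indicator C z * (\<integral>\<^sup>+\<omega>'. ?g (Y d \<omega>') \<partial>P z)"
        using start[OF z] AE_space
        by eventually_elim (auto simp: space_P[OF z] value_at_def indicator_def)
    qed
    also have "\<dots> = indicator C z * (\<integral>\<^sup>+\<omega>'. ?g (Y d \<omega>') \<partial>P z)"
      using Pz.emeasure_space_1 by simp
    finally show ?thesis .
  qed
  have sub: "A \<subseteq> C_abs" using sets.sets_into_space[OF Suc.prems(3)] by simp
  show ?case
    unfolding step[OF Suc.prems]
  proof (rule nn_integral_cong)
    fix \<omega> assume "\<omega> \<in> space (P y)"
    then have v: "value_at y \<tau> \<omega> \<in> {l..r}" using value_at_range[OF Suc.prems(2)] space_P[OF Suc.prems(2)] by auto
    show "indicator (A \<inter> ?D \<tau>) \<omega> * (\<integral>\<^sup>+\<omega>'. ?g (Y d \<omega>') \<partial>P (value_at y \<tau> \<omega>)) =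
       indicator A \<omega> * ?h (Suc m) (value_at y \<tau> \<omega>)"
    proof (cases "\<omega> \<in> A")
      case True
      then have "\<omega> \<in> C_abs" "\<tau> \<omega> < Time \<infinity>" using sub Suc.prems(4) by auto
      then have "indicator (A \<inter> ?D \<tau>) \<omega> = (indicator C (value_at y \<tau> \<omega>) :: ennreal)"
        using True by (simp add: value_at_def indicator_def)
      then show ?thesis unfolding h[OF v] using True by simp
    qed simp
  qed
qed

definition stay :: "ereal set \<Rightarrow> path set" where
  "stay C = {\<omega>\<in>C_abs. \<forall>t\<ge>0. Y t \<omega> \<in> C}"

definition stay_after :: "(path \<Rightarrow> ext_time) \<Rightarrow> ereal set \<Rightarrow> path set" where
  "stay_after \<tau> C = {\<omega>\<in>C_abs. \<tau> \<omega> < Time \<infinity> \<and> (\<forall>t\<ge>0. Y (time_val (\<tau> \<omega>) + t) \<omega> \<in> C)}"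

text \<open>Refining the mesh from \<open>2\<^sup>-\<^sup>n\<close> to half of it while lengthening the horizon from \<open>n\<close> to \<open>n + 1\<close>
  keeps all earlier grid points.\<close>

lemma grid_stay_after_decseq:
  "decseq (\<lambda>n. grid_stay_after \<tau> C ((1/2) ^ n) (n * 2 ^ n))"
  unfolding decseq_Suc_iff
proof (intro allI subsetI)
  fix n \<omega> assume w: "\<omega> \<in> grid_stay_after \<tau> C ((1/2) ^ Suc n) (Suc n * 2 ^ Suc n)"
  have "Y (time_val (\<tau> \<omega>) + real k * (1/2) ^ n) \<omega> \<in> C" if k: "k \<le> n * 2 ^ n" for k
  proof -
    have "2 * k \<le> n * 2 ^ Suc n" using k by simp
    also have "\<dots> \<le> Suc n * 2 ^ Suc n" by simp
    finally have "Y (time_val (\<tau> \<omega>) + real (2 * k) * (1/2) ^ Suc n) \<omega> \<in> C"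
      using w unfolding grid_stay_after_def by blast
    then show ?thesis by simp
  qed
  then show "\<omega> \<in> grid_stay_after \<tau> C ((1/2) ^ n) (n * 2 ^ n)" using w by (simp add: grid_stay_after_def)
qed

lemma grid_stay_after_INT:
  assumes C: "closed C"
  shows "(\<Inter>n. grid_stay_after \<tau> C ((1/2) ^ n) (n * 2 ^ n)) = stay_after \<tau> C"
proof (intro set_eqI iffI)
  fix \<omega> assume w: "\<omega> \<in> (\<Inter>n. grid_stay_after \<tau> C ((1/2) ^ n) (n * 2 ^ n))"
  let ?T = "time_val (\<tau> \<omega>)"
  have w0: "\<omega> \<in> C_abs" "\<tau> \<omega> < Time \<infinity>" using w by (auto simp: grid_stay_after_def)
  have wk: "Y (?T + real k * (1/2) ^ n) \<omega> \<in> C" if "k \<le> n * 2 ^ n" for k n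
    using w that by (auto simp: grid_stay_after_def)
  have "Y (?T + t) \<omega> \<in> C" if t: "0 \<le> t" for t
  proof -
    define i where "i n = nat \<lfloor>t * 2 ^ n\<rfloor>" for n
    have i: "(\<lambda>n. real (i n) / 2 ^ n) \<longlonglongrightarrow> t" "\<And>n. real (i n) / 2 ^ n \<le> t"
      unfolding i_def using dyadic_floor[OF t] by auto
    have l: "(\<lambda>n. Y (?T + real (i n) / 2 ^ n) \<omega>) \<longlonglongrightarrow> Y (?T + t) \<omega>"
      by (rule continuous_on_tendsto_compose[OF cont[OF w0(1)]]) (use i t in \<open>auto intro!: tendsto_intros\<close>)
    obtain N :: nat where N: "t \<le> real N" using real_arch_simple by blast
    have "\<forall>\<^sub>F n in sequentially. Y (?T + real (i n) / 2 ^ n) \<omega> \<in> C"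
      using eventually_ge_at_top[of N]
    proof eventually_elim
      case (elim n)
      have "real (i n) / 2 ^ n \<le> real n" using i(2)[of n] N elim by linarith
      then have "real (i n) \<le> real (n * 2 ^ n)" by (simp add: pos_divide_le_eq)
      then have "i n \<le> n * 2 ^ n" by (simp only: of_nat_le_iff)
      moreover have "real (i n) * (1/2) ^ n = real (i n) / 2 ^ n" by (simp add: power_one_over)
      ultimately show ?case using wk[of "i n" n] by simp
    qed
    then show ?thesis by (rule Lim_in_closed_set[OF C _ _ l]) simp
  qed
  then show "\<omega> \<in> stay_after \<tau> C" using w0 by (simp add: stay_after_def)
qed (auto simp: stay_after_def grid_stay_after_def)

lemma stay_eq: "stay C = stay_after (\<lambda>_. Time (ennreal 0)) C"
  by (simp add: stay_after_def stay_def)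

lemma stay_after_sets:
  assumes C: "closed C" and st: "stopping_time path_filt \<tau>"
  shows "stay_after \<tau> C \<in> sets path_alg"
  unfolding grid_stay_after_INT[OF C, symmetric]
  by (intro sets.countable_INT) (use grid_stay_after_sets[OF borel_closed[OF C] _ st] in auto)

lemma stay_sets: "closed C \<Longrightarrow> stay C \<in> sets path_alg"
  unfolding stay_eq by (rule stay_after_sets[OF _ stopping_time_const])

lemma grid_stay_prob_tendsto:
  assumes C: "closed C" and st: "stopping_time path_filt \<tau>" and y: "y \<in> {l..r}" and A: "A \<in> sets path_alg"
  shows "(\<lambda>n. emeasure (P y) (A \<inter> grid_stay_after \<tau> C ((1/2) ^ n) (n * 2 ^ n))) \<longlonglongrightarrow> emeasure (P y) (A \<inter> stay_after \<tau> C)"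
proof -
  interpret Py: prob_space "P y" by (rule prob[OF y])
  have "(\<lambda>n. emeasure (P y) (A \<inter> grid_stay_after \<tau> C ((1/2) ^ n) (n * 2 ^ n))) \<longlonglongrightarrow>
    emeasure (P y) (\<Inter>n. A \<inter> grid_stay_after \<tau> C ((1/2) ^ n) (n * 2 ^ n))"
  proof (rule Lim_emeasure_decseq)
    show "range (\<lambda>n. A \<inter> grid_stay_after \<tau> C ((1/2) ^ n) (n * 2 ^ n)) \<subseteq> sets (P y)"
      using A grid_stay_after_sets[OF borel_closed[OF C] _ st] sets_P[OF y] by auto
    show "decseq (\<lambda>n. A \<inter> grid_stay_after \<tau> C ((1/2) ^ n) (n * 2 ^ n))"
      using grid_stay_after_decseq[of \<tau> C] unfolding decseq_def by blast
  qed (simp add: Py.emeasure_eq_measure)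
  moreover have "(\<Inter>n. A \<inter> grid_stay_after \<tau> C ((1/2) ^ n) (n * 2 ^ n)) = A \<inter> stay_after \<tau> C"
    unfolding grid_stay_after_INT[OF C, symmetric] by auto
  ultimately show ?thesis by simp
qed

lemma markov_stay:
  assumes C: "closed C" and st: "stopping_time path_filt \<tau>" and y: "y \<in> {l..r}"
    and A: "A \<in> sets (stopped_alg \<tau>)" "A \<subseteq> {\<omega>. \<tau> \<omega> < Time \<infinity>}"
  shows "emeasure (P y) (A \<inter> stay_after \<tau> C) = (\<integral>\<^sup>+\<omega>. indicator A \<omega> * emeasure (P (value_at y \<tau> \<omega>)) (stay C) \<partial>P y)"
proof -
  interpret Py: prob_space "P y" by (rule prob[OF y])
  have Ap: "A \<in> sets path_alg" using A stopped_alg_subset[OF st] by auto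
  have Cb: "C \<in> sets borel" using C by (rule borel_closed)
  let ?h = "\<lambda>n z. emeasure (P z) (grid_stay C ((1/2) ^ n) (n * 2 ^ n))"
  have vr: "\<omega> \<in> space (P y) \<Longrightarrow> value_at y \<tau> \<omega> \<in> {l..r}" for \<omega>
    using value_at_range[OF y] space_P[OF y] by auto
  have lim: "(\<lambda>n. ?h n z) \<longlonglongrightarrow> emeasure (P z) (stay C)" if z: "z \<in> {l..r}" for z
  proof -
    have "C_abs \<in> sets path_alg" using sets.top[of path_alg] by simp
    from grid_stay_prob_tendsto[OF C stopping_time_const[of path_filt "Time (ennreal 0)"] z this]
    moreover have "C_abs \<inter> grid_stay_after \<tau> C d m = grid_stay_after \<tau> C d m" "C_abs \<inter> stay_after \<tau> C = stay_after \<tau> C" for \<tau> d m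
      by (auto simp: grid_stay_after_def stay_after_def)
    ultimately show ?thesis unfolding grid_stay_eq stay_eq by simp
  qed
  have va: "value_at y \<tau> \<in> measurable (P y) (restrict_space borel {l..r})"
    using measurable_value_at[OF st y] measurable_cong_sets[OF sets_P[OF y] refl] by blast
  have mh: "(\<lambda>\<omega>. ?h n (value_at y \<tau> \<omega>)) \<in> borel_measurable (P y)" for n
    by (rule measurable_compose[OF va measurable_grid_stay_prob[OF Cb]]) simp
  have ms: "(\<lambda>z. emeasure (P z) (stay C)) \<in> borel_measurable (restrict_space borel {l..r})"
    by (rule measurable_emeasure_kernel[OF kernel_subprob stay_sets[OF C]])
  have "(\<lambda>n. \<integral>\<^sup>+\<omega>. indicator A \<omega> * ?h n (value_at y \<tau> \<omega>) \<partial>P y) \<longlonglongrightarrow>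
     (\<integral>\<^sup>+\<omega>. indicator A \<omega> * emeasure (P (value_at y \<tau> \<omega>)) (stay C) \<partial>P y)"
  proof (rule nn_integral_dominated_convergence[where w="\<lambda>_. 1"])
    show "(\<lambda>\<omega>. indicator A \<omega> * ?h n (value_at y \<tau> \<omega>)) \<in> borel_measurable (P y)" for n
      using mh Ap sets_P[OF y] by (intro borel_measurable_times_ennreal borel_measurable_indicator) auto
    show "(\<lambda>\<omega>. indicator A \<omega> * emeasure (P (value_at y \<tau> \<omega>)) (stay C)) \<in> borel_measurable (P y)"
      using measurable_compose[OF va ms] Ap sets_P[OF y] by (intro borel_measurable_times_ennreal borel_measurable_indicator) auto
    show "AE \<omega> in P y. indicator A \<omega> * ?h n (value_at y \<tau> \<omega>) \<le> 1" for n
    proof (rule AE_I2)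
      fix \<omega> assume w: "\<omega> \<in> space (P y)"
      interpret Pv: prob_space "P (value_at y \<tau> \<omega>)" by (rule prob[OF vr[OF w]])
      show "indicator A \<omega> * ?h n (value_at y \<tau> \<omega>) \<le> 1"
        using Pv.measure_le_1 by (auto simp: indicator_def)
    qed
    show "AE \<omega> in P y. (\<lambda>n. indicator A \<omega> * ?h n (value_at y \<tau> \<omega>)) \<longlonglongrightarrow> indicator A \<omega> * emeasure (P (value_at y \<tau> \<omega>)) (stay C)"
    proof (rule AE_I2)
      fix \<omega> assume w: "\<omega> \<in> space (P y)"
      show "(\<lambda>n. indicator A \<omega> * ?h n (value_at y \<tau> \<omega>)) \<longlonglongrightarrow> indicator A \<omega> * emeasure (P (value_at y \<tau> \<omega>)) (stay C)"
        using lim[OF vr[OF w]] by (cases "\<omega> \<in> A") auto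
    qed
  qed (simp_all add: Py.emeasure_space_1)
  moreover have "emeasure (P y) (A \<inter> grid_stay_after \<tau> C ((1/2) ^ n) (n * 2 ^ n)) =
     (\<integral>\<^sup>+\<omega>. indicator A \<omega> * ?h n (value_at y \<tau> \<omega>) \<partial>P y)" for n
    by (rule markov_grid_stay[OF Cb _ st y A]) simp
  ultimately show ?thesis
    using LIMSEQ_unique[OF grid_stay_prob_tendsto[OF C st y Ap]] by simp
qed

text \<open>A path from \<open>a\<close> to \<open>b'\<close> passes through every \<open>z\<close> in \<open>[a,b]\<close>. By the strong Markov property at this
  passage, \<open>Y\<close> started at \<open>z\<close> exceeds \<open>b\<close> with at least the probability of reaching \<open>b'\<close> from \<open>a\<close>,
  which is positive by regularity and does not depend on \<open>z\<close>.\<close>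

lemma stay_below_prob_less_1:
  assumes "l < a" "a \<le> b" "b < b'" "b' < r"
  obtains q where "q < 1" "\<And>z. z \<in> {a..b} \<Longrightarrow> measure (P z) (stay {..b}) \<le> q"
proof
  have a: "a \<in> {l<..<r}" "b' \<in> {l<..<r}" using assms by auto
  have a': "a \<in> {l..r}" using a by auto
  interpret Pa: prob_space "P a" by (rule prob[OF a'])
  let ?H = "\<lambda>z. {\<omega>\<in>C_abs. hit_time Y z \<omega> < Time \<infinity>}"
  have "measure (P a) (?H b') > 0" using regular a by (auto simp: regular_diffusion_def)
  then show "1 - measure (P a) (?H b') < 1" by simp
  fix z assume z: "z \<in> {a..b}"
  then have z': "z \<in> {l..r}" using assms by auto
  let ?\<tau> = "hit_time Y z"
  let ?C = "{..b}"
  have st: "stopping_time path_filt ?\<tau>" by (rule stopping_time_hit_time)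
  have Hz: "?H z \<in> sets (stopped_alg ?\<tau>)" by (rule stopping_time_finite_sets[OF st])
  have Hs: "?H x \<in> sets (P a)" for x
    using stopping_time_finite_sets[OF stopping_time_hit_time] stopped_alg_subset[OF stopping_time_hit_time] sets_P[OF a'] by blast
  have Ss: "stay_after ?\<tau> ?C \<in> sets (P a)" using stay_after_sets[OF _ st] sets_P[OF a'] by simp
  have sub: "stay_after ?\<tau> ?C \<subseteq> ?H z" by (auto simp: stay_after_def)
  have "emeasure (P a) (?H z \<inter> stay_after ?\<tau> ?C) =
    (\<integral>\<^sup>+\<omega>. indicator (?H z) \<omega> * emeasure (P (value_at a ?\<tau> \<omega>)) (stay ?C) \<partial>P a)"
    by (rule markov_stay[OF _ st a' Hz]) auto
  also have "\<dots> = (\<integral>\<^sup>+\<omega>. emeasure (P z) (stay ?C) * indicator (?H z) \<omega> \<partial>P a)"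
    by (rule nn_integral_cong) (auto simp: indicator_def value_at_def at_hit_time)
  also have "\<dots> = emeasure (P z) (stay ?C) * emeasure (P a) (?H z)"
    using Hs by (simp add: nn_integral_cmult_indicator)
  finally have eq: "measure (P a) (stay_after ?\<tau> ?C) = measure (P z) (stay ?C) * measure (P a) (?H z)"
    using sub by (simp add: measure_def enn2real_mult Int_absorb1)
  have "measure (P a) (?H b') \<le> measure (P a) (?H z - stay_after ?\<tau> ?C)"
  proof (rule Pa.finite_measure_mono_AE)
    show "AE \<omega> in P a. \<omega> \<in> ?H b' \<longrightarrow> \<omega> \<in> ?H z - stay_after ?\<tau> ?C"
      using start[OF a']
    proof eventually_elim
      case (elim \<omega>)
      show ?case
      proof
        assume w: "\<omega> \<in> ?H b'"
        then have w0: "\<omega> \<in> C_abs" by simp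
        then obtain v where v: "0 \<le> v" "Y v \<omega> = b'" using w hit_time_less_infinity_iff by auto
        have "z \<le> b'" using z assms(3) by auto
        then have "\<exists>q. 0 \<le> q \<and> q \<le> v \<and> Y q \<omega> = z"
          using crossing[OF w0, of 0 v z] v elim z by auto
        then obtain u where u: "0 \<le> u" "u \<le> v" "Y u \<omega> = z" by blast
        have h: "?\<tau> \<omega> < Time \<infinity>" using hit_time_less_infinity_iff[OF w0] u by blast
        have "time_val (?\<tau> \<omega>) \<le> v" using at_hit_time(2)[OF w0 h u(1,3)] u by simp
        then have "\<not> (\<forall>t\<ge>0. Y (time_val (?\<tau> \<omega>) + t) \<omega> \<in> ?C)"
          using v assms by (auto intro!: exI[of _ "v - time_val (?\<tau> \<omega>)"] simp: not_le)
        then show "\<omega> \<in> ?H z - stay_after ?\<tau> ?C" using w0 h by (auto simp: stay_after_def)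
      qed
    qed
    show "?H z - stay_after ?\<tau> ?C \<in> sets (P a)" using Hs Ss by auto
  qed
  also have "\<dots> = measure (P a) (?H z) * (1 - measure (P z) (stay ?C))"
    using Pa.finite_measure_Diff[OF Hs[of z] Ss sub] eq by (simp add: algebra_simps)
  also have "\<dots> \<le> 1 * (1 - measure (P z) (stay ?C))"
    using prob_space.prob_le_1[OF prob[OF z']] by (intro mult_right_mono) auto
  finally show "measure (P z) (stay ?C) \<le> 1 - measure (P a) (?H b')" by simp
qed

text \<open>Let \<open>u\<close> be the probability of staying in \<open>[a,b]\<close> forever. By the Markov property at time \<open>n\<close> and the
  uniform bound \<open>q < 1\<close> on the probability of staying from any point of \<open>[a,b]\<close>, \<open>u\<close> is at most \<open>q\<close>
  times the probability of staying up to time \<open>n\<close>. These probabilities tend to \<open>u\<close>, so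
  \<open>u \<le> q u\<close> and \<open>u = 0\<close>.\<close>

lemma exit_compact:
  assumes ab: "l < a" "b < r" and y: "y \<in> {l..r}"
  shows "AE \<omega> in P y. \<exists>t\<ge>0. Y t \<omega> \<notin> {a..b}"
proof (cases "a \<le> b")
  case False
  then show ?thesis by (intro AE_I2 exI[of _ 0]) auto
next
  case True
  interpret Py: prob_space "P y" by (rule prob[OF y])
  obtain b' where b': "b < b'" "b' < r" using dense[OF ab(2)] by blast
  obtain q where q: "q < 1" "\<And>z. z \<in> {a..b} \<Longrightarrow> measure (P z) (stay {..b}) \<le> q"
    using stay_below_prob_less_1[OF ab(1) True b'] by blast
  let ?C = "{a..b}"
  have C: "closed ?C" by simp
  have qz: "emeasure (P z) (stay ?C) \<le> ennreal q" if z: "z \<in> ?C" for z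
  proof -
    have z': "z \<in> {l..r}" using z ab by auto
    interpret Pz: prob_space "P z" by (rule prob[OF z'])
    have "measure (P z) (stay ?C) \<le> measure (P z) (stay {..b})"
      by (rule Pz.finite_measure_mono) (use stay_sets[of "{..b}"] sets_P[OF z'] in \<open>auto simp: stay_def\<close>)
    then show ?thesis using q(2)[OF z] by (simp add: Pz.emeasure_eq_measure ennreal_leI)
  qed
  have q0: "0 \<le> q" using q(2)[of a] True by (auto intro: order_trans[OF measure_nonneg])
  define u where "u = measure (P y) (stay ?C)"
  let ?A = "\<lambda>n. grid_stay ?C ((1/2) ^ n) (n * 2 ^ n)"
  have step: "emeasure (P y) (stay ?C) \<le> ennreal q * emeasure (P y) (?A n)" for n
  proof -
    let ?\<tau> = "\<lambda>_::path. Time (ennreal (real n))"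
    have st: "stopping_time path_filt ?\<tau>" by (rule stopping_time_const)
    have An: "?A n \<in> sets (filt (real n))" by (rule grid_stay_sets) (auto simp: power_one_over)
    have A: "?A n \<in> sets (stopped_alg ?\<tau>)"
    proof (rule stopped_algI[OF st])
      show "?A n \<in> sets path_alg" using An filt_path_alg by blast
      fix t :: real assume "0 \<le> t"
      then show "?A n \<inter> {\<omega>. ?\<tau> \<omega> \<le> Time (ennreal t)} \<in> sets (filt t)"
        using An filt_mono[of "real n" t] by (cases "real n \<le> t") (auto simp: ennreal_le_iff)
    qed
    have AP: "?A n \<in> sets (P y)" using An filt_path_alg sets_P[OF y] by blast
    have "emeasure (P y) (stay ?C) \<le> emeasure (P y) (?A n \<inter> stay_after ?\<tau> ?C)"
    proof (rule emeasure_mono)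
      show "stay ?C \<subseteq> ?A n \<inter> stay_after ?\<tau> ?C"
        by (auto simp: stay_def stay_after_def grid_stay_def)
      show "?A n \<inter> stay_after ?\<tau> ?C \<in> sets (P y)" using AP stay_after_sets[OF C st] sets_P[OF y] by auto
    qed
    also have "\<dots> = (\<integral>\<^sup>+\<omega>. indicator (?A n) \<omega> * emeasure (P (value_at y ?\<tau> \<omega>)) (stay ?C) \<partial>P y)"
      by (rule markov_stay[OF C st y A]) auto
    also have "\<dots> \<le> (\<integral>\<^sup>+\<omega>. ennreal q * indicator (?A n) \<omega> \<partial>P y)"
    proof (rule nn_integral_mono)
      fix \<omega>
      have "emeasure (P (value_at y ?\<tau> \<omega>)) (stay ?C) \<le> ennreal q" if "\<omega> \<in> ?A n"
      proof (rule qz)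
        have "Y (real (n * 2 ^ n) * (1/2) ^ n) \<omega> \<in> ?C" using that unfolding grid_stay_def by blast
        then show "value_at y ?\<tau> \<omega> \<in> ?C" by (simp add: value_at_def power_one_over)
      qed
      then show "indicator (?A n) \<omega> * emeasure (P (value_at y ?\<tau> \<omega>)) (stay ?C) \<le> ennreal q * indicator (?A n) \<omega>"
        by (auto simp: indicator_def)
    qed
    also have "\<dots> = ennreal q * emeasure (P y) (?A n)" using AP by (simp add: nn_integral_cmult_indicator)
    finally show ?thesis .
  qed
  have "(\<lambda>n. emeasure (P y) (C_abs \<inter> ?A n)) \<longlonglongrightarrow> emeasure (P y) (C_abs \<inter> stay ?C)"
    unfolding grid_stay_eq stay_eq
    by (rule grid_stay_prob_tendsto[OF C stopping_time_const y]) (use sets.top[of path_alg] in simp)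
  moreover have "C_abs \<inter> ?A n = ?A n" "C_abs \<inter> stay ?C = stay ?C" for n by (auto simp: stay_def grid_stay_def)
  ultimately have "(\<lambda>n. emeasure (P y) (?A n)) \<longlonglongrightarrow> emeasure (P y) (stay ?C)" by simp
  then have l: "(\<lambda>n. measure (P y) (?A n)) \<longlonglongrightarrow> u"
    by (simp add: Py.emeasure_eq_measure u_def)
  have "u \<le> q * measure (P y) (?A n)" for n
    using step[of n] q0 by (simp add: Py.emeasure_eq_measure u_def ennreal_mult'[symmetric] ennreal_le_iff)
  then have "u \<le> q * u" using LIMSEQ_le_const[OF tendsto_mult_left[OF l, of q]] by blast
  then have "u = 0" using q(1) measure_nonneg[of "P y" "stay ?C"]
    by (metis u_def mult_le_cancel_right1 not_le order_antisym)
  then have "emeasure (P y) (stay ?C) = 0" by (simp add: Py.emeasure_eq_measure u_def)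
  then have "AE \<omega> in P y. \<omega> \<notin> stay ?C"
    by (intro AE_not_in) (use stay_sets[OF C] sets_P[OF y] in \<open>auto simp: null_sets_def\<close>)
  then show ?thesis using AE_space by eventually_elim (auto simp: stay_def space_P[OF y])
qed

end

section \<open>Long-run behaviour in terms of the scale function\<close>

text \<open>A substitute for continuity from below when the approximating events depend on a sequence of
  levels that need not be monotone.\<close>

lemma measure_tendsto_eventually:
  assumes M: "prob_space M" and A: "A \<in> sets M" and An: "\<And>n. An n \<in> sets M"
    and ev: "AE \<omega> in M. \<omega> \<in> A \<longrightarrow> (\<forall>\<^sub>F n in sequentially. \<omega> \<in> An n)"
  shows "(\<lambda>n. measure M (A \<inter> An n)) \<longlonglongrightarrow> measure M A"
proof -
  interpret M: prob_space M by fact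
  have "(\<lambda>n. \<integral>\<omega>. indicator (A \<inter> An n) \<omega> \<partial>M) \<longlonglongrightarrow> (\<integral>\<omega>. indicat_real A \<omega> \<partial>M)"
  proof (rule integral_dominated_convergence[where w="\<lambda>_. 1"])
    show "AE \<omega> in M. (\<lambda>n. indicat_real (A \<inter> An n) \<omega>) \<longlonglongrightarrow> indicat_real A \<omega>"
      using ev
    proof eventually_elim
      case (elim \<omega>)
      have "\<forall>\<^sub>F n in sequentially. indicat_real (A \<inter> An n) \<omega> = indicat_real A \<omega>"
      proof (cases "\<omega> \<in> A")
        case True
        then have "\<forall>\<^sub>F n in sequentially. \<omega> \<in> An n" using elim by blast
        then show ?thesis by eventually_elim (simp add: True)
      qed simp
      then show ?case by (rule tendsto_eventually)
    qed
  qed (use A An in \<open>auto simp: indicator_def\<close>)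
  then show ?thesis using A An by simp
qed

lemma integral_affine_indicator:
  fixes c d :: real
  assumes M: "prob_space M" and A: "A \<in> sets M"
  shows "integrable M (\<lambda>\<omega>. c * indicator A \<omega> + d)"
    and "(\<integral>\<omega>. c * indicator A \<omega> + d \<partial>M) = c * measure M A + d"
proof -
  interpret M: prob_space M by fact
  have i: "integrable M (\<lambda>\<omega>. c * indicator A \<omega>)"
    using A by (intro integrable_mult_right) (auto intro: M.integrable_const_bound[of _ 1])
  then show "integrable M (\<lambda>\<omega>. c * indicator A \<omega> + d)" by simp
  have "(\<integral>\<omega>. c * indicator A \<omega> + d \<partial>M) = (\<integral>\<omega>. c * indicator A \<omega> \<partial>M) + (\<integral>\<omega>. d \<partial>M)"
    by (rule Bochner_Integration.integral_add[OF i]) simp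
  then show "(\<integral>\<omega>. c * indicator A \<omega> + d \<partial>M) = c * measure M A + d"
    using A sets.Int_space_eq2[OF A] by (simp add: M.prob_space)
qed

lemma approaching_from_below:
  fixes m r :: ereal
  assumes "m < r"
  obtains b :: "nat \<Rightarrow> ereal" where "\<And>n. b n < r" "\<And>n. m < b n" "b \<longlonglongrightarrow> r"
proof -
  obtain m' where m': "m < m'" "m' < r" using dense[OF assms] by blast
  obtain u where u: "\<And>n. u n < r" "u \<longlonglongrightarrow> r" using approx_from_below_dense_linorder[OF assms] by auto
  have "(\<lambda>n. max (u n) m') \<longlonglongrightarrow> max r m'" by (intro tendsto_max u tendsto_const)
  moreover have "max r m' = r" using m' by simp
  ultimately show ?thesis using that[of "\<lambda>n. max (u n) m'"] u m' by (auto simp: less_max_iff_disj)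
qed

context absorbed_paths
begin

text \<open>The image of a compact time interval is closed; if it omits \<open>e\<close>, it omits a neighbourhood of \<open>e\<close>.\<close>

lemma eventually_not_attained:
  assumes w: "\<omega> \<in> C_abs" and a: "a \<longlonglongrightarrow> e" and ne: "\<And>u. 0 \<le> u \<Longrightarrow> u \<le> v \<Longrightarrow> Y u \<omega> \<noteq> e"
  shows "\<forall>\<^sub>F n in sequentially. \<forall>u. 0 \<le> u \<longrightarrow> u \<le> v \<longrightarrow> Y u \<omega> \<noteq> a n"
proof -
  have "continuous_on {0..v} (\<lambda>t. Y t \<omega>)" by (rule continuous_on_subset[OF cont[OF w]]) auto
  then have "compact ((\<lambda>t. Y t \<omega>) ` {0..v})" by (rule compact_continuous_image) simp
  then have "open (- ((\<lambda>t. Y t \<omega>) ` {0..v}))" by (intro open_Compl compact_imp_closed)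
  moreover have "e \<in> - ((\<lambda>t. Y t \<omega>) ` {0..v})" by (metis ComplI imageE atLeastAtMost_iff ne)
  ultimately have "\<forall>\<^sub>F n in sequentially. a n \<in> - ((\<lambda>t. Y t \<omega>) ` {0..v})" using a by (metis topological_tendstoD)
  then show ?thesis by eventually_elim (auto intro!: rev_image_eqI)
qed

lemma no_return:
  assumes w: "\<omega> \<in> C_abs" and u: "0 \<le> u" "Y u \<omega> = a" and nr: "\<not> return_time Y a c \<omega> < Time \<infinity>" and t: "u \<le> t"
  shows "a < c \<Longrightarrow> Y t \<omega> < c" and "c < a \<Longrightarrow> c < Y t \<omega>"
proof -
  have nc: "Y q \<omega> \<noteq> c" if "u \<le> q" for q
    using nr that u return_time_less_infinity_iff[OF w] by blast
  show "Y t \<omega> < c" if "a < c"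
    using crossing[OF w u(1) t, of c] nc u that by (metis less_imp_le not_less)
  show "c < Y t \<omega>" if "c < a"
    using crossing[OF w u(1) t, of c] nc u that by (metis less_imp_le not_less)
qed

lemma value_bound:
  assumes w: "\<omega> \<in> C_abs" and t: "0 \<le> t" and le: "\<sigma> \<omega> \<le> hit_time Y b \<omega>"
  shows "Y 0 \<omega> \<le> b \<Longrightarrow> Y (trunc \<sigma> t \<omega>) \<omega> \<le> b" and "b \<le> Y 0 \<omega> \<Longrightarrow> b \<le> Y (trunc \<sigma> t \<omega>) \<omega>"
proof -
  let ?u = "trunc \<sigma> t \<omega>"
  have u: "0 \<le> ?u" by (rule trunc_bounds[OF t])
  have *: "Y ?u \<omega> = b" if q: "0 \<le> q" "q \<le> ?u" "Y q \<omega> = b" for q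
  proof -
    have "hit_time Y b \<omega> \<le> Time (ennreal q)" using hit_time_le_iff[OF w q(1)] q by blast
    then have "\<sigma> \<omega> \<le> Time (ennreal q)" using le by (rule order_trans[rotated])
    then have "?u \<le> q" using q(1) t by (rule trunc_le)
    then show ?thesis using q by (metis order_antisym)
  qed
  show "Y ?u \<omega> \<le> b" if "Y 0 \<omega> \<le> b"
    using crossing[OF w order_refl u, of b] * that by (metis linear)
  show "b \<le> Y ?u \<omega>" if "b \<le> Y 0 \<omega>"
    using crossing[OF w order_refl u, of b] * that by (metis linear)
qed

end

locale scaled_laws = regular_laws +
  fixes s :: "ereal \<Rightarrow> ereal"
  assumes scale: "scale_function l r Y P s"
begin

lemma s_finite: "x \<in> {l<..<r} \<Longrightarrow> \<bar>s x\<bar> \<noteq> \<infinity>"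
  and s_cont_interior: "continuous_on {l<..<r} s"
  and s_mono_interior: "strict_mono_on {l<..<r} s"
  and s_local_martingale: "y \<in> {l<..<r} \<Longrightarrow> local_martingale (P y) (\<lambda>t \<omega>. s (Y t \<omega>))"
  and s_at_l: "(s \<longlongrightarrow> s l) (at_right l)"
  and s_at_r: "(s \<longlongrightarrow> s r) (at_left r)"
  using scale by (auto simp: scale_function_def)

lemma s_l_less: "x \<in> {l<..<r} \<Longrightarrow> s l < s x"
proof -
  assume x: "x \<in> {l<..<r}"
  then obtain x' where x': "l < x'" "x' < x" using dense by auto
  have x'I: "x' \<in> {l<..<r}" using x x' by (auto intro: less_trans)
  have "s l \<le> s x'"
  proof (rule ccontr)
    assume "\<not> s l \<le> s x'"
    then have "\<forall>\<^sub>F w in at_right l. s x' < s w" using order_tendstoD(1)[OF s_at_l] by auto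
    then obtain b where b: "l < b" "\<And>w. l < w \<Longrightarrow> w < b \<Longrightarrow> s x' < s w"
      unfolding eventually_at_right[OF lr] by blast
    have "l < min b x'" using b(1) x' by simp
    from dense[OF this] obtain w where "l < w" "w < min b x'" by blast
    moreover from this have "w \<in> {l<..<r}" using x'I by (auto intro: less_trans)
    ultimately show False using b(2)[of w] strict_mono_onD[OF s_mono_interior _ x'I, of w] by auto
  qed
  also have "s x' < s x" by (rule strict_mono_onD[OF s_mono_interior x'I x x'(2)])
  finally show ?thesis .
qed

lemma s_less_r: "x \<in> {l<..<r} \<Longrightarrow> s x < s r"
proof -
  assume x: "x \<in> {l<..<r}"
  then obtain x' where x': "x < x'" "x' < r" using dense by auto
  have x'I: "x' \<in> {l<..<r}" using x x' by (auto intro: less_trans)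
  have "s x < s x'" by (rule strict_mono_onD[OF s_mono_interior x x'I x'(1)])
  also have "s x' \<le> s r"
  proof (rule ccontr)
    assume "\<not> s x' \<le> s r"
    then have "\<forall>\<^sub>F w in at_left r. s w < s x'" using order_tendstoD(2)[OF s_at_r] by auto
    then obtain b where b: "b < r" "\<And>w. b < w \<Longrightarrow> w < r \<Longrightarrow> s w < s x'"
      unfolding eventually_at_left[OF lr] by blast
    have "max b x' < r" using b(1) x' by simp
    from dense[OF this] obtain w where "max b x' < w" "w < r" by blast
    moreover from this have "w \<in> {l<..<r}" using x'I by (auto intro: less_trans)
    ultimately show False using b(2)[of w] strict_mono_onD[OF s_mono_interior x'I, of w] by auto
  qed
  finally show ?thesis .
qed

lemma s_strict_mono: "x \<in> {l..r} \<Longrightarrow> x' \<in> {l..r} \<Longrightarrow> x < x' \<Longrightarrow> s x < s x'"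
proof -
  assume x: "x \<in> {l..r}" "x' \<in> {l..r}" "x < x'"
  have lr': "s l < s r"
  proof -
    obtain m where "l < m" "m < r" using dense[OF lr] by blast
    then show ?thesis using s_l_less[of m] s_less_r[of m] by auto
  qed
  consider "x = l" "x' = r" | "x = l" "x' \<in> {l<..<r}" | "x \<in> {l<..<r}" "x' = r" | "x \<in> {l<..<r}" "x' \<in> {l<..<r}"
    using x by (auto simp: le_less)
  then show ?thesis
    using lr' s_l_less s_less_r strict_mono_onD[OF s_mono_interior _ _ x(3)] by cases auto
qed

lemma s_mono: "x \<in> {l..r} \<Longrightarrow> x' \<in> {l..r} \<Longrightarrow> x \<le> x' \<Longrightarrow> s x \<le> s x'"
  using s_strict_mono[of x x'] by (cases "x = x'") (auto simp: less_le)

text \<open>Continuity at the endpoints is the definition of \<open>s l\<close> and \<open>s r\<close> as limits.\<close>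

lemma s_cont: "continuous_on {l..r} s"
  unfolding continuous_on_eq_continuous_within
proof
  fix x assume x: "x \<in> {l..r}"
  consider "x = l" | "x = r" | "x \<in> {l<..<r}" using x by (auto simp: le_less)
  then show "continuous (at x within {l..r}) s"
  proof cases
    case 1
    then show ?thesis using s_at_l lr by (simp add: continuous_within at_within_Icc_at_right)
  next
    case 2
    then show ?thesis using s_at_r lr by (simp add: continuous_within at_within_Icc_at_left)
  next
    case 3
    then have "continuous (at x) s" using s_cont_interior continuous_on_eq_continuous_at[OF open_greaterThanLessThan] by blast
    then show ?thesis by (rule continuous_at_imp_continuous_at_within)
  qed
qed

lemma Z_cont_adapted: "cont_adapted (\<lambda>t \<omega>. s (Y t \<omega>))"
  unfolding cont_adapted_def
proof safe
  fix t :: real assume t: "0 \<le> t"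
  have "Y t \<in> measurable (filt t) (restrict_space borel {l..r})"
    by (rule measurable_restrict_space2) (use range t meas in auto)
  moreover have "s \<in> borel_measurable (restrict_space borel {l..r})"
    by (rule borel_measurable_continuous_on_restrict[OF s_cont])
  ultimately show "(\<lambda>\<omega>. s (Y t \<omega>)) \<in> borel_measurable (filt t)" by (rule measurable_compose)
next
  fix \<omega> assume w: "\<omega> \<in> C_abs"
  show "continuous_on {0..} (\<lambda>t. s (Y t \<omega>))"
    by (rule continuous_on_compose2[OF s_cont cont[OF w]]) (use range[OF w] in auto)
qed

lemma s_tendsto:
  assumes "(f \<longlongrightarrow> e) F" "e \<in> {l..r}" "\<forall>\<^sub>F x in F. f x \<in> {l..r}"
  shows "((\<lambda>x. s (f x)) \<longlongrightarrow> s e) F"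
  by (rule continuous_on_tendsto_compose[OF s_cont assms])

lemma interior_closed: "y \<in> {l<..<r} \<Longrightarrow> y \<in> {l..r}"
  by auto

lemma scale_bound:
  assumes fin: "\<bar>s \<alpha>\<bar> \<noteq> \<infinity>" "\<bar>s \<beta>\<bar> \<noteq> \<infinity>" and ab: "\<alpha> \<in> {l..r}" "\<beta> \<in> {l..r}"
  obtains K where "\<And>x. x \<in> {\<alpha>..\<beta>} \<Longrightarrow> \<bar>s x\<bar> \<le> ereal K"
proof
  let ?K = "max \<bar>real_of_ereal (s \<alpha>)\<bar> \<bar>real_of_ereal (s \<beta>)\<bar>"
  fix x assume x: "x \<in> {\<alpha>..\<beta>}"
  then have "x \<in> {l..r}" using ab by auto
  then have "s \<alpha> \<le> s x" "s x \<le> s \<beta>" using s_mono[of \<alpha> x] s_mono[of x \<beta>] x ab by auto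
  moreover obtain p q where "s \<alpha> = ereal p" "s \<beta> = ereal q" using fin by (cases "s \<alpha>"; cases "s \<beta>") auto
  moreover obtain z where "s x = ereal z" using calculation by (cases "s x") auto
  ultimately show "\<bar>s x\<bar> \<le> ereal ?K" by (simp only: abs_ereal.simps ereal_less_eq real_of_ereal.simps, linarith?)
qed

text \<open>Optional stopping, evaluated between time \<open>0\<close> and \<open>t\<close>.\<close>

lemma bounded_expectation:
  assumes y: "y \<in> {l<..<r}" and st: "stopping_time path_filt \<sigma>" and t: "0 \<le> t"
    and fin: "\<bar>s \<alpha>\<bar> \<noteq> \<infinity>" "\<bar>s \<beta>\<bar> \<noteq> \<infinity>" "\<alpha> \<in> {l..r}" "\<beta> \<in> {l..r}"
    and bd: "AE \<omega> in P y. \<forall>t\<ge>0. Y (trunc \<sigma> t \<omega>) \<omega> \<in> {\<alpha>..\<beta>}"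
  shows "(\<integral>\<omega>. real_of_ereal (s (Y (trunc \<sigma> t \<omega>) \<omega>)) \<partial>P y) = real_of_ereal (s y)"
    and "integrable (P y) (\<lambda>\<omega>. real_of_ereal (s (Y (trunc \<sigma> t \<omega>) \<omega>)))"
proof -
  interpret Py: prob_space "P y" by (rule prob[OF interior_closed[OF y]])
  note sP = sets_P[OF interior_closed[OF y]]
  obtain K where K: "\<And>x. x \<in> {\<alpha>..\<beta>} \<Longrightarrow> \<bar>s x\<bar> \<le> ereal K" using scale_bound[OF fin] by blast
  have bound: "AE \<omega> in P y. \<forall>t\<ge>0. \<bar>s (Y (trunc \<sigma> t \<omega>) \<omega>)\<bar> \<le> ereal K"
    using bd by eventually_elim (use K in blast)
  have top: "C_abs \<in> sets (filt 0)" using sets.top[of "filt 0"] by simp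
  have "(\<integral>\<omega>. real_of_ereal (s (Y (trunc \<sigma> t \<omega>) \<omega>)) \<partial>P y) =
     (\<integral>\<omega>\<in>C_abs. real_of_ereal (s (Y (trunc \<sigma> t \<omega>) \<omega>)) \<partial>P y)"
    unfolding set_lebesgue_integral_def
    by (rule Bochner_Integration.integral_cong[OF refl]) (simp add: space_P[OF interior_closed[OF y]])
  also have "\<dots> = (\<integral>\<omega>\<in>C_abs. real_of_ereal (s (Y (trunc \<sigma> 0 \<omega>) \<omega>)) \<partial>P y)"
    by (rule local_martingale_bounded_stopping[OF Py.prob_space_axioms sP Z_cont_adapted s_local_martingale[OF y] st bound order_refl t top])
  also have "\<dots> = (\<integral>\<omega>. real_of_ereal (s y) \<partial>P y)"
    unfolding set_lebesgue_integral_def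
  proof (rule integral_cong_AE)
    have m0: "(\<lambda>\<omega>. s (Y (trunc \<sigma> 0 \<omega>) \<omega>)) \<in> borel_measurable (filt 0)"
      by (rule measurable_trunc[OF Z_cont_adapted st]) simp
    have "(\<lambda>\<omega>. s (Y (trunc \<sigma> 0 \<omega>) \<omega>)) \<in> borel_measurable (P y)"
      by (rule measurable_from_subalg[OF subalgebra_path_filt[OF sP] m0])
    moreover have "C_abs \<in> sets (P y)" using sets.top[of "P y"] space_P[OF interior_closed[OF y]] by simp
    ultimately show "(\<lambda>\<omega>. indicat_real C_abs \<omega> *\<^sub>R real_of_ereal (s (Y (trunc \<sigma> 0 \<omega>) \<omega>))) \<in> borel_measurable (P y)"
      by (intro borel_measurable_scaleR borel_measurable_indicator borel_measurable_real_of_ereal)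
    show "AE \<omega> in P y. indicat_real C_abs \<omega> *\<^sub>R real_of_ereal (s (Y (trunc \<sigma> 0 \<omega>) \<omega>)) = real_of_ereal (s y)"
      using start[OF interior_closed[OF y]] AE_space
    proof eventually_elim
      case (elim \<omega>)
      have "trunc \<sigma> 0 \<omega> = 0" using trunc_bounds[of 0 \<sigma> \<omega>] by simp
      then show ?case using elim space_P[OF interior_closed[OF y]] by simp
    qed
  qed simp
  finally show "(\<integral>\<omega>. real_of_ereal (s (Y (trunc \<sigma> t \<omega>) \<omega>)) \<partial>P y) = real_of_ereal (s y)"
    by (simp add: Py.prob_space)
  have "(\<lambda>\<omega>. s (Y (trunc \<sigma> t \<omega>) \<omega>)) \<in> borel_measurable (P y)"
    by (rule measurable_from_subalg[OF subalgebra_path_filt[OF sP] measurable_trunc[OF Z_cont_adapted st t]])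
  then show "integrable (P y) (\<lambda>\<omega>. real_of_ereal (s (Y (trunc \<sigma> t \<omega>) \<omega>)))"
  proof (intro Py.integrable_const_bound[of _ K] borel_measurable_real_of_ereal)
    show "AE \<omega> in P y. norm (real_of_ereal (s (Y (trunc \<sigma> t \<omega>) \<omega>))) \<le> K"
      using bound
    proof eventually_elim
      case (elim \<omega>)
      then have "\<bar>s (Y (trunc \<sigma> t \<omega>) \<omega>)\<bar> \<le> ereal K" using t by blast
      then show ?case by (cases "s (Y (trunc \<sigma> t \<omega>) \<omega>)") auto
    qed
  qed
qed

lemma finite_sets_P:
  "stopping_time path_filt \<tau> \<Longrightarrow> {\<omega>\<in>C_abs. \<tau> \<omega> < Time \<infinity>} \<in> sets path_alg"
  using stopping_time_finite_sets stopped_alg_subset by blast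

abbreviation sr :: "ereal \<Rightarrow> real" where "sr x \<equiv> real_of_ereal (s x)"

lemma s_sr: "x \<in> {l<..<r} \<Longrightarrow> s x = ereal (sr x)"
  using s_finite[of x] by (simp add: ereal_real)

lemma sr_strict_mono:
  assumes "\<bar>s x\<bar> \<noteq> \<infinity>" "\<bar>s x'\<bar> \<noteq> \<infinity>" "x \<in> {l..r}" "x' \<in> {l..r}" "x < x'"
  shows "sr x < sr x'"
  using s_strict_mono[OF assms(3-5)] assms(1,2) by (cases "s x"; cases "s x'") auto

lemma sr_ge_l:
  assumes l_fin: "\<bar>s l\<bar> \<noteq> \<infinity>" and "\<bar>s \<beta>\<bar> \<noteq> \<infinity>" "\<beta> \<in> {l..r}" and x: "x \<in> {l..\<beta>}"
  shows "sr l \<le> sr x"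
proof -
  have x': "x \<in> {l..r}" using x assms(3) by auto
  have l: "l \<in> {l..r}" using lr by simp
  have "s l \<le> s x" "s x \<le> s \<beta>" using s_mono[OF l x'] s_mono[OF x' assms(3)] x by auto
  then show ?thesis using assms(1,2) by (cases "s l"; cases "s \<beta>"; cases "s x") auto
qed

text \<open>Doob's maximal inequality for the nonnegative process \<open>s(Y) - s(l)\<close>: stopped at the first visit to
  \<open>b\<close>, it has mean \<open>s(y) - s(l)\<close> and takes the value \<open>s(b) - s(l)\<close> on paths that have reached \<open>b\<close>.\<close>

lemma hit_above_prob:
  assumes l_fin: "\<bar>s l\<bar> \<noteq> \<infinity>" and y: "y \<in> {l<..<r}" and b: "b \<in> {l<..<r}" "y \<le> b"
  shows "(sr b - sr l) * measure (P y) {\<omega>\<in>C_abs. hit_time Y b \<omega> < Time \<infinity>} \<le> sr y - sr l"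
proof -
  note y' = interior_closed[OF y]
  interpret Py: prob_space "P y" by (rule prob[OF y'])
  let ?\<tau> = "hit_time Y b"
  have st: "stopping_time path_filt ?\<tau>" by (rule stopping_time_hit_time)
  have bd: "AE \<omega> in P y. \<forall>t\<ge>0. Y (trunc ?\<tau> t \<omega>) \<omega> \<in> {l..b}"
    using start[OF y'] AE_space
  proof eventually_elim
    case (elim \<omega>)
    then have w: "\<omega> \<in> C_abs" using space_P[OF y'] by simp
    show ?case using value_bound(1)[of \<omega> _ ?\<tau> b, OF w _ order_refl] range[OF w trunc_bounds(1)] elim(1) b(2) by auto
  qed
  let ?A = "{\<omega>\<in>C_abs. ?\<tau> \<omega> < Time \<infinity>}"
  let ?An = "\<lambda>n::nat. {\<omega>\<in>C_abs. ?\<tau> \<omega> \<le> Time (ennreal (real n))}"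
  have A: "?A \<in> sets (P y)" using finite_sets_P[OF st] sets_P[OF y'] by simp
  have An: "?An n \<in> sets (P y)" for n using stopping_time_le_sets[OF st] filt_path_alg sets_P[OF y'] by blast
  have fb: "\<bar>s b\<bar> \<noteq> \<infinity>" by (rule s_finite[OF b(1)])
  have lb: "l \<in> {l..r}" "b \<in> {l..r}" using b lr by auto
  have bound: "(sr b - sr l) * measure (P y) (?A \<inter> ?An n) \<le> sr y - sr l" for n
  proof -
    have t: "0 \<le> real n" by simp
    have sub: "?A \<inter> ?An n = ?An n" by (auto dest: le_Time_less_infinity)
    have "(sr b - sr l) * measure (P y) (?An n) + sr l = (\<integral>\<omega>. (sr b - sr l) * indicator (?An n) \<omega> + sr l \<partial>P y)"
      by (rule integral_affine_indicator(2)[OF Py.prob_space_axioms An, symmetric])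
    also have "\<dots> \<le> (\<integral>\<omega>. sr (Y (trunc ?\<tau> (real n) \<omega>) \<omega>) \<partial>P y)"
    proof (rule integral_mono_AE)
      show "integrable (P y) (\<lambda>\<omega>. (sr b - sr l) * indicator (?An n) \<omega> + sr l)"
        by (rule integral_affine_indicator(1)[OF Py.prob_space_axioms An])
      show "integrable (P y) (\<lambda>\<omega>. sr (Y (trunc ?\<tau> (real n) \<omega>) \<omega>))"
        by (rule bounded_expectation(2)[OF y st t l_fin fb lb bd])
      show "AE \<omega> in P y. (sr b - sr l) * indicator (?An n) \<omega> + sr l \<le> sr (Y (trunc ?\<tau> (real n) \<omega>) \<omega>)"
        using bd AE_space
      proof eventually_elim
        case (elim \<omega>)
        then have w: "\<omega> \<in> C_abs" using space_P[OF y'] by simp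
        have v: "Y (trunc ?\<tau> (real n) \<omega>) \<omega> \<in> {l..b}" using elim t by blast
        show ?case
        proof (cases "\<omega> \<in> ?An n")
          case True
          then have h: "?\<tau> \<omega> \<le> Time (ennreal (real n))" by blast
          then have "Y (trunc ?\<tau> (real n) \<omega>) \<omega> = b"
            using at_hit_time(1)[OF w le_Time_less_infinity[OF h]] by (simp add: trunc_def)
          then show ?thesis using True by simp
        next
          case False
          have "sr l \<le> sr (Y (trunc ?\<tau> (real n) \<omega>) \<omega>)" by (rule sr_ge_l[OF l_fin fb lb(2) v])
          then show ?thesis using False by simp
        qed
      qed
    qed
    also have "\<dots> = sr y" by (rule bounded_expectation(1)[OF y st t l_fin fb lb bd])
    finally show ?thesis unfolding sub by simp
  qed
  have "(\<lambda>n. measure (P y) (?A \<inter> ?An n)) \<longlonglongrightarrow> measure (P y) ?A"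
  proof (rule measure_tendsto_eventually[OF Py.prob_space_axioms A An], rule AE_I2, rule impI)
    fix \<omega> assume w: "\<omega> \<in> ?A"
    then obtain N :: nat where "?\<tau> \<omega> \<le> Time (ennreal (real N))" using finite_time_iff by blast
    then have "\<forall>n\<ge>N. \<omega> \<in> ?An n" using w by (auto elim!: order_trans intro!: ennreal_leI)
    then show "\<forall>\<^sub>F n in sequentially. \<omega> \<in> ?An n" unfolding eventually_sequentially by blast
  qed
  from tendsto_mult_left[OF this, of "sr b - sr l"] show ?thesis
    by (rule LIMSEQ_le_const2) (use bound in blast)
qed

text \<open>Stop \<open>s(Y)\<close> at \<open>\<rho> \<and> \<tau>\<^sub>b\<close> and at \<open>\<tau>\<^sub>a \<and> \<tau>\<^sub>b\<close>, where \<open>\<rho>\<close> is the return time. Both stopped processes have mean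
  \<open>s(y)\<close>, and they differ only on paths that have visited \<open>a\<close>. There the second one equals \<open>s(a)\<close>,
  while the first one is at least \<open>s(l)\<close> and equals \<open>s(c)\<close> once \<open>\<rho>\<close> has come. Comparing means gives the
  bound for returns before \<open>\<tau>\<^sub>b\<close>. Every return is of this kind for \<open>b\<close> close to \<open>r\<close>: a path that visits
  \<open>c\<close> at a finite time has not been absorbed at \<open>r\<close> before.\<close>

lemma return_above_prob:
  assumes l_fin: "\<bar>s l\<bar> \<noteq> \<infinity>" and y: "y \<in> {l<..<r}" and a: "l < a" "a < c" "a < y" and c: "c < r"
  shows "(sr c - sr l) * measure (P y) {\<omega>\<in>C_abs. return_time Y a c \<omega> < Time \<infinity>} \<le> sr a - sr l"
proof -
  note y' = interior_closed[OF y]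
  interpret Py: prob_space "P y" by (rule prob[OF y'])
  let ?\<rho> = "return_time Y a c"
  let ?m = "max c y"
  have m: "?m < r" using c y by auto
  obtain b where b: "\<And>n. b n < r" "\<And>n. ?m < b n" "b \<longlonglongrightarrow> r"
    using approaching_from_below[OF m] by metis
  have st\<rho>: "stopping_time path_filt ?\<rho>" by (rule stopping_time_return_time) (use a in auto)
  let ?s1 = "\<lambda>n \<omega>. min (?\<rho> \<omega>) (hit_time Y (b n) \<omega>)"
  let ?s2 = "\<lambda>n \<omega>. min (hit_time Y a \<omega>) (hit_time Y (b n) \<omega>)"
  have st1: "stopping_time path_filt (?s1 n)" for n by (rule stopping_time_min[OF st\<rho> stopping_time_hit_time])
  have st2: "stopping_time path_filt (?s2 n)" for n by (rule stopping_time_min[OF stopping_time_hit_time stopping_time_hit_time])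
  have bI: "b n \<in> {l<..<r}" for n
  proof -
    have "l < ?m" using y by (simp add: less_max_iff_disj)
    from less_trans[OF this b(2)] show ?thesis using b(1)[of n] by simp
  qed
  have bd: "AE \<omega> in P y. \<forall>t\<ge>0. Y (trunc (\<lambda>\<omega>. min (\<sigma> \<omega>) (hit_time Y (b n) \<omega>)) t \<omega>) \<omega> \<in> {l..b n}" for n \<sigma>
    using start[OF y'] AE_space
  proof eventually_elim
    case (elim \<omega>)
    then have w: "\<omega> \<in> C_abs" using space_P[OF y'] by simp
    have "y \<le> b n" using b(2)[of n] by auto
    then show ?case using value_bound(1)[of \<omega> _ "\<lambda>\<omega>. min (\<sigma> \<omega>) (hit_time Y (b n) \<omega>)" "b n", OF w _ min.cobounded2] range[OF w trunc_bounds(1)] elim(1) by auto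
  qed
  let ?A = "{\<omega>\<in>C_abs. ?\<rho> \<omega> < Time \<infinity>}"
  let ?An = "\<lambda>n::nat. {\<omega>\<in>C_abs. ?\<rho> \<omega> \<le> Time (ennreal (real n))} \<inter> {\<omega>\<in>C_abs. ?\<rho> \<omega> < hit_time Y (b n) \<omega>}"
  have A: "?A \<in> sets (P y)" using finite_sets_P[OF st\<rho>] sets_P[OF y'] by simp
  have An: "?An n \<in> sets (P y)" for n
    using stopping_time_le_sets[OF st\<rho>] filt_path_alg sets_P[OF y'] stopping_time_less_sets[OF st\<rho> stopping_time_hit_time] by blast
  have lb: "l \<in> {l..r}" using lr by auto
  have bound: "(sr c - sr l) * measure (P y) (?A \<inter> ?An n) \<le> sr a - sr l" for n
  proof -
    let ?t = "real n"
    have t: "0 \<le> ?t" by simp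
    have fb: "\<bar>s (b n)\<bar> \<noteq> \<infinity>" by (rule s_finite[OF bI])
    note E1 = bounded_expectation[OF y st1 t l_fin fb lb interior_closed[OF bI] bd]
    note E2 = bounded_expectation[OF y st2 t l_fin fb lb interior_closed[OF bI] bd]
    let ?W1 = "\<lambda>\<omega>. sr (Y (trunc (?s1 n) ?t \<omega>) \<omega>)" and ?W2 = "\<lambda>\<omega>. sr (Y (trunc (?s2 n) ?t \<omega>) \<omega>)"
    have sub: "?A \<inter> ?An n = ?An n" by (auto dest: le_Time_less_infinity)
    have bd1: "AE \<omega> in P y. \<forall>t\<ge>0. Y (trunc (?s1 n) t \<omega>) \<omega> \<in> {l..b n}" by (rule bd)
    have "(sr c - sr l) * measure (P y) (?An n) - (sr a - sr l) = (\<integral>\<omega>. (sr c - sr l) * indicator (?An n) \<omega> + - (sr a - sr l) \<partial>P y)"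
      by (subst integral_affine_indicator(2)[OF Py.prob_space_axioms An]) simp
    also have "\<dots> \<le> (\<integral>\<omega>. ?W1 \<omega> - ?W2 \<omega> \<partial>P y)"
    proof (rule integral_mono_AE)
      show "integrable (P y) (\<lambda>\<omega>. (sr c - sr l) * indicator (?An n) \<omega> + - (sr a - sr l))"
        by (rule integral_affine_indicator(1)[OF Py.prob_space_axioms An])
      show "integrable (P y) (\<lambda>\<omega>. ?W1 \<omega> - ?W2 \<omega>)" using E1(2) E2(2) by (rule Bochner_Integration.integrable_diff)
      show "AE \<omega> in P y. (sr c - sr l) * indicator (?An n) \<omega> + - (sr a - sr l) \<le> ?W1 \<omega> - ?W2 \<omega>"
        using bd1 AE_space
      proof eventually_elim
        case (elim \<omega>)
        then have w: "\<omega> \<in> C_abs" using space_P[OF y'] by simp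
        have aI: "a \<in> {l<..<r}" using a(1) less_trans[OF a(2) c] by simp
        have sla: "sr l \<le> sr a"
          by (rule sr_ge_l[OF l_fin s_finite[OF aI] interior_closed[OF aI]]) (use a in simp)
        let ?T1 = "trunc (?s1 n) ?t \<omega>" and ?T2 = "trunc (?s2 n) ?t \<omega>"
        have v: "Y ?T1 \<omega> \<in> {l..b n}" using elim(1) t by blast
        have W1: "sr l \<le> ?W1 \<omega>" by (rule sr_ge_l[OF l_fin fb interior_closed[OF bI] v])
        show ?case
        proof (cases "\<omega> \<in> ?An n")
          case True
          then have h: "?\<rho> \<omega> \<le> Time (ennreal ?t)" "?\<rho> \<omega> < hit_time Y (b n) \<omega>" by auto
          have "Y ?T1 \<omega> = c" using h at_return_time[OF w le_Time_less_infinity[OF h(1)]] by (simp add: trunc_def)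
          moreover have "Y ?T2 \<omega> = a"
          proof -
            let ?v = "time_val (?\<rho> \<omega>)"
            have fin: "?\<rho> \<omega> < Time \<infinity>" by (rule le_Time_less_infinity[OF h(1)])
            then have "?\<rho> \<omega> \<le> Time (ennreal ?v)" by (simp add: Time_time_val)
            then obtain u where u: "0 \<le> u" "u \<le> ?v" "Y u \<omega> = a" using return_time_le_iff[OF w time_val_nonneg] by (meson order_trans)
            then have "hit_time Y a \<omega> \<le> Time (ennreal ?v)" using hit_time_le_iff[OF w time_val_nonneg] by blast
            then have ha: "hit_time Y a \<omega> \<le> ?\<rho> \<omega>" using fin by (simp add: Time_time_val)
            then have "hit_time Y a \<omega> \<le> Time (ennreal ?t)" "hit_time Y a \<omega> \<le> hit_time Y (b n) \<omega>" using h by auto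
            then show ?thesis using at_hit_time(1)[OF w le_Time_less_infinity] by (simp add: trunc_def min_absorb1)
          qed
          ultimately show ?thesis using True by simp
        next
          case False
          then have ind: "indicat_real (?An n) \<omega> = 0" by (rule indicator_simps)
          show ?thesis
          proof (cases "hit_time Y a \<omega> \<le> Time (ennreal ?t) \<and> hit_time Y a \<omega> \<le> hit_time Y (b n) \<omega>")
            case True
            then have "Y ?T2 \<omega> = a" using at_hit_time(1)[OF w le_Time_less_infinity[OF conjunct1[OF True]]] by (simp add: trunc_def min_absorb1)
            then show ?thesis using W1 unfolding ind by simp
          next
            case F: False
            have ge: "hit_time Y a \<omega> \<le> ?\<rho> \<omega>"
            proof (cases "?\<rho> \<omega> < Time \<infinity>")
              case True
              then have "?\<rho> \<omega> \<le> Time (ennreal (time_val (?\<rho> \<omega>)))" by (simp add: Time_time_val)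
              then obtain u where u: "0 \<le> u" "u \<le> time_val (?\<rho> \<omega>)" "Y u \<omega> = a"
                using return_time_le_iff[OF w time_val_nonneg] by (meson order_trans)
              then have "hit_time Y a \<omega> \<le> Time (ennreal (time_val (?\<rho> \<omega>)))" using hit_time_le_iff[OF w time_val_nonneg] by blast
              then show ?thesis using True by (simp add: Time_time_val)
            next
              case False
              then have "?\<rho> \<omega> = Beyond" using return_time_less_infinity[of a c \<omega>] by (cases "?\<rho> \<omega>") auto
              then show ?thesis by simp
            qed
            have "?T1 = ?T2"
            proof (cases "hit_time Y (b n) \<omega> < hit_time Y a \<omega>")
              case True
              then have "min (?\<rho> \<omega>) (hit_time Y (b n) \<omega>) = hit_time Y (b n) \<omega>" "min (hit_time Y a \<omega>) (hit_time Y (b n) \<omega>) = hit_time Y (b n) \<omega>"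
                using ge by auto
              then show ?thesis by (simp add: trunc_def)
            next
              case G: False
              then have "\<not> hit_time Y a \<omega> \<le> Time (ennreal ?t)" using F by auto
              then have "\<not> min (?\<rho> \<omega>) (hit_time Y (b n) \<omega>) \<le> Time (ennreal ?t)" "\<not> min (hit_time Y a \<omega>) (hit_time Y (b n) \<omega>) \<le> Time (ennreal ?t)"
                using ge G by (auto simp: min_le_iff_disj not_le)
              then show ?thesis by (simp add: trunc_def)
            qed
            then show ?thesis using sla unfolding ind by simp
          qed
        qed
      qed
    qed
    also have "\<dots> = 0" using E1 E2 by simp
    finally show ?thesis unfolding sub by simp
  qed
  have "(\<lambda>n. measure (P y) (?A \<inter> ?An n)) \<longlonglongrightarrow> measure (P y) ?A"
  proof (rule measure_tendsto_eventually[OF Py.prob_space_axioms A An], rule AE_I2, rule impI)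
    fix \<omega> assume w: "\<omega> \<in> ?A"
    then have w0: "\<omega> \<in> C_abs" and fin: "?\<rho> \<omega> < Time \<infinity>" by auto
    let ?v = "time_val (?\<rho> \<omega>)"
    obtain N :: nat where N: "?\<rho> \<omega> \<le> Time (ennreal (real N))" using finite_time_iff fin by blast
    have "Y u \<omega> \<noteq> r" if "0 \<le> u" "u \<le> ?v" for u
      using absorbed[OF w0 that] at_return_time[OF w0 fin] c by auto
    from eventually_not_attained[OF w0 b(3) this]
    have "\<forall>\<^sub>F n in sequentially. \<forall>u. 0 \<le> u \<longrightarrow> u \<le> ?v \<longrightarrow> Y u \<omega> \<noteq> b n" by blast
    then show "\<forall>\<^sub>F n in sequentially. \<omega> \<in> ?An n"
      using eventually_ge_at_top[of N]
    proof eventually_elim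
      case (elim n)
      have "\<not> hit_time Y (b n) \<omega> \<le> Time (ennreal ?v)" using elim(1) hit_time_le_iff[OF w0 time_val_nonneg] by blast
      then have "?\<rho> \<omega> < hit_time Y (b n) \<omega>" using fin by (simp add: Time_time_val not_le)
      moreover have "?\<rho> \<omega> \<le> Time (ennreal (real n))"
        using N elim(2) by (elim order_trans) (simp add: ennreal_leI)
      ultimately show ?case using w0 by blast
    qed
  qed
  from tendsto_mult_left[OF this, of "sr c - sr l"] show ?thesis
    by (rule LIMSEQ_le_const2) (use bound in blast)
qed

end

lemma approaching_from_above:
  fixes m l :: ereal
  assumes "l < m"
  obtains a :: "nat \<Rightarrow> ereal" where "\<And>n. l < a n" "\<And>n. a n < m" "a \<longlonglongrightarrow> l"
proof -
  have "- m < - l" using assms by simp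
  from approaching_from_below[OF this] obtain b :: "nat \<Rightarrow> ereal"
    where b: "\<And>n. b n < - l" "\<And>n. - m < b n" "b \<longlonglongrightarrow> - l" by blast
  have "(\<lambda>n. - b n) \<longlonglongrightarrow> - (- l)" using b(3) by (rule tendsto_uminus_ereal)
  moreover have "l < - b n" "- b n < m" for n
    using b(1,2)[of n] by (simp_all add: ereal_less_uminus_reorder ereal_uminus_less_reorder)
  ultimately show ?thesis using that[of "\<lambda>n. - b n"] by simp
qed

lemma hit_time_uminus: "hit_time (\<lambda>t \<omega>. - Y t \<omega>) a \<omega> = hit_time Y (- a) \<omega>"
proof -
  have 1: "- Y t \<omega> = a \<longleftrightarrow> Y t \<omega> = - a" for t by (metis ereal_uminus_uminus)
  have 2: "((\<lambda>t. - Y t \<omega>) \<longlongrightarrow> a) at_top \<longleftrightarrow> ((\<lambda>t. Y t \<omega>) \<longlongrightarrow> - a) at_top"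
    using tendsto_uminus_ereal[of "\<lambda>t. - Y t \<omega>" a at_top] tendsto_uminus_ereal[of "\<lambda>t. Y t \<omega>" "- a" at_top] by auto
  show ?thesis unfolding hit_time_def 1 2 ..
qed

lemma stopped_uminus: "stopped (\<lambda>t \<omega>. - X t \<omega>) \<tau> = (\<lambda>t \<omega>. - stopped X \<tau> t \<omega>)"
  by (intro ext) (simp add: stopped_def)

lemma martingale_uminus:
  assumes M: "prob_space M" "sets M = sets path_alg" and X: "martingale M X"
  shows "martingale M (\<lambda>t \<omega>. - X t \<omega>)"
  unfolding martingale_def
proof (intro conjI allI impI)
  interpret M: prob_space M by fact
  fix t :: real assume t: "0 \<le> t"
  have Xt: "X t \<in> borel_measurable (filt t)" "AE \<omega> in M. \<bar>X t \<omega>\<bar> \<noteq> \<infinity>" "integrable M (\<lambda>\<omega>. real_of_ereal (X t \<omega>))"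
    using X t unfolding martingale_def by blast+
  show "(\<lambda>\<omega>. - X t \<omega>) \<in> borel_measurable (filt t)" using Xt(1) by measurable
  show "AE \<omega> in M. \<bar>- X t \<omega>\<bar> \<noteq> \<infinity>" using Xt(2) by simp
  show "integrable M (\<lambda>\<omega>. real_of_ereal (- X t \<omega>))" using Xt(3) by simp
next
  interpret M: prob_space M by fact
  fix u t :: real assume ut: "0 \<le> u" "u \<le> t"
  interpret finite_measure_subalgebra M "filt u"
    by unfold_locales (rule subalgebra_path_filt[OF M(2)])
  have i: "integrable M (\<lambda>\<omega>. real_of_ereal (X t \<omega>))" and e: "AE \<omega> in M. real_cond_exp M (filt u) (\<lambda>\<omega>. real_of_ereal (X t \<omega>)) \<omega> = real_of_ereal (X u \<omega>)"
    using X ut unfolding martingale_def by auto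
  from real_cond_exp_cmult[OF i, of "-1"] e
  show "AE \<omega> in M. real_cond_exp M (filt u) (\<lambda>\<omega>. real_of_ereal (- X t \<omega>)) \<omega> = real_of_ereal (- X u \<omega>)"
    by eventually_elim simp
qed

lemma local_martingale_uminus:
  assumes M: "prob_space M" "sets M = sets path_alg" and X: "local_martingale M X"
  shows "local_martingale M (\<lambda>t \<omega>. - X t \<omega>)"
  using X martingale_uminus[OF M] unfolding local_martingale_def stopped_uminus by blast

lemma uminus_Icc: "- x \<in> {l..r} \<longleftrightarrow> x \<in> {- r..- l}" for x l r :: ereal
  by (metis atLeastAtMost_iff ereal_minus_le_minus ereal_uminus_uminus)

lemma uminus_Ioo: "- x \<in> {l<..<r} \<longleftrightarrow> x \<in> {- r<..<- l}" for x l r :: ereal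
  by (auto simp: ereal_uminus_less_reorder ereal_less_uminus_reorder)

text \<open>Reflection exchanges the two endpoints. It is used twice: to carry over to \<open>r\<close> the analysis of paths
  near \<open>l\<close>, and to reduce the normalization \<open>s(r) = 0\<close> to \<open>s(l) = 0\<close>.\<close>

lemma (in regular_laws) reflected_regular:
  "regular_diffusion (- r) (- l) (\<lambda>t \<omega>. - Y t \<omega>) (\<lambda>x. P (- x))"
  unfolding regular_diffusion_def
proof (intro conjI ballI)
  show "diffusion (- r) (- l) (\<lambda>t \<omega>. - Y t \<omega>) (\<lambda>x. P (- x))"
    unfolding diffusion_def
  proof (intro conjI ballI allI impI)
    show "- r < - l" using lr by simp
    show "(\<lambda>\<omega>. - Y t \<omega>) \<in> borel_measurable (filt t)" if "0 \<le> t" for t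
      using meas[OF that] by measurable
    show "- Y t \<omega> \<in> {- r..- l}" if "\<omega> \<in> C_abs" "0 \<le> t" for t \<omega>
      using range[OF that] by simp
    show "continuous_on {0..} (\<lambda>t. - Y t \<omega>)" if "\<omega> \<in> C_abs" for \<omega>
      using continuous_uminus_ereal cont[OF that] by (auto intro: continuous_on_compose2[of UNIV])
    show "- Y t \<omega> = - Y u \<omega>" if "\<omega> \<in> C_abs" "0 \<le> u" "u \<le> t" "- Y u \<omega> \<in> {- r, - l}" for u t \<omega>
      using absorbed[OF that(1-3)] that(4) by auto
    show "prob_space (P (- x))" "sets (P (- x)) = sets path_alg" "AE \<omega> in P (- x). - Y 0 \<omega> = x"
      if "x \<in> {- r..- l}" for x
    proof -
      have x: "- x \<in> {l..r}" using that by (simp only: uminus_Icc)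
      show "prob_space (P (- x))" "sets (P (- x)) = sets path_alg" using prob[OF x] sets_P[OF x] .
      show "AE \<omega> in P (- x). - Y 0 \<omega> = x" using start[OF x] by eventually_elim simp
    qed
    show "(\<lambda>x. measure (P (- x)) A) \<in> borel_measurable (restrict_space borel {- r..- l})" if "A \<in> sets path_alg" for A
    proof (rule measurable_compose[OF _ kernel[OF that]])
      show "uminus \<in> measurable (restrict_space borel {- r..- l}) (restrict_space borel {l..r})"
        by (rule measurable_restrict_space2) (auto simp: space_restrict_space uminus_Icc simp del: atLeastAtMost_iff intro: measurable_restrict_space1)
    qed
    show "strong_markov (- r) (- l) (\<lambda>t \<omega>. - Y t \<omega>) (\<lambda>x. P (- x))"
      unfolding strong_markov_def
    proof (intro allI impI)
      fix \<tau> x and t :: real and B :: "ereal set"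
      assume a: "stopping_time path_filt \<tau>" "x \<in> {- r..- l}" "0 \<le> t" "B \<in> sets borel"
      have x: "- x \<in> {l..r}" using a(2) by (simp only: uminus_Icc)
      have B: "uminus -` B \<in> sets borel" using measurable_sets[OF borel_measurable_uminus_ereal[OF measurable_ident_sets[OF refl]] a(4)] by simp
      show "AE \<omega> in P (- x). \<tau> \<omega> < Time \<infinity> \<longrightarrow>
        real_cond_exp (P (- x)) (stopped_alg \<tau>) (indicator {\<omega> \<in> C_abs. \<tau> \<omega> < Time \<infinity> \<and> - Y (time_val (\<tau> \<omega>) + t) \<omega> \<in> B}) \<omega> =
        measure (P (- (- Y (time_val (\<tau> \<omega>)) \<omega>))) {\<omega>' \<in> C_abs. - Y t \<omega>' \<in> B}"
        using strong_markov[unfolded strong_markov_def, rule_format, OF a(1) x a(3) B] by simp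
    qed
  qed
next
  fix x z assume "x \<in> {- r<..<- l}" "z \<in> {- r<..<- l}"
  then have "- x \<in> {l<..<r}" "- z \<in> {l<..<r}" by (simp_all only: uminus_Ioo)
  then show "0 < measure (P (- x)) {\<omega> \<in> C_abs. hit_time (\<lambda>t \<omega>. - Y t \<omega>) z \<omega> < Time \<infinity>}"
    unfolding hit_time_uminus using regular unfolding regular_diffusion_def by blast
qed

lemma filterlim_uminus_at_right: "filterlim uminus (at_left (r::ereal)) (at_right (- r))"
  unfolding filterlim_at
proof (intro conjI)
  show "\<forall>\<^sub>F x in at_right (- r). - x \<in> {..<r} \<and> - x \<noteq> r"
    unfolding eventually_at_filter by (rule always_eventually) (metis ereal_uminus_less_reorder ereal_uminus_uminus greaterThan_iff lessThan_iff)
  have "((\<lambda>x. - x) \<longlongrightarrow> - (- r)) (at_right (- r))" by (rule tendsto_uminus_ereal) (rule tendsto_ident_at)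
  then show "(uminus \<longlongrightarrow> r) (at_right (- r))" by simp
qed

lemma filterlim_uminus_at_left: "filterlim uminus (at_right (l::ereal)) (at_left (- l))"
  unfolding filterlim_at
proof (intro conjI)
  show "\<forall>\<^sub>F x in at_left (- l). - x \<in> {l<..} \<and> - x \<noteq> l"
    unfolding eventually_at_filter by (rule always_eventually) (metis ereal_less_uminus_reorder ereal_uminus_uminus greaterThan_iff lessThan_iff)
  have "((\<lambda>x. - x) \<longlongrightarrow> - (- l)) (at_left (- l))" by (rule tendsto_uminus_ereal) (rule tendsto_ident_at)
  then show "(uminus \<longlongrightarrow> l) (at_left (- l))" by simp
qed

lemma (in scaled_laws) reflected_scale:
  "scale_function (- r) (- l) (\<lambda>t \<omega>. - Y t \<omega>) (\<lambda>x. P (- x)) (\<lambda>x. - s (- x))"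
  unfolding scale_function_def
proof (intro conjI ballI)
  fix x assume "x \<in> {- r<..<- l}"
  then have x: "- x \<in> {l<..<r}" by (simp only: uminus_Ioo)
  show "\<bar>- s (- x)\<bar> \<noteq> \<infinity>" using s_finite[OF x] by simp
  have "local_martingale (P (- x)) (\<lambda>t \<omega>. - s (Y t \<omega>))"
    by (rule local_martingale_uminus[OF prob[OF interior_closed[OF x]] sets_P[OF interior_closed[OF x]] s_local_martingale[OF x]])
  then show "local_martingale (P (- x)) (\<lambda>t \<omega>. - s (- (- Y t \<omega>)))" by simp
next
  have "continuous_on {- r<..<- l} (\<lambda>x. s (- x))"
    by (rule continuous_on_compose2[OF s_cont_interior])
      (auto intro: continuous_uminus_ereal simp: ereal_uminus_less_reorder ereal_less_uminus_reorder continuous_on_subset[OF continuous_uminus_ereal])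
  then show "continuous_on {- r<..<- l} (\<lambda>x. - s (- x))"
    by (rule continuous_on_compose2[OF continuous_uminus_ereal[of UNIV]]) auto
  show "strict_mono_on {- r<..<- l} (\<lambda>x. - s (- x))"
  proof (rule strict_mono_onI)
    fix x x' assume x: "x \<in> {- r<..<- l}" "x' \<in> {- r<..<- l}" "x < x'"
    then have "- x \<in> {l<..<r}" "- x' \<in> {l<..<r}" "- x' < - x" by (simp_all only: uminus_Ioo ereal_minus_less_minus)
    then have "s (- x') < s (- x)" using strict_mono_onD[OF s_mono_interior] by blast
    then show "- s (- x) < - s (- x')" by simp
  qed
  have "((\<lambda>x. s (- x)) \<longlongrightarrow> s r) (at_right (- r))" by (rule filterlim_compose[OF s_at_r filterlim_uminus_at_right])
  from tendsto_uminus_ereal[OF this] show "((\<lambda>x. - s (- x)) \<longlongrightarrow> - s (- (- r))) (at_right (- r))" by simp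
  have "((\<lambda>x. s (- x)) \<longlongrightarrow> s l) (at_left (- l))" by (rule filterlim_compose[OF s_at_l filterlim_uminus_at_left])
  from tendsto_uminus_ereal[OF this] show "((\<lambda>x. - s (- x)) \<longlongrightarrow> - s (- (- l))) (at_left (- l))" by simp
qed

context scaled_laws
begin

lemma reflected_laws: "scaled_laws (- r) (- l) (\<lambda>t \<omega>. - Y t \<omega>) (\<lambda>x. P (- x)) (\<lambda>x. - s (- x))"
  by (intro scaled_laws.intro regular_laws.intro scaled_laws_axioms.intro reflected_regular reflected_scale)

lemma sr_tendsto_l:
  assumes l_fin: "\<bar>s l\<bar> \<noteq> \<infinity>" and a: "a \<longlonglongrightarrow> l" "\<And>n. a n \<in> {l..r}"
  shows "(\<lambda>n. sr (a n)) \<longlonglongrightarrow> sr l"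
proof -
  have "(\<lambda>n. s (a n)) \<longlonglongrightarrow> s l" by (rule s_tendsto[OF a(1)]) (use a lr in auto)
  also have "s l = ereal (sr l)" using l_fin by (simp add: ereal_real)
  finally show ?thesis by (rule lim_real_of_ereal)
qed

text \<open>The probability of returning to \<open>c\<close> from \<open>a\<close> is at most proportional to \<open>s(a) - s(l)\<close>, which tends to
  \<open>0\<close> as \<open>a\<close> tends to \<open>l\<close>.\<close>

lemma eventually_no_return:
  assumes l_fin: "\<bar>s l\<bar> \<noteq> \<infinity>" and y: "y \<in> {l<..<r}" and c: "c \<in> {l<..<r}"
  shows "AE \<omega> in P y. \<exists>a. l < a \<and> a < c \<and> a < y \<and> \<not> return_time Y a c \<omega> < Time \<infinity>"
proof -
  note y' = interior_closed[OF y]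
  interpret Py: prob_space "P y" by (rule prob[OF y'])
  have m: "l < min c y" using c y by auto
  obtain a where a: "\<And>n. l < a n" "\<And>n. a n < min c y" "a \<longlonglongrightarrow> l" using approaching_from_above[OF m] by blast
  have aI: "a n \<in> {l..r}" for n using less_trans[OF a(2)[of n], of r] a(1)[of n] y by (auto simp: min_less_iff_disj)
  let ?R = "\<lambda>n. {\<omega>\<in>C_abs. return_time Y (a n) c \<omega> < Time \<infinity>}"
  have R: "?R n \<in> sets (P y)" for n
    using finite_sets_P[OF stopping_time_return_time, of "a n" c] a(2)[of n] sets_P[OF y'] by auto
  let ?B = "\<Inter>n. ?R n"
  have B: "?B \<in> sets (P y)" using R by auto
  have le: "(sr c - sr l) * measure (P y) ?B \<le> sr (a n) - sr l" for n
  proof -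
    have "(sr c - sr l) * measure (P y) ?B \<le> (sr c - sr l) * measure (P y) (?R n)"
    proof (rule mult_left_mono)
      show "measure (P y) ?B \<le> measure (P y) (?R n)" by (rule Py.finite_measure_mono[OF _ R]) auto
      show "0 \<le> sr c - sr l" using sr_ge_l[OF l_fin s_finite[OF c] interior_closed[OF c], of c] c by auto
    qed
    also have "\<dots> \<le> sr (a n) - sr l"
      by (rule return_above_prob[OF l_fin y]) (use a(1,2)[of n] c in auto)
    finally show ?thesis .
  qed
  have "(\<lambda>n. sr (a n) - sr l) \<longlonglongrightarrow> sr l - sr l" by (intro tendsto_intros sr_tendsto_l[OF l_fin a(3) aI])
  then have "(sr c - sr l) * measure (P y) ?B \<le> sr l - sr l" by (rule LIMSEQ_le_const) (use le in blast)
  moreover have "sr l < sr c" by (rule sr_strict_mono[OF l_fin s_finite[OF c]]) (use c lr in auto)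
  ultimately have "measure (P y) ?B \<le> 0" by (simp add: mult_le_0_iff)
  then have "measure (P y) ?B = 0" using measure_nonneg[of "P y" ?B] by linarith
  then have "emeasure (P y) ?B = 0" by (simp add: Py.emeasure_eq_measure)
  then have "AE \<omega> in P y. \<omega> \<notin> ?B" by (intro AE_not_in) (use B in \<open>auto simp: null_sets_def\<close>)
  then show ?thesis using AE_space
  proof eventually_elim
    case (elim \<omega>)
    then have "\<omega> \<in> C_abs" using space_P[OF y'] by simp
    then obtain n where "\<not> return_time Y (a n) c \<omega> < Time \<infinity>" using elim(1) by blast
    then show ?case using a(1,2)[of n] by (intro exI[of _ "a n"]) auto
  qed
qed

text \<open>After visiting a level from which it never returns to \<open>c\<close>, a path stays below \<open>c\<close>; apply this to a
  sequence of levels \<open>c\<close> tending to \<open>l\<close>.\<close>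

lemma limit_at_l:
  assumes l_fin: "\<bar>s l\<bar> \<noteq> \<infinity>" and y: "y \<in> {l<..<r}"
  shows "AE \<omega> in P y. (\<forall>a>l. \<exists>t\<ge>0. Y t \<omega> < a) \<longrightarrow> ((\<lambda>t. Y t \<omega>) \<longlongrightarrow> l) at_top"
proof -
  note y' = interior_closed[OF y]
  obtain c where c: "\<And>n. l < c n" "\<And>n. c n < r" "c \<longlonglongrightarrow> l" using approaching_from_above[OF lr] by blast
  have "AE \<omega> in P y. \<forall>k. \<exists>a. l < a \<and> a < c k \<and> a < y \<and> \<not> return_time Y a (c k) \<omega> < Time \<infinity>"
    unfolding AE_all_countable using eventually_no_return[OF l_fin y] c by auto
  then show ?thesis using AE_space start[OF y']
  proof eventually_elim
    case (elim \<omega>)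
    then have w: "\<omega> \<in> C_abs" using space_P[OF y'] by simp
    show ?case
    proof (intro impI order_tendstoI)
      fix c' assume "c' < l"
      then have "\<forall>t\<ge>0. c' < Y t \<omega>" using range[OF w] by (auto intro: less_le_trans)
      then show "\<forall>\<^sub>F t in at_top. c' < Y t \<omega>" by (auto simp: eventually_at_top_linorder)
    next
      fix c' assume inf: "\<forall>a>l. \<exists>t\<ge>0. Y t \<omega> < a" and c': "l < c'"
      have "\<forall>\<^sub>F k in sequentially. c k < c'" using c(3) c' by (rule order_tendstoD(2))
      then obtain k where k: "c k < c'" by (auto simp: eventually_sequentially)
      obtain a where a: "l < a" "a < c k" "a < y" "\<not> return_time Y a (c k) \<omega> < Time \<infinity>" using elim(1) by blast
      obtain t where t: "0 \<le> t" "Y t \<omega> < a" using inf a(1) by blast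
      have "Y t \<omega> \<le> a \<and> a \<le> Y 0 \<omega>" using t a(3) elim(3) by auto
      then obtain u where u: "0 \<le> u" "Y u \<omega> = a" using crossing[OF w order_refl t(1)] by blast
      have "\<forall>t\<ge>u. Y t \<omega> < c'" using no_return(1)[OF w u a(4) _ a(2)] k by (auto intro: less_trans)
      then show "\<forall>\<^sub>F t in at_top. Y t \<omega> < c'" by (auto simp: eventually_at_top_linorder)
    qed
  qed
qed

lemma limit_at_r:
  assumes r_fin: "\<bar>s r\<bar> \<noteq> \<infinity>" and y: "y \<in> {l<..<r}"
  shows "AE \<omega> in P y. (\<forall>b<r. \<exists>t\<ge>0. b < Y t \<omega>) \<longrightarrow> ((\<lambda>t. Y t \<omega>) \<longlongrightarrow> r) at_top"
proof -
  interpret R: scaled_laws "- r" "- l" "\<lambda>t \<omega>. - Y t \<omega>" "\<lambda>x. P (- x)" "\<lambda>x. - s (- x)"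
    by (rule reflected_laws)
  have "\<bar>- s (- (- r))\<bar> \<noteq> \<infinity>" "- y \<in> {- r<..<- l}" using r_fin y by auto
  from R.limit_at_l[OF this, unfolded ereal_uminus_uminus] show ?thesis
  proof eventually_elim
    case (elim \<omega>)
    show ?case
    proof
      assume b: "\<forall>b<r. \<exists>t\<ge>0. b < Y t \<omega>"
      have "\<exists>t\<ge>0. - Y t \<omega> < a" if "- r < a" for a
      proof -
        have "- a < r" using that by (simp add: ereal_uminus_less_reorder)
        then obtain t where "t \<ge> 0" "- a < Y t \<omega>" using b by blast
        then show ?thesis by (auto simp: ereal_uminus_less_reorder)
      qed
      then have "((\<lambda>t. - Y t \<omega>) \<longlongrightarrow> - r) at_top" using elim by blast
      from tendsto_uminus_ereal[OF this] show "((\<lambda>t. Y t \<omega>) \<longlongrightarrow> r) at_top" by simp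
    qed
  qed
qed

text \<open>By the maximal inequality, level \<open>b\<close> is reached with probability of order \<open>1 / s(b)\<close>.\<close>

lemma bounded_below_r:
  assumes l_fin: "\<bar>s l\<bar> \<noteq> \<infinity>" and r_inf: "s r = \<infinity>" and y: "y \<in> {l<..<r}"
  shows "AE \<omega> in P y. \<exists>b<r. \<forall>t\<ge>0. Y t \<omega> \<le> b"
proof -
  note y' = interior_closed[OF y]
  interpret Py: prob_space "P y" by (rule prob[OF y'])
  have yr: "y < r" using y by simp
  obtain b where b: "\<And>n. b n < r" "\<And>n. y < b n" "b \<longlonglongrightarrow> r" using approaching_from_below[OF yr] by blast
  have bI: "b n \<in> {l<..<r}" for n using less_trans[OF _ b(2)[of n], of l] b(1)[of n] y by simp
  let ?H = "\<lambda>n. {\<omega>\<in>C_abs. hit_time Y (b n) \<omega> < Time \<infinity>}"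
  have H: "?H n \<in> sets (P y)" for n
    using finite_sets_P[OF stopping_time_hit_time] sets_P[OF y'] by auto
  let ?B = "\<Inter>n. ?H n"
  have B: "?B \<in> sets (P y)" using H by auto
  have le: "(sr (b n) - sr l) * measure (P y) ?B \<le> sr y - sr l" for n
  proof -
    have "(sr (b n) - sr l) * measure (P y) ?B \<le> (sr (b n) - sr l) * measure (P y) (?H n)"
    proof (rule mult_left_mono)
      show "measure (P y) ?B \<le> measure (P y) (?H n)" by (rule Py.finite_measure_mono[OF _ H]) auto
      show "0 \<le> sr (b n) - sr l" using sr_ge_l[OF l_fin s_finite[OF bI] interior_closed[OF bI], of "b n" n] bI[of n] by auto
    qed
    also have "\<dots> \<le> sr y - sr l"
      by (rule hit_above_prob[OF l_fin y bI]) (use b(2)[of n] in auto)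
    finally show ?thesis .
  qed
  have "(\<lambda>n. s (b n)) \<longlonglongrightarrow> s r" by (rule s_tendsto[OF b(3)]) (use interior_closed[OF bI] lr in auto)
  then have "(\<lambda>n. ereal (sr (b n))) \<longlonglongrightarrow> \<infinity>" using s_sr[OF bI] r_inf by simp
  then have top: "filterlim (\<lambda>n. sr (b n)) at_top sequentially" by (simp add: tendsto_PInfty_eq_at_top)
  have "measure (P y) ?B = 0"
  proof (rule ccontr)
    assume "measure (P y) ?B \<noteq> 0"
    then have pos: "0 < measure (P y) ?B" using measure_nonneg[of "P y" ?B] by linarith
    let ?C = "(sr y - sr l) / measure (P y) ?B + sr l"
    have "\<forall>\<^sub>F n in sequentially. ?C < sr (b n)" using top by (simp add: filterlim_at_top_dense)
    then obtain n where "?C < sr (b n)" by (auto simp: eventually_sequentially)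
    then have "(sr y - sr l) / measure (P y) ?B < sr (b n) - sr l" by simp
    then have "sr y - sr l < (sr (b n) - sr l) * measure (P y) ?B" using pos by (simp add: pos_divide_less_eq)
    then show False using le[of n] by simp
  qed
  then have "emeasure (P y) ?B = 0" by (simp add: Py.emeasure_eq_measure)
  then have "AE \<omega> in P y. \<omega> \<notin> ?B" by (intro AE_not_in) (use B in \<open>auto simp: null_sets_def\<close>)
  then show ?thesis using AE_space start[OF y']
  proof eventually_elim
    case (elim \<omega>)
    then have w: "\<omega> \<in> C_abs" using space_P[OF y'] by simp
    then obtain n where n: "\<not> hit_time Y (b n) \<omega> < Time \<infinity>" using elim(1) by blast
    have "Y t \<omega> \<le> b n" if t: "0 \<le> t" for t
    proof (rule ccontr)
      assume "\<not> Y t \<omega> \<le> b n"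
      then have "Y 0 \<omega> \<le> b n \<and> b n \<le> Y t \<omega>" using elim(3) b(2)[of n] by auto
      then obtain u where "0 \<le> u" "Y u \<omega> = b n" using crossing[OF w order_refl t] by blast
      then show False using n hit_time_less_infinity_iff[OF w] by blast
    qed
    then show ?case using b(1) by blast
  qed
qed

text \<open>Since every compact interval is left, the infimum of a path is \<open>l\<close> or its supremum is \<open>r\<close>, and in
  both cases the path converges to that endpoint. The supremum is \<open>r\<close> with probability \<open>0\<close> if
  \<open>s(r) = \<infinity>\<close>.\<close>

lemma limit_exists:
  assumes l_fin: "\<bar>s l\<bar> \<noteq> \<infinity>" and r_val: "s r \<noteq> \<infinity> \<longrightarrow> \<bar>s r\<bar> \<noteq> \<infinity>" and y: "y \<in> {l<..<r}"
  shows "AE \<omega> in P y. ((\<lambda>t. Y t \<omega>) \<longlongrightarrow> l) at_top \<or> s r \<noteq> \<infinity> \<and> ((\<lambda>t. Y t \<omega>) \<longlongrightarrow> r) at_top"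
proof -
  note y' = interior_closed[OF y]
  obtain a where a: "\<And>n. l < a n" "\<And>n. a n < r" "a \<longlonglongrightarrow> l" using approaching_from_above[OF lr] by blast
  obtain b where b: "\<And>n. b n < r" "\<And>n. l < b n" "b \<longlonglongrightarrow> r" using approaching_from_below[OF lr] by blast
  have ex: "AE \<omega> in P y. \<forall>n m. \<exists>t\<ge>0. Y t \<omega> \<notin> {a n..b m}"
    unfolding AE_all_countable using exit_compact[OF a(1) b(1) y'] by blast
  have up: "AE \<omega> in P y. (\<forall>b<r. \<exists>t\<ge>0. b < Y t \<omega>) \<longrightarrow> s r \<noteq> \<infinity> \<and> ((\<lambda>t. Y t \<omega>) \<longlongrightarrow> r) at_top"
  proof (cases "s r = \<infinity>")
    case True
    from bounded_below_r[OF l_fin True y] show ?thesis by eventually_elim (auto simp: not_less[symmetric])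
  next
    case False
    with limit_at_r[OF _ y] r_val show ?thesis by simp
  qed
  from ex up limit_at_l[OF l_fin y] show ?thesis
  proof eventually_elim
    case (elim \<omega>)
    show ?case
    proof (cases "\<forall>a>l. \<exists>t\<ge>0. Y t \<omega> < a")
      case True
      then show ?thesis using elim(3) by blast
    next
      case False
      then obtain a0 where a0: "l < a0" "\<And>t. 0 \<le> t \<Longrightarrow> a0 \<le> Y t \<omega>" by (auto simp: not_less)
      have "\<exists>t\<ge>0. b' < Y t \<omega>" if b': "b' < r" for b'
      proof -
        have "\<forall>\<^sub>F n in sequentially. a n < a0" using a(3) a0(1) by (rule order_tendstoD(2))
        then obtain n where n: "a n < a0" by (auto simp: eventually_sequentially)
        have "\<forall>\<^sub>F m in sequentially. b' < b m" using b(3) b' by (rule order_tendstoD(1))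
        then obtain m where m: "b' < b m" by (auto simp: eventually_sequentially)
        obtain t where t: "0 \<le> t" "Y t \<omega> \<notin> {a n..b m}" using elim(1) by blast
        have "a n \<le> Y t \<omega>" using n a0(2)[OF t(1)] by (auto intro: order_trans less_imp_le)
        then have "b m < Y t \<omega>" using t by auto
        then show ?thesis using t(1) m by (auto intro: less_trans)
      qed
      then show ?thesis using elim(2) by blast
    qed
  qed
qed

end

section \<open>Uniqueness of extensions\<close>

lemma finite_horizon_stopped_alg:
  assumes st: "stopping_time path_filt \<tau>" and A: "A \<in> sets (filt 0)"
  shows "A \<in> sets (stopped_alg \<tau>)"
proof (rule stopped_algI[OF st])
  show "A \<in> sets path_alg" using A filt_path_alg by blast
  fix t :: real assume t: "0 \<le> t"
  have "A \<in> sets (filt t)" using A filt_mono[OF t] by blast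
  moreover have "A \<inter> {\<omega>. \<tau> \<omega> \<le> Time (ennreal t)} = A \<inter> {\<omega>\<in>C_abs. \<tau> \<omega> \<le> Time (ennreal t)}"
    using sets.sets_into_space[OF A] by auto
  ultimately show "A \<inter> {\<omega>. \<tau> \<omega> \<le> Time (ennreal t)} \<in> sets (filt t)"
    using stopping_time_le_sets[OF st, of "Time (ennreal t)"] by auto
qed

lemma stopped_coordinate_sets:
  assumes st: "stopping_time path_filt \<tau>" and u: "0 \<le> u" and B: "B \<in> sets borel"
  shows "{\<omega>\<in>C_abs. \<omega> (trunc \<tau> u \<omega>) \<in> B} \<in> sets (stopped_alg \<tau>)"
proof (rule stopped_algI[OF st])
  have m: "{\<omega>\<in>C_abs. \<omega> (trunc \<tau> v \<omega>) \<in> B} \<in> sets (filt v)" if "0 \<le> v" for v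
    using measurable_sets[OF measurable_trunc[OF cont_adapted_coordinate st that] B]
    by (simp add: vimage_def Int_def conj_commute)
  show "{\<omega>\<in>C_abs. \<omega> (trunc \<tau> u \<omega>) \<in> B} \<in> sets path_alg" using m[OF u] filt_path_alg by blast
  fix t :: real assume t: "0 \<le> t"
  let ?v = "min u t"
  have v: "0 \<le> ?v" using u t by simp
  have "trunc \<tau> u \<omega> = trunc \<tau> ?v \<omega>" if "\<tau> \<omega> \<le> Time (ennreal t)" for \<omega>
    unfolding trunc_eq_min[OF u] trunc_eq_min[OF v] using iffD1[OF le_Time_iff[OF t] that] by auto
  then have "{\<omega>\<in>C_abs. \<omega> (trunc \<tau> u \<omega>) \<in> B} \<inter> {\<omega>. \<tau> \<omega> \<le> Time (ennreal t)} =
    {\<omega>\<in>C_abs. \<omega> (trunc \<tau> ?v \<omega>) \<in> B} \<inter> {\<omega>\<in>C_abs. \<tau> \<omega> \<le> Time (ennreal t)}" by auto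
  moreover have "{\<omega>\<in>C_abs. \<omega> (trunc \<tau> ?v \<omega>) \<in> B} \<in> sets (filt t)" using m[OF v] filt_mono[of ?v t] by auto
  ultimately show "{\<omega>\<in>C_abs. \<omega> (trunc \<tau> u \<omega>) \<in> B} \<inter> {\<omega>. \<tau> \<omega> \<le> Time (ennreal t)} \<in> sets (filt t)"
    using stopping_time_le_sets[OF st, of "Time (ennreal t)"] by auto
qed

locale absorbed_information = absorbed_paths +
  assumes alg: "sets path_alg = sets (stopped_alg (\<lambda>\<omega>. min (hit_time Y l \<omega>) (hit_time Y r \<omega>)))"
begin

text \<open>The path is followed up to \<open>t\<close> and then continued with slope \<open>d\<close>. Two different slopes give two
  paths that agree up to \<open>t\<close> and differ afterwards.\<close>

definition continuation :: "path \<Rightarrow> real \<Rightarrow> real \<Rightarrow> path" where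
  "continuation \<omega> t d = restrict (\<lambda>u. \<omega> (min u t) + ennreal (d * max 0 (u - t))) {0..}"

lemma continuation_C_abs:
  assumes w: "\<omega> \<in> C_abs" and t: "0 \<le> t" and x: "\<omega> t \<notin> {0, \<infinity>}" and d: "0 \<le> d"
  shows "continuation \<omega> t d \<in> C_abs"
proof -
  have cont: "continuous_on {0..} \<omega>" and abs: "\<And>u v. 0 \<le> u \<Longrightarrow> u \<le> v \<Longrightarrow> \<omega> u \<in> {0, \<infinity>} \<Longrightarrow> \<omega> v = \<omega> u"
    using w unfolding C_abs_def by blast+
  have "continuous_on {0..} (\<lambda>u. \<omega> (min u t))"
    by (rule continuous_on_compose2[OF cont]) (use t in \<open>auto intro!: continuous_intros\<close>)
  then have "continuous_on {0..} (\<lambda>u. \<omega> (min u t) + ennreal (d * max 0 (u - t)))"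
    by (intro continuous_on_add_ennreal continuous_on_ennreal continuous_intros)
  then have "continuous_on {0..} (continuation \<omega> t d)"
    by (rule continuous_on_eq) (simp add: continuation_def)
  moreover have "continuation \<omega> t d u \<notin> {0, \<infinity>}" if u: "0 \<le> u" for u
  proof -
    have "\<omega> (min u t) \<notin> {0, \<infinity>}" using abs[of "min u t" t] x u t by auto
    then show ?thesis using u by (auto simp: continuation_def)
  qed
  ultimately show ?thesis unfolding C_abs_def by (auto simp: continuation_def)
qed

text \<open>If \<open>\<omega>\<close> were not absorbed at \<open>t\<close>, it could be continued both constantly and with slope \<open>1\<close>. The event
  that the coordinate at time \<open>t + 1\<close> has the value of the constant continuation would belong to the
  \<open>\<sigma>\<close>-algebra of \<open>\<tau>\<^sub>l \<and> \<tau>\<^sub>r\<close>, and on \<open>{\<tau>\<^sub>l \<and> \<tau>\<^sub>r \<le> t}\<close> it would be known at time \<open>t\<close>. But the two continuations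
  agree up to \<open>t\<close>.\<close>

lemma absorbed_at_endpoint:
  assumes w: "\<omega> \<in> C_abs" and t: "0 \<le> t" and Y: "Y t \<omega> \<in> {l, r}"
  shows "\<omega> t \<in> {0, \<infinity>}"
proof (rule ccontr)
  assume x: "\<omega> t \<notin> {0, \<infinity>}"
  let ?\<tau> = "\<lambda>\<omega>. min (hit_time Y l \<omega>) (hit_time Y r \<omega>)"
  have st: "stopping_time path_filt ?\<tau>" by (rule stopping_time_min[OF stopping_time_hit_time stopping_time_hit_time])
  let ?f = "continuation \<omega> t"
  have f: "?f 0 \<in> C_abs" "?f 1 \<in> C_abs" using continuation_C_abs[OF w t x] by auto
  have agree: "?f d u = \<omega> u" if "0 \<le> u" "Time (ennreal u) \<le> Time (ennreal t)" for d u
    using that t by (simp add: continuation_def ennreal_le_iff min_absorb1)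
  let ?A = "{\<omega>'\<in>C_abs. \<omega>' (t + 1) \<in> {?f 0 (t + 1)}}"
  have "?A \<in> sets (filt (t + 1))"
    using measurable_sets[OF measurable_coordinate[of "t + 1"], of "{?f 0 (t + 1)}"] t
    by (simp add: vimage_def Int_def conj_commute)
  then have "?A \<in> sets path_alg" using filt_path_alg by blast
  then have AD: "?A \<inter> {\<omega>. ?\<tau> \<omega> \<le> Time (ennreal t)} \<in> sets (filt t)"
    using stopped_algD[OF st _ t] unfolding alg by blast
  have D: "{\<omega>\<in>C_abs. ?\<tau> \<omega> \<le> Time (ennreal t)} \<in> sets (filt t)" by (rule stopping_time_le_sets[OF st])
  have "hit_time Y (Y t \<omega>) \<omega> \<le> Time (ennreal t)" using hit_time_le_iff[OF w t] t by blast
  then have "?\<tau> \<omega> \<le> Time (ennreal t)" using Y by (auto simp: min_le_iff_disj)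
  then have "?f 0 \<in> {\<omega>\<in>C_abs. ?\<tau> \<omega> \<le> Time (ennreal t)}"
    using path_filt_determined[OF D f(1) w agree] w by blast
  then have "?f 0 \<in> ?A \<inter> {\<omega>. ?\<tau> \<omega> \<le> Time (ennreal t)}" by simp
  then have "?f 1 \<in> ?A \<inter> {\<omega>. ?\<tau> \<omega> \<le> Time (ennreal t)}"
    using path_filt_determined[OF AD f(1) f(2)] agree by simp
  then have "?f 1 (t + 1) = ?f 0 (t + 1)" by simp
  then have "\<omega> t + 1 = \<omega> t" using t by (simp add: continuation_def)
  then show False using x by (cases "\<omega> t") (auto simp flip: ennreal_1 ennreal_plus)
qed

text \<open>If \<open>e\<close> is not reached by time \<open>u\<close>, the levels \<open>a n\<close> are eventually reached only after \<open>u\<close>. Otherwise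
  their hitting times tend to the hitting time of \<open>e\<close>, and from that time on the path is constant.\<close>

lemma coordinate_tendsto:
  assumes w: "\<omega> \<in> C_abs" and e: "e \<in> {l, r}" and a: "a \<longlonglongrightarrow> e"
    and between: "\<And>n. Y 0 \<omega> < a n \<and> a n < e \<or> e < a n \<and> a n < Y 0 \<omega>"
    and hit: "\<And>n. hit_time Y (a n) \<omega> < Time \<infinity>" and u: "0 \<le> u"
  shows "(\<lambda>n. \<omega> (trunc (hit_time Y (a n)) u \<omega>)) \<longlonglongrightarrow> \<omega> u"
proof -
  define T where "T n = time_val (hit_time Y (a n) \<omega>)" for n
  have late: "\<forall>\<^sub>F n in sequentially. v < T n" if ne: "\<And>q. 0 \<le> q \<Longrightarrow> q \<le> v \<Longrightarrow> Y q \<omega> \<noteq> e" and v: "0 \<le> v" for v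
  proof -
    from eventually_not_attained[OF w a, of v] ne
    have "\<forall>\<^sub>F n in sequentially. \<forall>q. 0 \<le> q \<longrightarrow> q \<le> v \<longrightarrow> Y q \<omega> \<noteq> a n" by blast
    then show ?thesis
  proof eventually_elim
    case (elim n)
    then have "\<not> hit_time Y (a n) \<omega> \<le> Time (ennreal v)" using hit_time_le_iff[OF w v] by blast
    then show ?case using hit[of n] le_Time_iff[OF v] by (auto simp: T_def)
  qed
  qed
  have trunc: "trunc (hit_time Y (a n)) u \<omega> = min (T n) u" for n
    using hit[of n] by (simp add: trunc_eq_min[OF u] T_def)
  show ?thesis
  proof (cases "\<exists>v\<ge>0. v \<le> u \<and> Y v \<omega> = e")
    case False
    then have "\<forall>\<^sub>F n in sequentially. u < T n" by (intro late u) auto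
    then have "\<forall>\<^sub>F n in sequentially. \<omega> (trunc (hit_time Y (a n)) u \<omega>) = \<omega> u"
      by eventually_elim (simp add: trunc)
    then show ?thesis by (rule tendsto_eventually)
  next
    case True
    then obtain v where v: "0 \<le> v" "v \<le> u" "Y v \<omega> = e" by blast
    have he: "hit_time Y e \<omega> < Time \<infinity>" using hit_time_less_infinity_iff[OF w] v by blast
    define v0 where "v0 = time_val (hit_time Y e \<omega>)"
    have v0: "0 \<le> v0" "Y v0 \<omega> = e" "\<And>q. 0 \<le> q \<Longrightarrow> Y q \<omega> = e \<Longrightarrow> v0 \<le> q"
      unfolding v0_def using at_hit_time[OF w he] by auto
    have Tv: "T n \<le> v0" for n
    proof -
      obtain q where "0 \<le> q" "q \<le> v0" "Y q \<omega> = a n"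
        using crossing[OF w order_refl v0(1), of "a n"] between[of n] v0(2) by (auto intro: less_imp_le)
      then show ?thesis using at_hit_time(2)[OF w hit, of q n] by (simp add: T_def)
    qed
    have "T \<longlonglongrightarrow> v0"
    proof (rule order_tendstoI)
      fix q assume q: "q < v0"
      show "\<forall>\<^sub>F n in sequentially. q < T n"
      proof (cases "0 \<le> q")
        case True
        then show ?thesis using q v0(3) by (intro late) force+
      next
        case False
        then have "q < T n" for n using time_val_nonneg[of "hit_time Y (a n) \<omega>"] unfolding T_def by linarith
        then show ?thesis by simp
      qed
    next
      fix q assume "v0 < q"
      then have "T n < q" for n using Tv[of n] by linarith
      then show "\<forall>\<^sub>F n in sequentially. T n < q" by simp
    qed
    moreover have wc: "continuous_on {0..} \<omega>" using w by (simp add: C_abs_def)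
    ultimately have lim: "(\<lambda>n. \<omega> (T n)) \<longlonglongrightarrow> \<omega> v0"
      using continuous_on_tendsto_compose[OF wc, of T v0] v0(1) by (auto simp: T_def)
    have v0u: "v0 \<le> u" using v0(3)[OF v(1,3)] v(2) by simp
    have "\<omega> v0 \<in> {0, \<infinity>}" by (rule absorbed_at_endpoint[OF w v0(1)]) (use v0(2) e in simp)
    then have "\<omega> u = \<omega> v0" using w v0(1) v0u unfolding C_abs_def by blast
    moreover have "trunc (hit_time Y (a n)) u \<omega> = T n" for n using trunc Tv[of n] v0u by simp
    ultimately show ?thesis using lim by simp
  qed
qed

lemma hit_time_order:
  assumes w: "\<omega> \<in> C_abs" and t: "0 \<le> t" and b: "Y 0 \<omega> \<le> a \<and> a \<le> a' \<or> a' \<le> a \<and> a \<le> Y 0 \<omega>"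
    and h: "hit_time Y a' \<omega> \<le> Time (ennreal t)"
  shows "hit_time Y a \<omega> \<le> Time (ennreal t)"
proof -
  obtain u where u: "0 \<le> u" "u \<le> t" "Y u \<omega> = a'" using h hit_time_le_iff[OF w t] by blast
  then obtain q where "0 \<le> q" "q \<le> u" "Y q \<omega> = a" using crossing[OF w order_refl u(1), of a] b by auto
  then show ?thesis using hit_time_le_iff[OF w t] u by force
qed

text \<open>On the event \<open>S\<close> that \<open>Y\<close> starts at \<open>y\<close>, levels farther away from \<open>y\<close> on the side of \<open>e\<close> are hit later.
  Hence the \<open>\<sigma>\<close>-algebras of the hitting times, restricted to \<open>S\<close>, are nested in the order of the
  levels, and their union is stable under intersections; so the two measures agree on the
  \<open>\<sigma>\<close>-algebra generated by this union. On the event \<open>H\<close> of full measure on which all levels are reached,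
  every coordinate of the path is a limit of stopped coordinates, so each event coincides on \<open>H\<close> with
  an event of the generated \<open>\<sigma>\<close>-algebra.\<close>

lemma extension_unique:
  assumes e: "e \<in> {l, r}" and a: "a \<longlonglongrightarrow> e"
    and between: "\<And>n. y < a n \<and> a n < e \<or> e < a n \<and> a n < y"
    and M: "prob_space M" "sets M = sets path_alg" and N: "prob_space N" "sets N = sets path_alg"
    and agree: "\<And>n A. A \<in> sets (stopped_alg (hit_time Y (a n))) \<Longrightarrow> emeasure M A = emeasure N A"
    and start: "AE \<omega> in N. Y 0 \<omega> = y" and hit: "AE \<omega> in N. \<forall>n. hit_time Y (a n) \<omega> < Time \<infinity>"
  shows "M = N"
proof -
  interpret M: prob_space M by fact
  interpret N: prob_space N by fact
  have spM: "space M = C_abs" and spN: "space N = C_abs"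
    using sets_eq_imp_space_eq[OF M(2)] sets_eq_imp_space_eq[OF N(2)] by auto
  note st = stopping_time_hit_time
  let ?G = "\<lambda>n. stopped_alg (hit_time Y (a n))"
  define S where "S = {\<omega>\<in>C_abs. Y 0 \<omega> = y}"
  have S0: "S \<in> sets (filt 0)"
    using measurable_sets[OF meas[OF order_refl], of "{y}"] by (simp add: S_def vimage_def Int_def conj_commute)
  have S: "S \<in> sets (?G n)" for n by (rule finite_horizon_stopped_alg[OF st S0])
  define E where "E = {A. A \<subseteq> S \<and> (\<exists>n. A \<in> sets (?G n))}"
  have E_sub: "E \<subseteq> sets path_alg" using stopped_alg_subset[OF st] by (auto simp: E_def)
  have EPow: "E \<subseteq> Pow C_abs" using E_sub sets.sets_into_space[of _ path_alg] by auto
  have E_mono: "A \<in> sets (?G n)" if A: "A \<in> sets (?G m)" "A \<subseteq> S"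
    and mn: "y \<le> a m \<and> a m \<le> a n \<or> a n \<le> a m \<and> a m \<le> y" for A m n
  proof (rule stopped_algI[OF st])
    show "A \<in> sets path_alg" using A stopped_alg_subset[OF st] by blast
    fix t :: real assume t: "0 \<le> t"
    have "A \<inter> {\<omega>. hit_time Y (a n) \<omega> \<le> Time (ennreal t)} =
      (A \<inter> {\<omega>. hit_time Y (a m) \<omega> \<le> Time (ennreal t)}) \<inter> {\<omega>\<in>C_abs. hit_time Y (a n) \<omega> \<le> Time (ennreal t)}"
      using hit_time_order[OF _ t, of _ "a m" "a n"] mn A(2) by (auto simp: S_def)
    then show "A \<inter> {\<omega>. hit_time Y (a n) \<omega> \<le> Time (ennreal t)} \<in> sets (filt t)"
      using stopped_algD[OF st A(1) t] stopping_time_le_sets[OF st, of "a n" "Time (ennreal t)"] by auto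
  qed
  have Int: "Int_stable E"
  proof (rule Int_stableI)
    fix A B assume "A \<in> E" "B \<in> E"
    then obtain m n where mn: "A \<in> sets (?G m)" "A \<subseteq> S" "B \<in> sets (?G n)" "B \<subseteq> S" by (auto simp: E_def)
    have "(y \<le> a m \<and> a m \<le> a n \<or> a n \<le> a m \<and> a m \<le> y) \<or> (y \<le> a n \<and> a n \<le> a m \<or> a m \<le> a n \<and> a n \<le> y)"
      using between[of m] between[of n] by (metis less_imp_le less_trans linear not_less_iff_gr_or_eq)
    then have "A \<in> sets (?G n) \<or> B \<in> sets (?G m)" using E_mono mn by blast
    then have "A \<inter> B \<in> sets (?G n) \<or> A \<inter> B \<in> sets (?G m)" using mn by auto
    then show "A \<inter> B \<in> E" using mn by (auto simp: E_def)
  qed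
  let ?\<Sigma> = "sigma_sets C_abs E"
  have \<Sigma>_sub: "?\<Sigma> \<subseteq> sets path_alg" using sets.sigma_sets_subset[OF E_sub] by simp
  have eq\<Sigma>: "emeasure M A = emeasure N A" if "A \<in> ?\<Sigma>" for A
    using Int EPow that
  proof (induction rule: sigma_sets_induct_disjoint)
    case (basic A)
    then show ?case using agree by (auto simp: E_def)
  next
    case (compl A)
    then have "A \<in> sets M" "A \<in> sets N" using \<Sigma>_sub M N by auto
    then show ?case using compl(2) M.prob_compl[of A] N.prob_compl[of A]
      by (simp add: spM spN M.emeasure_eq_measure N.emeasure_eq_measure)
  next
    case (union A)
    then have "range A \<subseteq> sets M" "range A \<subseteq> sets N" using \<Sigma>_sub M N by auto
    then show ?case using suminf_emeasure[of A M] suminf_emeasure[of A N] union by simp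
  qed simp
  define H where "H = {\<omega>\<in>C_abs. Y 0 \<omega> = y \<and> (\<forall>n. hit_time Y (a n) \<omega> < Time \<infinity>)}"
  have HN: "AE \<omega> in N. \<omega> \<in> H"
    using start hit AE_space by eventually_elim (simp add: H_def spN)
  have HM: "AE \<omega> in M. \<omega> \<in> H"
  proof -
    have "AE \<omega> in M. \<omega> \<in> S \<inter> {\<omega>\<in>C_abs. hit_time Y (a n) \<omega> < Time \<infinity>}" for n
    proof -
      let ?K = "S \<inter> {\<omega>\<in>C_abs. hit_time Y (a n) \<omega> < Time \<infinity>}"
      have K: "?K \<in> sets (?G n)" using S stopping_time_finite_sets[OF st] by auto
      have KM: "?K \<in> sets M" "?K \<in> sets N" using K stopped_alg_subset[OF st] M N by auto
      have "AE \<omega> in N. \<omega> \<in> ?K" using HN by eventually_elim (auto simp: H_def S_def)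
      then have "measure N ?K = 1" using N.AE_in_set_eq_1[OF KM(2)] by blast
      then have "measure M ?K = 1" using agree[OF K] by (simp add: measure_def)
      then show ?thesis using M.AE_in_set_eq_1[OF KM(1)] by blast
    qed
    then have "AE \<omega> in M. \<forall>n. \<omega> \<in> S \<inter> {\<omega>\<in>C_abs. hit_time Y (a n) \<omega> < Time \<infinity>}" by (simp add: AE_all_countable)
    then show ?thesis by eventually_elim (auto simp: H_def S_def)
  qed
  have trace: "\<exists>A'\<in>?\<Sigma>. A \<inter> H = A' \<inter> H" if "A \<in> sets path_alg" for A
    using that unfolding sets_path_filt[of Beyond]
  proof (induction rule: sigma_sets.induct)
    case (Basic A)
    then obtain u B where uB: "A = {\<omega>\<in>C_abs. \<omega> u \<in> B}" "0 \<le> u" "B \<in> sets borel" by auto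
    let ?Ms = "sigma C_abs E"
    have sMs: "sets ?Ms = ?\<Sigma>" "space ?Ms = C_abs" using EPow by auto
    define L where "L n \<omega> = (if \<omega> \<in> S then \<omega> (trunc (hit_time Y (a n)) u \<omega>) else 0)" for n \<omega>
    have L: "L n \<in> borel_measurable ?Ms" for n
    proof (rule measurableI)
      fix B :: "ennreal set" assume B: "B \<in> sets borel"
      have 1: "{\<omega>\<in>C_abs. \<omega> (trunc (hit_time Y (a n)) u \<omega>) \<in> B} \<inter> S \<in> E"
        using stopped_coordinate_sets[OF st uB(2) B] S by (auto simp: E_def)
      have 2: "S \<in> E" using S by (auto simp: E_def)
      have "L n -` B \<inter> space ?Ms = ({\<omega>\<in>C_abs. \<omega> (trunc (hit_time Y (a n)) u \<omega>) \<in> B} \<inter> S) \<union> (if 0 \<in> B then space ?Ms - S else {})"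
        by (auto simp: L_def sMs(2) split: if_splits)
      moreover have "{\<omega>\<in>C_abs. \<omega> (trunc (hit_time Y (a n)) u \<omega>) \<in> B} \<inter> S \<in> sets ?Ms" "S \<in> sets ?Ms"
        using 1 2 by (auto simp: sMs(1) sigma_sets.Basic)
      ultimately show "L n -` B \<inter> space ?Ms \<in> sets ?Ms" by auto
    qed simp
    have Lm: "(\<lambda>\<omega>. liminf (\<lambda>n. L n \<omega>)) \<in> borel_measurable ?Ms" using L by measurable
    let ?A' = "(\<lambda>\<omega>. liminf (\<lambda>n. L n \<omega>)) -` B \<inter> space ?Ms"
    have "?A' \<in> ?\<Sigma>" using measurable_sets[OF Lm uB(3)] by (simp only: sMs(1))
    moreover have "A \<inter> H = ?A' \<inter> H"
    proof -
      have "liminf (\<lambda>n. L n \<omega>) = \<omega> u" if h: "\<omega> \<in> H" for \<omega>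
      proof (rule lim_imp_Liminf[OF sequentially_bot])
        have "(\<lambda>n. \<omega> (trunc (hit_time Y (a n)) u \<omega>)) \<longlonglongrightarrow> \<omega> u"
          by (rule coordinate_tendsto[OF _ e a _ _ uB(2)]) (use h between in \<open>auto simp: H_def\<close>)
        then show "(\<lambda>n. L n \<omega>) \<longlonglongrightarrow> \<omega> u" using h by (simp add: L_def H_def S_def)
      qed
      then show ?thesis unfolding uB(1) sMs(2) by auto
    qed
    ultimately show ?case by blast
  next
    case Empty
    then show ?case by (intro bexI[of _ "{}"]) (auto intro: sigma_sets.Empty)
  next
    case (Compl A)
    then obtain A' where "A' \<in> ?\<Sigma>" "A \<inter> H = A' \<inter> H" by blast
    then show ?case by (intro bexI[of _ "C_abs - A'"]) (auto intro: sigma_sets.Compl)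
  next
    case (Union A)
    then obtain A' where A': "\<And>i. A' i \<in> ?\<Sigma>" "\<And>i. A i \<inter> H = A' i \<inter> H" by metis
    have "(\<Union>i. A' i) \<in> ?\<Sigma>" using A'(1) by (rule sigma_sets.Union)
    moreover have "(\<Union>i. A i) \<inter> H = (\<Union>i. A' i) \<inter> H" using A'(2) by blast
    ultimately show ?case by blast
  qed
  show "M = N"
  proof (rule measure_eqI)
    show "sets M = sets N" using M N by simp
    fix A assume "A \<in> sets M"
    then have A: "A \<in> sets path_alg" using M by simp
    then obtain A' where A': "A' \<in> ?\<Sigma>" "A \<inter> H = A' \<inter> H" using trace by blast
    have A'p: "A' \<in> sets path_alg" using A' \<Sigma>_sub by blast
    have "emeasure M A = emeasure M A'"
    proof (rule emeasure_eq_AE)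
      show "AE \<omega> in M. \<omega> \<in> A \<longleftrightarrow> \<omega> \<in> A'" using HM by eventually_elim (use A'(2) in blast)
    qed (use A A'p M in auto)
    also have "\<dots> = emeasure N A'" by (rule eq\<Sigma>[OF A'(1)])
    also have "\<dots> = emeasure N A"
    proof (rule emeasure_eq_AE)
      show "AE \<omega> in N. \<omega> \<in> A' \<longleftrightarrow> \<omega> \<in> A" using HN by eventually_elim (use A'(2) in blast)
    qed (use A A'p N in auto)
    finally show "emeasure M A = emeasure N A" .
  qed
qed

end

section \<open>Conditioned laws and Foellmer measures\<close>

text \<open>A density that is a constant multiple of an indicator amounts to conditioning.\<close>

lemma uniform_measure_proportional:
  assumes M: "prob_space M" and N: "prob_space N" and E: "E \<in> sets M" and A: "A \<in> sets M"
    and k: "measure N A = k * measure M (A \<inter> E)" "k * measure M E = 1"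
  shows "emeasure (uniform_measure M E) A = emeasure N A"
proof -
  interpret M: prob_space M by fact
  interpret N: prob_space N by fact
  have ne: "measure M E \<noteq> 0" using k(2) by auto
  then have pos: "0 < measure M E" using measure_nonneg[of M E] by linarith
  have "emeasure (uniform_measure M E) A = ennreal (measure M (E \<inter> A)) / ennreal (measure M E)"
    using E A by (simp add: M.emeasure_eq_measure)
  also have "\<dots> = ennreal (measure M (E \<inter> A) / measure M E)"
    using pos by (simp add: divide_ennreal)
  also have "measure M (E \<inter> A) / measure M E = measure N A"
    unfolding k(1) using k(2) ne by (simp add: Int_commute field_simps)
  finally show ?thesis by (simp add: N.emeasure_eq_measure)
qed

text \<open>The members agree on common events because each of them agrees there with the one measure \<open>N\<close>.\<close>

lemma (in absorbed_paths) conditioned_family: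
  assumes M: "sets M = sets path_alg" and N: "prob_space N" "sets N = sets path_alg"
    and eq: "\<And>a A. a \<in> I \<Longrightarrow> A \<in> sets (stopped_alg (hit_time Y a)) \<Longrightarrow>
      emeasure (uniform_measure M {\<omega> \<in> C_abs. hit_time Y a \<omega> \<le> hit_time Y b \<omega>}) A = emeasure N A"
  shows "consistent_family I (cond_restr M Y b)" "is_extension I (cond_restr M Y b) N"
    "\<And>a. sets (cond_restr M Y b a) = sets (stopped_alg (hit_time Y a))"
    "\<And>a A. a \<in> I \<Longrightarrow> A \<in> sets (stopped_alg (hit_time Y a)) \<Longrightarrow> emeasure (cond_restr M Y b a) A = emeasure N A"
proof -
  interpret N: prob_space N by fact
  have sub: "subalgebra (uniform_measure M {\<omega> \<in> C_abs. hit_time Y a \<omega> \<le> hit_time Y b \<omega>}) (stopped_alg (hit_time Y a))" for a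
    by (rule subalgebra_stopped_alg[OF stopping_time_hit_time]) (simp add: M)
  show sets: "sets (cond_restr M Y b a) = sets (stopped_alg (hit_time Y a))" for a
    unfolding cond_restr_def by (rule sets_restr_to_subalg[OF sub])
  show em: "emeasure (cond_restr M Y b a) A = emeasure N A"
    if "a \<in> I" "A \<in> sets (stopped_alg (hit_time Y a))" for a A
    unfolding cond_restr_def using emeasure_restr_to_subalg[OF sub that(2)] eq[OF that] by simp
  show "is_extension I (cond_restr M Y b) N"
    unfolding is_extension_def using N em sets by auto
  show "consistent_family I (cond_restr M Y b)"
    unfolding consistent_family_def
  proof (intro conjI ballI)
    fix a assume a: "a \<in> I"
    have sp: "space (cond_restr M Y b a) = C_abs"
      using sets_eq_imp_space_eq[OF sets[of a]] by simp
    have "C_abs \<in> sets (stopped_alg (hit_time Y a))" using sets.top[of "stopped_alg (hit_time Y a)"] by simp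
    from em[OF a this] show "prob_space (cond_restr M Y b a)"
      using N.emeasure_space_1 sets_eq_imp_space_eq[OF N(2)] by (intro prob_spaceI) (simp add: sp)
  qed (use em sets in auto)
qed

text \<open>If \<open>\<tau> < \<rho>\<close> and \<open>\<tau> \<le> t\<close>, then at \<open>t\<close> itself or at some rational time before \<open>t\<close> it is visible that \<open>\<tau>\<close> has
  come and \<open>\<rho>\<close> has not.\<close>

lemma before_other_sets:
  assumes S: "stopping_time path_filt \<tau>" and T: "stopping_time path_filt \<rho>"
    and A: "A \<in> sets (stopped_alg \<tau>)"
  shows "A \<inter> {\<omega>. \<tau> \<omega> < Time \<infinity> \<and> \<tau> \<omega> < \<rho> \<omega>} \<in> sets (stopped_alg (\<lambda>\<omega>. min (\<tau> \<omega>) (\<rho> \<omega>)))"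
proof (rule stopped_algI[OF stopping_time_min[OF S T]])
  have AC: "A \<subseteq> C_abs" using sets.sets_into_space[OF A] by simp
  have "A \<inter> {\<omega>. \<tau> \<omega> < Time \<infinity> \<and> \<tau> \<omega> < \<rho> \<omega>} = A \<inter> {\<omega>\<in>C_abs. \<tau> \<omega> < Time \<infinity>} \<inter> {\<omega>\<in>C_abs. \<tau> \<omega> < \<rho> \<omega>}"
    using AC by auto
  then show "A \<inter> {\<omega>. \<tau> \<omega> < Time \<infinity> \<and> \<tau> \<omega> < \<rho> \<omega>} \<in> sets path_alg"
    using A stopping_time_finite_sets[OF S] stopped_alg_subset[OF S] stopping_time_less_sets[OF S T] by auto
  fix t :: real assume t: "0 \<le> t"
  let ?Q = "insert t {q\<in>\<rat>. 0 \<le> q \<and> q \<le> t}"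
  let ?F = "\<lambda>\<sigma> q. {\<omega>\<in>C_abs. \<sigma> \<omega> \<le> Time (ennreal q)}"
  have eq: "A \<inter> {\<omega>. \<tau> \<omega> < Time \<infinity> \<and> \<tau> \<omega> < \<rho> \<omega>} \<inter> {\<omega>. min (\<tau> \<omega>) (\<rho> \<omega>) \<le> Time (ennreal t)} =
    (A \<inter> {\<omega>. \<tau> \<omega> \<le> Time (ennreal t)}) \<inter> (\<Union>q\<in>?Q. ?F \<tau> q - ?F \<rho> q)" (is "?L = ?R")
  proof (intro set_eqI iffI)
    fix \<omega> assume "\<omega> \<in> ?L"
    then have w: "\<omega> \<in> A" "\<omega> \<in> C_abs" "\<tau> \<omega> < \<rho> \<omega>" "\<tau> \<omega> \<le> Time (ennreal t)" using AC by (auto simp: min_def split: if_splits)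
    have "\<exists>q\<in>?Q. \<tau> \<omega> \<le> Time (ennreal q) \<and> \<not> \<rho> \<omega> \<le> Time (ennreal q)"
    proof (cases "\<rho> \<omega> \<le> Time (ennreal t)")
      case False
      then show ?thesis using w(4) by blast
    next
      case True
      have r: "\<rho> \<omega> < Time \<infinity>" "time_val (\<rho> \<omega>) \<le> t" and s: "\<tau> \<omega> < Time \<infinity>"
        using iffD1[OF le_Time_iff[OF t] True] le_Time_less_infinity[OF w(4)] by auto
      have "time_val (\<tau> \<omega>) < time_val (\<rho> \<omega>)"
      proof (rule ccontr)
        assume "\<not> time_val (\<tau> \<omega>) < time_val (\<rho> \<omega>)"
        then have "\<rho> \<omega> \<le> Time (ennreal (time_val (\<tau> \<omega>)))" using r(1) by (simp add: le_Time_iff)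
        then show False using w(3) Time_time_val[OF s] by simp
      qed
      then obtain q where q: "q \<in> \<rat>" "time_val (\<tau> \<omega>) < q" "q < time_val (\<rho> \<omega>)" using Rats_dense_in_real by blast
      have q0: "0 \<le> q" using q(2) time_val_nonneg[of "\<tau> \<omega>"] by linarith
      have "\<tau> \<omega> \<le> Time (ennreal q)" by (rule iffD2[OF le_Time_iff[OF q0]]) (use s q in simp)
      moreover have "\<not> \<rho> \<omega> \<le> Time (ennreal q)" using iffD1[OF le_Time_iff[OF q0], of "\<rho> \<omega>"] q by auto
      ultimately show ?thesis using q q0 r by (intro bexI[of _ q]) auto
    qed
    then show "\<omega> \<in> ?R" using w by blast
  next
    fix \<omega> assume "\<omega> \<in> ?R"
    then obtain q where w: "\<omega> \<in> A" "\<tau> \<omega> \<le> Time (ennreal t)" "\<tau> \<omega> \<le> Time (ennreal q)" "\<not> \<rho> \<omega> \<le> Time (ennreal q)"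
      using AC by blast
    then have "\<tau> \<omega> < \<rho> \<omega>" by (meson le_less_trans not_le)
    then show "\<omega> \<in> ?L" using w le_Time_less_infinity[OF w(2)] by (auto simp: min_le_iff_disj)
  qed
  have "(\<Union>q\<in>?Q. ?F \<tau> q - ?F \<rho> q) \<in> sets (filt t)"
  proof (rule sets.countable_UN'')
    show "countable ?Q" by (intro countable_insert countable_subset[OF _ countable_rat]) auto
    fix q assume "q \<in> ?Q"
    then have "q \<le> t" using t by auto
    then show "?F \<tau> q - ?F \<rho> q \<in> sets (filt t)"
      using stopping_time_le_filt[OF S] stopping_time_le_filt[OF T] by (intro sets.Diff) auto
  qed
  then show "?L \<in> sets (filt t)" unfolding eq using stopped_algD[OF S A t] by (rule sets.Int[rotated])
qed

locale foellmer_laws = scaled_laws + absorbed_information +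
  fixes y :: ereal and Q :: "path measure"
  assumes y: "y \<in> {l<..<r}" and s_l: "s l = 0"
    and foellmer: "foellmer_measure (P y) (\<lambda>t \<omega>. ratio (s (Y t \<omega>)) (s y)) Q"
begin

lemma y': "y \<in> {l..r}"
  by (rule interior_closed[OF y])

lemma l_fin: "\<bar>s l\<bar> \<noteq> \<infinity>"
  by (simp add: s_l)

lemma Q_prob: "prob_space Q" and sets_Q: "sets Q = sets path_alg"
  using foellmer by (auto simp: foellmer_measure_def)

lemma space_Q: "space Q = C_abs"
  using sets_eq_imp_space_eq[OF sets_Q] by simp

lemma sr_pos: "x \<in> {l<..<r} \<Longrightarrow> 0 < sr x"
  using s_l_less[of x] s_finite[of x] by (cases "s x") (auto simp: s_l)

lemma s_r_cases: "s r \<noteq> \<infinity> \<longrightarrow> \<bar>s r\<bar> \<noteq> \<infinity>"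
  using s_less_r[OF y] by (cases "s r") auto

lemma measure_Q_C_abs: "measure Q C_abs = 1"
  using prob_space.prob_space[OF Q_prob] unfolding space_Q .

definition X :: process where
  "X t \<omega> = s (Y t \<omega>) / ereal (sr y)"

lemma ratio_eq: "(\<lambda>t \<omega>. ratio (s (Y t \<omega>)) (s y)) = X"
  unfolding X_def ratio_def using s_sr[OF y] sr_pos[OF y] by (intro ext) (auto simp: zero_ereal_def)

text \<open>Below a level with finite scale value \<open>X\<close> is bounded, so it is a uniformly integrable martingale and
  the defining property of the Foellmer measure applies.\<close>

lemma foellmer_stopped:
  assumes st: "stopping_time path_filt \<sigma>" and b: "b \<in> {l..r}" "\<bar>s b\<bar> \<noteq> \<infinity>"
    and bd: "AE \<omega> in P y. \<forall>t\<ge>0. Y (trunc \<sigma> t \<omega>) \<omega> \<in> {l..b}"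
    and A: "A \<in> sets (stopped_alg \<sigma>)"
  shows "emeasure Q A = (\<integral>\<^sup>+\<omega>\<in>A. e2ennreal (stopped_limit X \<sigma> \<omega>) \<partial>P y)"
proof -
  have l: "l \<in> {l..r}" using lr by simp
  obtain K where K: "\<And>x. x \<in> {l..b} \<Longrightarrow> \<bar>s x\<bar> \<le> ereal K" using scale_bound[OF l_fin b(2) l b(1)] by blast
  have bound: "AE \<omega> in P y. \<forall>t\<ge>0. \<bar>s (Y (trunc \<sigma> t \<omega>) \<omega>)\<bar> \<le> ereal K"
    using bd by eventually_elim (use K in blast)
  have c: "sr y \<noteq> 0" using sr_pos[OF y] by simp
  note mart = stopped_scaled_martingale[OF prob[OF y'] sets_P[OF y'] Z_cont_adapted s_local_martingale[OF y] st bound c]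
  have "martingale (P y) (stopped X \<sigma>)" "uniformly_integrable (P y) (stopped X \<sigma>)"
    using mart by (simp_all add: X_def[abs_def])
  then show ?thesis using foellmer st A unfolding foellmer_measure_def ratio_eq by blast
qed

lemma stopped_limit_finite:
  assumes "\<sigma> \<omega> < Time \<infinity>"
  shows "stopped_limit X \<sigma> \<omega> = X (time_val (\<sigma> \<omega>)) \<omega>"
proof -
  have "stopped X \<sigma> t \<omega> = X (time_val (\<sigma> \<omega>)) \<omega>" if t: "time_val (\<sigma> \<omega>) \<le> t" for t
  proof -
    have "0 \<le> t" using t time_val_nonneg[of "\<sigma> \<omega>"] by linarith
    then have "\<sigma> \<omega> \<le> Time (ennreal t)" using le_Time_iff t assms by blast
    then show ?thesis by (simp add: stopped_def)
  qed
  then have "\<forall>\<^sub>F t in at_top. stopped X \<sigma> t \<omega> = X (time_val (\<sigma> \<omega>)) \<omega>"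
    by (auto simp: eventually_at_top_linorder)
  then show ?thesis unfolding stopped_limit_def
    by (intro tendsto_Lim trivial_limit_at_top_linorder tendsto_eventually)
qed

lemma stopped_limit_infinite:
  assumes w: "\<omega> \<in> C_abs" and inf: "\<not> \<sigma> \<omega> < Time \<infinity>" and e: "e \<in> {l..r}" and lim: "((\<lambda>t. Y t \<omega>) \<longlongrightarrow> e) at_top"
  shows "stopped_limit X \<sigma> \<omega> = s e / ereal (sr y)"
proof -
  have "\<not> \<sigma> \<omega> \<le> Time (ennreal t)" for t using inf le_Time_less_infinity by blast
  then have eq: "stopped X \<sigma> t \<omega> = X t \<omega>" for t by (simp add: stopped_def)
  have "\<forall>\<^sub>F t in at_top. Y t \<omega> \<in> {l..r}"
    using eventually_ge_at_top[of "0::real"] by eventually_elim (rule range[OF w])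
  with lim e have "((\<lambda>t. s (Y t \<omega>)) \<longlongrightarrow> s e) at_top" by (rule s_tendsto)
  then have "((\<lambda>t. ereal (1 / sr y) * s (Y t \<omega>)) \<longlongrightarrow> ereal (1 / sr y) * s e) at_top"
    by (rule tendsto_cmult_ereal[rotated]) simp
  moreover have "ereal (1 / sr y) * x = x / ereal (sr y)" for x
    using sr_pos[OF y] by (simp add: divide_ereal_def mult.commute inverse_eq_divide)
  ultimately have "((\<lambda>t. X t \<omega>) \<longlongrightarrow> s e / ereal (sr y)) at_top" by (simp add: X_def)
  then show ?thesis unfolding stopped_limit_def eq by (intro tendsto_Lim trivial_limit_at_top_linorder)
qed

lemma foellmer_level:
  assumes st: "stopping_time path_filt \<sigma>" and b: "b \<in> {l..r}" "\<bar>s b\<bar> \<noteq> \<infinity>"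
    and bd: "AE \<omega> in P y. \<forall>t\<ge>0. Y (trunc \<sigma> t \<omega>) \<omega> \<in> {l..b}"
    and A: "A \<in> sets (stopped_alg \<sigma>)" and E: "E \<in> sets path_alg" and c: "0 \<le> c"
    and lim: "AE \<omega> in P y. \<omega> \<in> A \<longrightarrow> stopped_limit X \<sigma> \<omega> = (if \<omega> \<in> E then ereal c else 0)"
  shows "measure Q A = c * measure (P y) (A \<inter> E)"
proof -
  interpret Py: prob_space "P y" by (rule prob[OF y'])
  have AE: "A \<inter> E \<in> sets (P y)" using A E stopped_alg_subset[OF st] sets_P[OF y'] by auto
  have "emeasure Q A = (\<integral>\<^sup>+\<omega>\<in>A. e2ennreal (stopped_limit X \<sigma> \<omega>) \<partial>P y)"
    by (rule foellmer_stopped[OF st b bd A])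
  also have "\<dots> = (\<integral>\<^sup>+\<omega>. ennreal c * indicator (A \<inter> E) \<omega> \<partial>P y)"
    by (rule nn_integral_cong_AE) (use lim in \<open>eventually_elim, auto simp: indicator_def e2ennreal_neg\<close>)
  also have "\<dots> = ennreal (c * measure (P y) (A \<inter> E))"
    using AE c by (simp add: nn_integral_cmult_indicator Py.emeasure_eq_measure ennreal_mult)
  finally show ?thesis using c by (simp add: measure_def)
qed

lemma bounded_at_hit:
  assumes "y \<le> b" and le: "\<And>\<omega>. \<sigma> \<omega> \<le> hit_time Y b \<omega>"
  shows "AE \<omega> in P y. \<forall>t\<ge>0. Y (trunc \<sigma> t \<omega>) \<omega> \<in> {l..b}"
  using start[OF y'] AE_space
proof eventually_elim
  case (elim \<omega>)
  then have w: "\<omega> \<in> C_abs" using space_P[OF y'] by simp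
  show ?case using value_bound(1)[of \<omega> _ \<sigma> b, OF w _ le] range[OF w trunc_bounds(1)] elim(1) assms(1) by auto
qed

lemma X_at_level:
  assumes c: "c \<in> {l<..<r}" and "Y (time_val (\<sigma> \<omega>)) \<omega> = c" "\<sigma> \<omega> < Time \<infinity>"
  shows "stopped_limit X \<sigma> \<omega> = ereal (sr c / sr y)"
proof -
  have "ereal (sr c) / ereal (sr y) = ereal (sr c / sr y)" using sr_pos[OF y] by simp
  then show ?thesis using stopped_limit_finite[of \<sigma> \<omega>, OF assms(3)] assms(2) s_sr[OF c] by (simp add: X_def)
qed

text \<open>Only values at finite times occur here, so the formula presupposes nothing about the
  long-run behaviour of the paths.\<close>

lemma foellmer_at_level:
  assumes st: "stopping_time path_filt \<sigma>" and b: "b \<in> {l<..<r}" "y \<le> b" "\<And>\<omega>. \<sigma> \<omega> \<le> hit_time Y b \<omega>"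
    and A: "A \<in> sets (stopped_alg \<sigma>)" and c: "c \<in> {l<..<r}"
    and lev: "\<And>\<omega>. \<omega> \<in> A \<Longrightarrow> \<sigma> \<omega> < Time \<infinity> \<and> Y (time_val (\<sigma> \<omega>)) \<omega> = c"
  shows "measure Q A = sr c / sr y * measure (P y) A"
proof -
  have "measure Q A = sr c / sr y * measure (P y) (A \<inter> space path_alg)"
  proof (rule foellmer_level[OF st interior_closed[OF b(1)] s_finite[OF b(1)] bounded_at_hit[OF b(2,3)] A])
    show "0 \<le> sr c / sr y" using sr_pos[OF c] sr_pos[OF y] by simp
    show "AE \<omega> in P y. \<omega> \<in> A \<longrightarrow> stopped_limit X \<sigma> \<omega> = (if \<omega> \<in> space path_alg then ereal (sr c / sr y) else 0)"
      using X_at_level[OF c] lev sets.sets_into_space[OF A] by (intro AE_I2) auto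
  qed (rule sets.top)
  moreover have "A \<inter> space path_alg = A" using sets.sets_into_space[OF A] by auto
  ultimately show ?thesis by simp
qed

text \<open>A path that converges to an endpoint cannot visit an interior level after having reached it, and it
  does not converge to an interior level. So both sides say that \<open>a\<close> is visited.\<close>

lemma endpoint_hit_before:
  assumes w: "\<omega> \<in> C_abs" and e: "e \<in> {l, r}" and a: "a \<in> {l<..<r}" and lim: "((\<lambda>t. Y t \<omega>) \<longlongrightarrow> e) at_top"
  shows "hit_time Y a \<omega> \<le> hit_time Y e \<omega> \<longleftrightarrow> hit_time Y a \<omega> < Time \<infinity>"
proof
  have he: "hit_time Y e \<omega> \<le> Time \<infinity>" using endpoint_hit_iff[OF w e] lim by blast
  have ae: "a \<noteq> e" using a e by auto
  {
    assume h: "hit_time Y a \<omega> \<le> hit_time Y e \<omega>"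
    then have "hit_time Y a \<omega> \<le> Time \<infinity>" using he by (rule order_trans)
    then have "(\<exists>u\<ge>0. Y u \<omega> = a) \<or> ((\<lambda>t. Y t \<omega>) \<longlongrightarrow> a) at_top" using hit_time_le_infinity_iff[OF w] by blast
    moreover have "\<not> ((\<lambda>t. Y t \<omega>) \<longlongrightarrow> a) at_top"
      using tendsto_unique[OF trivial_limit_at_top_linorder lim] ae by metis
    ultimately show "hit_time Y a \<omega> < Time \<infinity>" using hit_time_less_infinity_iff[OF w] by blast
  next
    assume h: "hit_time Y a \<omega> < Time \<infinity>"
    show "hit_time Y a \<omega> \<le> hit_time Y e \<omega>"
    proof (cases "hit_time Y e \<omega> < Time \<infinity>")
      case True
      let ?v = "time_val (hit_time Y e \<omega>)"
      obtain u where u: "0 \<le> u" "Y u \<omega> = a" using hit_time_less_infinity_iff[OF w] h by blast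
      have "u \<le> ?v"
      proof (rule ccontr)
        assume "\<not> u \<le> ?v"
        then have "Y u \<omega> = e" using absorbed[OF w time_val_nonneg, of "hit_time Y e \<omega>" u] at_hit_time(1)[OF w True] e by auto
        then show False using u ae by simp
      qed
      then have "hit_time Y a \<omega> \<le> Time (ennreal ?v)" using hit_time_le_iff[OF w time_val_nonneg] u by blast
      then show ?thesis using Time_time_val[OF True] by simp
    next
      case False
      then show ?thesis using h by simp
    qed
  }
qed

lemma C_abs_stopped: "C_abs \<in> sets (stopped_alg \<sigma>)"
  using sets.top[of "stopped_alg \<sigma>"] by simp

lemma limit_l:
  assumes "s r = \<infinity>"
  shows "AE \<omega> in P y. ((\<lambda>t. Y t \<omega>) \<longlongrightarrow> l) at_top"
  using limit_exists[OF l_fin s_r_cases y] assms by simp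

text \<open>Paths that never visit \<open>a\<close> converge to \<open>l\<close>, where \<open>X\<close> vanishes.\<close>

lemma foellmer_hit_level:
  assumes r_inf: "s r = \<infinity>" and a: "y < a" "a < r" and A: "A \<in> sets (stopped_alg (hit_time Y a))"
  shows "measure Q A = sr a / sr y * measure (P y) (A \<inter> {\<omega>\<in>C_abs. hit_time Y a \<omega> < Time \<infinity>})"
proof -
  have aI: "a \<in> {l<..<r}" using less_trans[OF _ a(1), of l] a(2) y by simp
  have ya: "y \<le> a" using a by simp
  show ?thesis
  proof (rule foellmer_level[OF stopping_time_hit_time interior_closed[OF aI] s_finite[OF aI] bounded_at_hit[OF ya order_refl] A finite_sets_P[OF stopping_time_hit_time]])
    show "0 \<le> sr a / sr y" using sr_pos[OF aI] sr_pos[OF y] by simp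
    show "AE \<omega> in P y. \<omega> \<in> A \<longrightarrow> stopped_limit X (hit_time Y a) \<omega> =
        (if \<omega> \<in> {\<omega> \<in> C_abs. hit_time Y a \<omega> < Time \<infinity>} then ereal (sr a / sr y) else 0)"
      using limit_l[OF r_inf] AE_space
    proof eventually_elim
      case (elim \<omega>)
      then have w: "\<omega> \<in> C_abs" using space_P[OF y'] by simp
      show ?case
      proof (cases "hit_time Y a \<omega> < Time \<infinity>")
        case True
        have "stopped_limit X (hit_time Y a) \<omega> = ereal (sr a / sr y)"
          by (rule X_at_level[of a "hit_time Y a" \<omega>, OF aI at_hit_time(1)[OF w True] True])
        then show ?thesis using True w by simp
      next
        case False
        have "l \<in> {l..r}" using lr by simp
        from stopped_limit_infinite[of \<omega> "hit_time Y a" l, OF w False this elim(1)] show ?thesis using False by (simp add: s_l)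
      qed
    qed
  qed
qed

lemma conditioned_on_hitting_above:
  assumes r_inf: "s r = \<infinity>" and a: "y < a" "a < r" and A: "A \<in> sets (stopped_alg (hit_time Y a))"
  shows "emeasure (uniform_measure (P y) {\<omega> \<in> C_abs. hit_time Y a \<omega> \<le> hit_time Y l \<omega>}) A = emeasure Q A"
proof -
  interpret Py: prob_space "P y" by (rule prob[OF y'])
  interpret Q: prob_space Q by (rule Q_prob)
  have aI: "a \<in> {l<..<r}" using less_trans[OF _ a(1), of l] a(2) y by simp
  let ?E = "{\<omega> \<in> C_abs. hit_time Y a \<omega> \<le> hit_time Y l \<omega>}"
  let ?H = "{\<omega>\<in>C_abs. hit_time Y a \<omega> < Time \<infinity>}"
  have E: "?E \<in> sets (P y)" using stopping_times_le_sets[OF stopping_time_hit_time stopping_time_hit_time] sets_P[OF y'] by simp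
  have H: "?H \<in> sets (P y)" using finite_sets_P[OF stopping_time_hit_time] sets_P[OF y'] by simp
  have eq: "measure (P y) (B \<inter> ?H) = measure (P y) (B \<inter> ?E)" if "B \<in> sets (P y)" for B
  proof (rule Py.finite_measure_eq_AE)
    show "AE \<omega> in P y. \<omega> \<in> B \<inter> ?H \<longleftrightarrow> \<omega> \<in> B \<inter> ?E"
      using limit_l[OF r_inf] AE_space
    proof eventually_elim
      case (elim \<omega>)
      then have w: "\<omega> \<in> C_abs" using space_P[OF y'] by simp
      show ?case using endpoint_hit_before[OF w _ aI elim(1)] w by simp
    qed
  qed (use that E H in auto)
  have AP: "A \<in> sets (P y)" using A stopped_alg_subset[OF stopping_time_hit_time] sets_P[OF y'] by blast
  show ?thesis
  proof (rule uniform_measure_proportional[OF Py.prob_space_axioms Q_prob E AP])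
    show "measure Q A = sr a / sr y * measure (P y) (A \<inter> ?E)"
      using foellmer_hit_level[OF r_inf a A] eq[OF AP] by simp
    have "C_abs \<in> sets (P y)" using sets.top[of "P y"] space_P[OF y'] by simp
    from eq[OF this] have "measure Q C_abs = sr a / sr y * measure (P y) (C_abs \<inter> ?E)"
      unfolding foellmer_hit_level[OF r_inf a C_abs_stopped] by (simp only:)
    moreover have "C_abs \<inter> ?E = ?E" by auto
    ultimately show "sr a / sr y * measure (P y) ?E = 1" using measure_Q_C_abs by (simp only:)
  qed
qed

text \<open>The density vanishes on paths that do not reach \<open>a\<close>.\<close>

lemma Q_hits_above:
  assumes r_inf: "s r = \<infinity>" and a: "y < a" "a < r"
  shows "AE \<omega> in Q. hit_time Y a \<omega> < Time \<infinity>"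
proof -
  interpret Q: prob_space Q by (rule Q_prob)
  let ?H = "{\<omega>\<in>C_abs. hit_time Y a \<omega> < Time \<infinity>}"
  have H: "?H \<in> sets (stopped_alg (hit_time Y a))" by (rule stopping_time_finite_sets[OF stopping_time_hit_time])
  have HQ: "?H \<in> sets Q" using finite_sets_P[OF stopping_time_hit_time] sets_Q by simp
  have "C_abs \<inter> ?H = ?H" by auto
  then have "measure Q ?H = measure Q C_abs"
    using foellmer_hit_level[OF r_inf a H] foellmer_hit_level[OF r_inf a C_abs_stopped] by simp
  then have "measure Q ?H = 1" using Q.prob_space space_Q by simp
  then have "AE \<omega> in Q. \<omega> \<in> ?H" using Q.AE_in_set_eq_1[OF HQ] by blast
  then show ?thesis by eventually_elim simp
qed

lemma Q_start: "AE \<omega> in Q. Y 0 \<omega> = y"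
proof -
  interpret Q: prob_space Q by (rule Q_prob)
  interpret Py: prob_space "P y" by (rule prob[OF y'])
  let ?S = "{\<omega>\<in>C_abs. Y 0 \<omega> = y}" and ?\<sigma> = "\<lambda>_::path. Time (ennreal 0)"
  have st: "stopping_time path_filt ?\<sigma>" by (rule stopping_time_const)
  have S0: "?S \<in> sets (filt 0)"
    using measurable_sets[OF meas[OF order_refl], of "{y}"] by (simp add: vimage_def Int_def conj_commute)
  have S: "?S \<in> sets (stopped_alg ?\<sigma>)" by (rule finite_horizon_stopped_alg[OF st S0])
  have SP: "?S \<in> sets path_alg" using S0 filt_path_alg by blast
  have t0: "trunc ?\<sigma> t \<omega> = 0" if "0 \<le> t" for t \<omega> using that by (simp add: trunc_eq_min)
  have bd: "AE \<omega> in P y. \<forall>t\<ge>0. Y (trunc ?\<sigma> t \<omega>) \<omega> \<in> {l..y}"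
    using start[OF y'] by eventually_elim (use t0 y in auto)
  have "measure Q ?S = 1 * measure (P y) (?S \<inter> ?S)"
  proof (rule foellmer_level[OF st y' s_finite[OF y] bd S SP])
    show "AE \<omega> in P y. \<omega> \<in> ?S \<longrightarrow> stopped_limit X ?\<sigma> \<omega> = (if \<omega> \<in> ?S then ereal 1 else 0)"
      using X_at_level[OF y, of ?\<sigma>] sr_pos[OF y] by (intro AE_I2) simp
  qed simp
  also have "\<dots> = 1"
  proof -
    have "AE \<omega> in P y. \<omega> \<in> ?S" using start[OF y'] AE_space by eventually_elim (simp add: space_P[OF y'])
    then show ?thesis using Py.AE_in_set_eq_1[of ?S] SP sets_P[OF y'] by simp
  qed
  finally have "AE \<omega> in Q. \<omega> \<in> ?S" using Q.AE_in_set_eq_1[of ?S] SP sets_Q by simp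
  then show ?thesis by eventually_elim simp
qed

text \<open>Stop at the minimum of the return time and a level \<open>b'\<close> beyond \<open>b\<close>. On the event that the return comes
  first the density is \<open>s(c)/s(y)\<close>, and under \<open>P\<close> the visit to \<open>b\<close> that precedes it has probability at most
  \<open>s(y)/s(b)\<close>. The product does not depend on \<open>b'\<close>, which may tend to \<open>r\<close>.\<close>

lemma Q_return_prob:
  assumes r_inf: "s r = \<infinity>" and c: "c \<in> {l<..<r}" and b: "b \<in> {l<..<r}" "y < b" "c < b"
  shows "measure Q {\<omega>\<in>C_abs. return_time Y b c \<omega> < Time \<infinity>} \<le> sr c / sr b"
proof -
  interpret Q: prob_space Q by (rule Q_prob)
  interpret Py: prob_space "P y" by (rule prob[OF y'])
  let ?\<rho> = "return_time Y b c"
  have cb: "b \<noteq> c" using b by auto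
  have st: "stopping_time path_filt ?\<rho>" by (rule stopping_time_return_time[OF cb])
  have br: "b < r" using b by simp
  obtain b' where b': "\<And>n. b' n < r" "\<And>n. b < b' n" "b' \<longlonglongrightarrow> r" using approaching_from_below[OF br] by blast
  have b'I: "b' n \<in> {l<..<r}" for n using less_trans[OF _ b'(2)[of n], of l] b'(1)[of n] b(1) by simp
  let ?A = "{\<omega>\<in>C_abs. ?\<rho> \<omega> < Time \<infinity>}"
  let ?An = "\<lambda>n. C_abs \<inter> {\<omega>. ?\<rho> \<omega> < Time \<infinity> \<and> ?\<rho> \<omega> < hit_time Y (b' n) \<omega>}"
  have A: "?A \<in> sets path_alg" by (rule finite_sets_P[OF st])
  have Ans: "?An n \<in> sets (stopped_alg (\<lambda>\<omega>. min (?\<rho> \<omega>) (hit_time Y (b' n) \<omega>)))" for n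
    by (rule before_other_sets[OF st stopping_time_hit_time C_abs_stopped])
  have An: "?An n \<in> sets path_alg" for n
    using Ans[of n] stopped_alg_subset[OF stopping_time_min[OF st stopping_time_hit_time]] by blast
  have bound: "measure Q (?A \<inter> ?An n) \<le> sr c / sr b" for n
  proof -
    have sub: "?A \<inter> ?An n = ?An n" by auto
    have yb: "y \<le> b' n" using b(2) b'(2)[of n] by simp
    have "measure Q (?An n) = sr c / sr y * measure (P y) (?An n)"
    proof (rule foellmer_at_level[OF stopping_time_min[OF st stopping_time_hit_time] b'I yb min.cobounded2 Ans c])
      fix \<omega> assume "\<omega> \<in> ?An n"
      then have w: "\<omega> \<in> C_abs" "?\<rho> \<omega> < Time \<infinity>" "min (?\<rho> \<omega>) (hit_time Y (b' n) \<omega>) = ?\<rho> \<omega>" by auto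
      show "min (?\<rho> \<omega>) (hit_time Y (b' n) \<omega>) < Time \<infinity> \<and> Y (time_val (min (?\<rho> \<omega>) (hit_time Y (b' n) \<omega>))) \<omega> = c"
        unfolding w(3) using w(2) at_return_time[OF w(1,2)] by blast
    qed
    also have "\<dots> \<le> sr c / sr y * measure (P y) {\<omega>\<in>C_abs. hit_time Y b \<omega> < Time \<infinity>}"
    proof (intro mult_left_mono Py.finite_measure_mono)
      show "?An n \<subseteq> {\<omega>\<in>C_abs. hit_time Y b \<omega> < Time \<infinity>}"
        using return_time_less_infinity_iff hit_time_less_infinity_iff by blast
      show "{\<omega>\<in>C_abs. hit_time Y b \<omega> < Time \<infinity>} \<in> sets (P y)"
        using finite_sets_P[OF stopping_time_hit_time] sets_P[OF y'] by simp
      show "0 \<le> sr c / sr y" using sr_pos[OF c] sr_pos[OF y] by simp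
    qed
    also have "\<dots> \<le> sr c / sr y * (sr y / sr b)"
    proof (rule mult_left_mono)
      have "sr b * measure (P y) {\<omega>\<in>C_abs. hit_time Y b \<omega> < Time \<infinity>} \<le> sr y"
        using hit_above_prob[OF l_fin y b(1)] b(2) by (simp add: s_l)
      then show "measure (P y) {\<omega>\<in>C_abs. hit_time Y b \<omega> < Time \<infinity>} \<le> sr y / sr b"
        using sr_pos[OF b(1)] by (simp add: pos_le_divide_eq mult.commute)
      show "0 \<le> sr c / sr y" using sr_pos[OF c] sr_pos[OF y] by simp
    qed
    also have "\<dots> = sr c / sr b" using sr_pos[OF y] by simp
    finally show ?thesis unfolding sub .
  qed
  have "(\<lambda>n. measure Q (?A \<inter> ?An n)) \<longlonglongrightarrow> measure Q ?A"
  proof (rule measure_tendsto_eventually[OF Q_prob])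
    show "?A \<in> sets Q" "\<And>n. ?An n \<in> sets Q" using A An sets_Q by simp_all
    show "AE \<omega> in Q. \<omega> \<in> ?A \<longrightarrow> (\<forall>\<^sub>F n in sequentially. \<omega> \<in> ?An n)"
    proof (rule AE_I2, rule impI)
      fix \<omega> assume "\<omega> \<in> ?A"
      then have w: "\<omega> \<in> C_abs" and fin: "?\<rho> \<omega> < Time \<infinity>" by auto
      let ?v = "time_val (?\<rho> \<omega>)"
      have "Y u \<omega> \<noteq> r" if "0 \<le> u" "u \<le> ?v" for u
        using absorbed[OF w that] at_return_time[OF w fin] c by auto
      from eventually_not_attained[OF w b'(3) this]
      have "\<forall>\<^sub>F n in sequentially. \<forall>u. 0 \<le> u \<longrightarrow> u \<le> ?v \<longrightarrow> Y u \<omega> \<noteq> b' n" by blast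
      then show "\<forall>\<^sub>F n in sequentially. \<omega> \<in> ?An n"
      proof eventually_elim
        case (elim n)
        have "\<not> hit_time Y (b' n) \<omega> \<le> Time (ennreal ?v)" using elim hit_time_le_iff[OF w time_val_nonneg] by blast
        then have "?\<rho> \<omega> < hit_time Y (b' n) \<omega>" using Time_time_val[OF fin] by (simp add: not_le)
        then show ?case using w fin by blast
      qed
    qed
  qed
  then show ?thesis by (rule LIMSEQ_le_const2) (use bound in blast)
qed

text \<open>All levels above \<open>y\<close> are reached, and the return probability \<open>s(c)/s(b)\<close> tends to \<open>0\<close> as \<open>b\<close> tends to
  \<open>r\<close>; hence paths eventually stay above every interior level.\<close>

lemma Q_limit_r:
  assumes r_inf: "s r = \<infinity>"
  shows "AE \<omega> in Q. ((\<lambda>t. Y t \<omega>) \<longlongrightarrow> r) at_top"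
proof -
  interpret Q: prob_space Q by (rule Q_prob)
  have evc: "AE \<omega> in Q. \<forall>\<^sub>F t in at_top. c < Y t \<omega>" if c: "c \<in> {l<..<r}" for c
  proof -
    have m: "max c y < r" using c y by simp
    obtain b where b: "\<And>n. b n < r" "\<And>n. max c y < b n" "b \<longlonglongrightarrow> r" using approaching_from_below[OF m] by blast
    have b2: "c < b n" "y < b n" for n using b(2)[of n] by auto
    have bI: "b n \<in> {l<..<r}" for n using less_trans[OF _ b2(2)[of n], of l] b(1)[of n] y by simp
    let ?R = "\<lambda>n. {\<omega>\<in>C_abs. return_time Y (b n) c \<omega> < Time \<infinity>}"
    have R: "?R n \<in> sets Q" for n
      using finite_sets_P[OF stopping_time_return_time, of "b n" c] b2(1)[of n] sets_Q by auto
    let ?B = "\<Inter>n. ?R n"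
    have B: "?B \<in> sets Q" using R by auto
    have le: "measure Q ?B \<le> sr c / sr (b n)" for n
      using Q.finite_measure_mono[OF _ R, of ?B n] Q_return_prob[OF r_inf c bI b2(2) b2(1)] by (meson INT_lower UNIV_I order_trans)
    have "(\<lambda>n. s (b n)) \<longlonglongrightarrow> s r" by (rule s_tendsto[OF b(3)]) (use interior_closed[OF bI] lr in auto)
    then have "(\<lambda>n. ereal (sr (b n))) \<longlonglongrightarrow> \<infinity>" using s_sr[OF bI] r_inf by simp
    then have "filterlim (\<lambda>n. sr (b n)) at_top sequentially" by (simp add: tendsto_PInfty_eq_at_top)
    then have "(\<lambda>n. sr c / sr (b n)) \<longlonglongrightarrow> 0" by (rule real_tendsto_divide_at_top[OF tendsto_const])
    then have "measure Q ?B \<le> 0" by (rule LIMSEQ_le_const) (use le in blast)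
    then have "measure Q ?B = 0" using measure_nonneg[of Q ?B] by linarith
    then have "emeasure Q ?B = 0" by (simp add: Q.emeasure_eq_measure)
    then have nB: "AE \<omega> in Q. \<omega> \<notin> ?B" by (intro AE_not_in) (use B in \<open>auto simp: null_sets_def\<close>)
    have hits: "AE \<omega> in Q. \<forall>n. hit_time Y (b n) \<omega> < Time \<infinity>"
      unfolding AE_all_countable using Q_hits_above[OF r_inf b2(2) b(1)] by blast
    from nB hits show ?thesis using AE_space
    proof eventually_elim
      case (elim \<omega>)
      then have w: "\<omega> \<in> C_abs" using space_Q by simp
      then obtain n where n: "\<not> return_time Y (b n) c \<omega> < Time \<infinity>" using elim(1) by blast
      obtain u where u: "0 \<le> u" "Y u \<omega> = b n" using elim(2) hit_time_less_infinity_iff[OF w] by blast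
      have "\<forall>t\<ge>u. c < Y t \<omega>" using no_return(2)[OF w u n _ b2(1)] by blast
      then show ?case by (auto simp: eventually_at_top_linorder)
    qed
  qed
  obtain c where c: "\<And>n. c n < r" "\<And>n. l < c n" "c \<longlonglongrightarrow> r" using approaching_from_below[OF lr] by blast
  have "AE \<omega> in Q. \<forall>n. \<forall>\<^sub>F t in at_top. c n < Y t \<omega>"
    unfolding AE_all_countable using evc c by simp
  then show ?thesis using AE_space
  proof eventually_elim
    case (elim \<omega>)
    then have w: "\<omega> \<in> C_abs" using space_Q by simp
    show ?case
    proof (rule order_tendstoI)
      fix x assume "x < r"
      with c(3) have "\<forall>\<^sub>F n in sequentially. x < c n" by (rule order_tendstoD(1))
      then obtain n where n: "x < c n" by (auto simp: eventually_sequentially)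
      have "\<forall>\<^sub>F t in at_top. c n < Y t \<omega>" using elim(1) by blast
      then show "\<forall>\<^sub>F t in at_top. x < Y t \<omega>" by eventually_elim (use n in \<open>auto intro: less_trans\<close>)
    next
      fix x assume x: "r < x"
      show "\<forall>\<^sub>F t in at_top. Y t \<omega> < x"
        using eventually_ge_at_top[of "0::real"]
      proof eventually_elim
        case (elim t)
        then show ?case using range[OF w elim] x by (auto intro: le_less_trans)
      qed
    qed
  qed
qed

lemma P_hits_below:
  assumes r_inf: "s r = \<infinity>" and a: "l < a" "a < y"
  shows "AE \<omega> in P y. hit_time Y a \<omega> < Time \<infinity>"
  using limit_l[OF r_inf] start[OF y'] AE_space
proof eventually_elim
  case (elim \<omega>)
  then have w: "\<omega> \<in> C_abs" using space_P[OF y'] by simp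
  have "\<forall>\<^sub>F t in at_top. Y t \<omega> < a" using elim(1) a(1) by (rule order_tendstoD(2))
  then obtain T where T: "\<And>t. T \<le> t \<Longrightarrow> Y t \<omega> < a" by (auto simp: eventually_at_top_linorder)
  have "Y (max T 0) \<omega> \<le> a \<and> a \<le> Y 0 \<omega>" using T[of "max T 0"] elim(2) a(2) by (auto intro: less_imp_le)
  then obtain u where "0 \<le> u" "Y u \<omega> = a" using crossing[OF w order_refl, of "max T 0" a] by auto
  then show ?case using hit_time_less_infinity_iff[OF w] by blast
qed

text \<open>Before a level \<open>b > y\<close> is reached, the density at \<open>\<tau>\<^sub>a\<close> is the constant \<open>s(a)/s(y)\<close>. A path that reaches \<open>a\<close>
  does so before it reaches levels close to \<open>r\<close>, so that \<open>b\<close> may tend to \<open>r\<close> under both measures. Under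
  \<open>Q\<close> reaching \<open>a\<close> is the same as \<open>\<tau>\<^sub>a \<le> \<tau>\<^sub>r\<close> because paths converge to \<open>r\<close>; under \<open>P\<close> it is almost sure.\<close>

lemma conditioned_back:
  assumes r_inf: "s r = \<infinity>" and a: "l < a" "a < y" and A: "A \<in> sets (stopped_alg (hit_time Y a))"
  shows "emeasure (uniform_measure Q {\<omega> \<in> C_abs. hit_time Y a \<omega> \<le> hit_time Y r \<omega>}) A = emeasure (P y) A"
proof -
  interpret Q: prob_space Q by (rule Q_prob)
  interpret Py: prob_space "P y" by (rule prob[OF y'])
  note st = stopping_time_hit_time
  have aI: "a \<in> {l<..<r}" using less_trans[OF a(2), of r] a(1) y by simp
  have yr: "y < r" using y by simp
  obtain b where b: "\<And>n. b n < r" "\<And>n. y < b n" "b \<longlonglongrightarrow> r" using approaching_from_below[OF yr] by blast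
  have bI: "b n \<in> {l<..<r}" for n using less_trans[OF _ b(2)[of n], of l] b(1)[of n] y by simp
  let ?E = "{\<omega> \<in> C_abs. hit_time Y a \<omega> \<le> hit_time Y r \<omega>}"
  let ?H = "{\<omega>\<in>C_abs. hit_time Y a \<omega> < Time \<infinity>}"
  have E: "?E \<in> sets Q" using stopping_times_le_sets[OF st st] sets_Q by simp
  have H: "?H \<in> sets path_alg" by (rule finite_sets_P[OF st])
  have key: "measure Q (B \<inter> ?E) = sr a / sr y * measure (P y) B" if B: "B \<in> sets (stopped_alg (hit_time Y a))" for B
  proof -
    have Bp: "B \<in> sets path_alg" using B stopped_alg_subset[OF st] by blast
    have BH: "B \<inter> ?H \<in> sets path_alg" using Bp H by auto
    let ?Bn = "\<lambda>n. B \<inter> {\<omega>. hit_time Y a \<omega> < Time \<infinity> \<and> hit_time Y a \<omega> < hit_time Y (b n) \<omega>}"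
    have Bns: "?Bn n \<in> sets (stopped_alg (\<lambda>\<omega>. min (hit_time Y a \<omega>) (hit_time Y (b n) \<omega>)))" for n
      by (rule before_other_sets[OF st st B])
    have Bn: "?Bn n \<in> sets path_alg" for n using Bns[of n] stopped_alg_subset[OF stopping_time_min[OF st st]] by blast
    have BC: "B \<subseteq> C_abs" using sets.sets_into_space[OF B] by simp
    have eqn: "measure Q (?Bn n) = sr a / sr y * measure (P y) (?Bn n)" for n
    proof (rule foellmer_at_level[OF stopping_time_min[OF st st] bI less_imp_le[OF b(2)] min.cobounded2 Bns aI])
      fix \<omega> assume "\<omega> \<in> ?Bn n"
      then have w: "\<omega> \<in> C_abs" "hit_time Y a \<omega> < Time \<infinity>" "min (hit_time Y a \<omega>) (hit_time Y (b n) \<omega>) = hit_time Y a \<omega>"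
        using BC by auto
      show "min (hit_time Y a \<omega>) (hit_time Y (b n) \<omega>) < Time \<infinity> \<and> Y (time_val (min (hit_time Y a \<omega>) (hit_time Y (b n) \<omega>))) \<omega> = a"
        unfolding w(3) using w(2) at_hit_time(1)[OF w(1,2)] by blast
    qed
    have ev: "\<forall>\<^sub>F n in sequentially. \<omega> \<in> ?Bn n" if "\<omega> \<in> B \<inter> ?H" for \<omega>
    proof -
      have w: "\<omega> \<in> C_abs" and fin: "hit_time Y a \<omega> < Time \<infinity>" and wB: "\<omega> \<in> B" using that by auto
      let ?v = "time_val (hit_time Y a \<omega>)"
      have "Y u \<omega> \<noteq> r" if "0 \<le> u" "u \<le> ?v" for u
        using absorbed[OF w that] at_hit_time(1)[OF w fin] aI by auto
      from eventually_not_attained[OF w b(3) this]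
      have "\<forall>\<^sub>F n in sequentially. \<forall>u. 0 \<le> u \<longrightarrow> u \<le> ?v \<longrightarrow> Y u \<omega> \<noteq> b n" by blast
      then show ?thesis
      proof eventually_elim
        case (elim n)
        have "\<not> hit_time Y (b n) \<omega> \<le> Time (ennreal ?v)" using elim hit_time_le_iff[OF w time_val_nonneg] by blast
        then have "hit_time Y a \<omega> < hit_time Y (b n) \<omega>" using Time_time_val[OF fin] by (simp add: not_le)
        then show ?case using wB fin by blast
      qed
    qed
    have BHn: "(B \<inter> ?H) \<inter> ?Bn n = ?Bn n" for n using BC by auto
    have l1: "(\<lambda>n. measure Q ((B \<inter> ?H) \<inter> ?Bn n)) \<longlonglongrightarrow> measure Q (B \<inter> ?H)"
      by (rule measure_tendsto_eventually[OF Q_prob]) (use BH Bn sets_Q ev in auto)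
    have l2: "(\<lambda>n. measure (P y) ((B \<inter> ?H) \<inter> ?Bn n)) \<longlonglongrightarrow> measure (P y) (B \<inter> ?H)"
      by (rule measure_tendsto_eventually[OF Py.prob_space_axioms]) (use BH Bn sets_P[OF y'] ev in auto)
    have "measure Q (B \<inter> ?H) = sr a / sr y * measure (P y) (B \<inter> ?H)"
      using l1[unfolded BHn eqn] tendsto_mult_left[OF l2[unfolded BHn]] by (rule LIMSEQ_unique)
    moreover have "measure Q (B \<inter> ?H) = measure Q (B \<inter> ?E)"
    proof (rule Q.finite_measure_eq_AE)
      show "AE \<omega> in Q. \<omega> \<in> B \<inter> ?H \<longleftrightarrow> \<omega> \<in> B \<inter> ?E"
        using Q_limit_r[OF r_inf] AE_space
      proof eventually_elim
        case (elim \<omega>)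
        then have w: "\<omega> \<in> C_abs" using space_Q by simp
        show ?case using endpoint_hit_before[OF w _ aI elim(1)] w by simp
      qed
    qed (use Bp BH E sets_Q in auto)
    moreover have "measure (P y) (B \<inter> ?H) = measure (P y) B"
    proof (rule Py.finite_measure_eq_AE)
      show "AE \<omega> in P y. \<omega> \<in> B \<inter> ?H \<longleftrightarrow> \<omega> \<in> B"
        using P_hits_below[OF r_inf a] AE_space by eventually_elim (auto simp: space_P[OF y'])
    qed (use Bp BH sets_P[OF y'] in auto)
    ultimately show ?thesis by simp
  qed
  have AQ: "A \<in> sets Q" using A stopped_alg_subset[OF st] sets_Q by blast
  have pos: "0 < sr a" "0 < sr y" using sr_pos aI y by auto
  show ?thesis
  proof (rule uniform_measure_proportional[OF Q_prob Py.prob_space_axioms E AQ])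
    show "measure (P y) A = sr y / sr a * measure Q (A \<inter> ?E)" using key[OF A] pos by simp
    have "C_abs \<inter> ?E = ?E" by auto
    then have "measure Q ?E = sr a / sr y" using key[OF C_abs_stopped] Py.prob_space space_P[OF y'] by simp
    then show "sr y / sr a * measure Q ?E = 1" using pos by simp
  qed
qed

lemma never_hits_l_sets: "{\<omega> \<in> C_abs. hit_time Y l \<omega> = Beyond} \<in> sets path_alg"
proof -
  have eq: "{\<omega> \<in> C_abs. hit_time Y l \<omega> = Beyond} = space path_alg - {\<omega>\<in>C_abs. hit_time Y l \<omega> \<le> Time \<infinity>}"
    using hit_time_Beyond_iff by auto
  show ?thesis unfolding eq
    by (intro sets.compl_sets subsetD[OF filt_path_alg stopping_time_le_sets[OF stopping_time_hit_time]])
qed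

lemma never_hits_l_null:
  assumes "s r = \<infinity>"
  shows "measure (P y) {\<omega> \<in> C_abs. hit_time Y l \<omega> = Beyond} = 0"
proof -
  interpret Py: prob_space "P y" by (rule prob[OF y'])
  have "measure (P y) {\<omega> \<in> C_abs. hit_time Y l \<omega> = Beyond} = measure (P y) {}"
  proof (rule Py.finite_measure_eq_AE)
    show "AE \<omega> in P y. \<omega> \<in> {\<omega> \<in> C_abs. hit_time Y l \<omega> = Beyond} \<longleftrightarrow> \<omega> \<in> {}"
      using limit_l[OF assms] AE_space
      by eventually_elim (auto simp: hit_time_Beyond_iff endpoint_hit_iff simp del: infinity_ennreal_def)
  qed (use never_hits_l_sets sets_P[OF y'] in auto)
  then show ?thesis by simp
qed

text \<open>Here \<open>X\<close> is bounded without stopping, so the constant time \<open>Beyond\<close> is admissible, and its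
  \<open>\<sigma>\<close>-algebra contains every event.\<close>

lemma conditioned_on_never_hitting:
  assumes "s r \<noteq> \<infinity>"
  shows "0 < measure (P y) {\<omega> \<in> C_abs. hit_time Y l \<omega> = Beyond}"
    and "uniform_measure (P y) {\<omega> \<in> C_abs. hit_time Y l \<omega> = Beyond} = Q"
proof -
  interpret Q: prob_space Q by (rule Q_prob)
  interpret Py: prob_space "P y" by (rule prob[OF y'])
  let ?\<sigma> = "\<lambda>_::path. Beyond" and ?E = "{\<omega> \<in> C_abs. hit_time Y l \<omega> = Beyond}"
  have r_fin: "\<bar>s r\<bar> \<noteq> \<infinity>" by (rule mp[OF s_r_cases assms])
  have st: "stopping_time path_filt ?\<sigma>" by (rule stopping_time_const)
  have rI: "r \<in> {l..r}" "l \<in> {l..r}" using lr by auto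
  have bd: "AE \<omega> in P y. \<forall>t\<ge>0. Y (trunc ?\<sigma> t \<omega>) \<omega> \<in> {l..r}"
    using AE_space by eventually_elim (use range trunc_bounds(1) space_P[OF y'] in blast)
  have s_sr_r: "s r = ereal (sr r)" using r_fin by (simp add: ereal_real)
  have pos: "0 < sr r" using s_less_r[OF y] s_sr[OF y] sr_pos[OF y] s_sr_r by (metis ereal_less(2) less_trans ereal_less_eq(3) less_ereal.simps(1))
  have key: "measure Q A = sr r / sr y * measure (P y) (A \<inter> ?E)" if A: "A \<in> sets path_alg" for A
  proof (rule foellmer_level[OF st rI(1) r_fin bd _ never_hits_l_sets])
    show "A \<in> sets (stopped_alg ?\<sigma>)" by (rule stopped_algI[OF st A]) simp
    show "0 \<le> sr r / sr y" using pos sr_pos[OF y] by simp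
    show "AE \<omega> in P y. \<omega> \<in> A \<longrightarrow> stopped_limit X ?\<sigma> \<omega> = (if \<omega> \<in> ?E then ereal (sr r / sr y) else 0)"
      using limit_exists[OF l_fin s_r_cases y] AE_space
    proof eventually_elim
      case (elim \<omega>)
      then have w: "\<omega> \<in> C_abs" using space_P[OF y'] by simp
      have inf: "\<not> ?\<sigma> \<omega> < Time \<infinity>" by simp
      have E: "\<omega> \<in> ?E \<longleftrightarrow> \<not> ((\<lambda>t. Y t \<omega>) \<longlongrightarrow> l) at_top"
        using w hit_time_Beyond_iff[OF w] endpoint_hit_iff[OF w, of l] by simp
      show ?case
      proof (cases "((\<lambda>t. Y t \<omega>) \<longlongrightarrow> l) at_top")
        case True
        have "stopped_limit X ?\<sigma> \<omega> = 0"
          using stopped_limit_infinite[OF w, of ?\<sigma>, OF inf rI(2) True] by (simp add: s_l)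
        moreover have "\<omega> \<notin> ?E" using E True by blast
        ultimately show ?thesis by (simp only: if_False simp_thms)
      next
        case False
        then have lim: "((\<lambda>t. Y t \<omega>) \<longlongrightarrow> r) at_top" using elim(1) by blast
        have "ereal (sr r) / ereal (sr y) = ereal (sr r / sr y)" using sr_pos[OF y] by simp
        then show ?thesis using stopped_limit_infinite[OF w, of ?\<sigma>, OF inf rI(1) lim] E False s_sr_r by simp
      qed
    qed
  qed
  have "C_abs \<in> sets path_alg" using sets.top[of path_alg] by simp
  moreover have "C_abs \<inter> ?E = ?E" by auto
  ultimately have one: "sr r / sr y * measure (P y) ?E = 1" using key[of C_abs] measure_Q_C_abs by (simp only:)
  then have "measure (P y) ?E \<noteq> 0" by auto
  then show "0 < measure (P y) ?E" using measure_nonneg[of "P y" ?E] by linarith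
  have ES: "?E \<in> sets (P y)" using never_hits_l_sets sets_P[OF y'] by simp
  show "uniform_measure (P y) ?E = Q"
  proof (rule measure_eqI)
    show "sets (uniform_measure (P y) ?E) = sets Q" using sets_P[OF y'] sets_Q by simp
    fix A assume "A \<in> sets (uniform_measure (P y) ?E)"
    then have A: "A \<in> sets path_alg" "A \<in> sets (P y)" using sets_P[OF y'] by auto
    show "emeasure (uniform_measure (P y) ?E) A = emeasure Q A"
      by (rule uniform_measure_proportional[OF Py.prob_space_axioms Q_prob ES A(2) key[OF A(1)] one])
  qed
qed

lemma case_L:
  shows "(measure (P y) {\<omega> \<in> C_abs. hit_time Y l \<omega> = Beyond} = 0 \<longleftrightarrow> s r = \<infinity>) \<and>
      (measure (P y) {\<omega> \<in> C_abs. hit_time Y l \<omega> = Beyond} = 0 \<longrightarrow>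
         consistent_family {y<..<r} (cond_restr (P y) Y l) \<and>
         (\<exists>R. is_extension {y<..<r} (cond_restr (P y) Y l) R) \<and>
         (\<forall>R. is_extension {y<..<r} (cond_restr (P y) Y l) R \<longrightarrow> R = Q)) \<and>
      (measure (P y) {\<omega> \<in> C_abs. hit_time Y l \<omega> = Beyond} > 0 \<longleftrightarrow> s r < \<infinity>) \<and>
      (measure (P y) {\<omega> \<in> C_abs. hit_time Y l \<omega> = Beyond} > 0 \<longrightarrow>
         uniform_measure (P y) {\<omega> \<in> C_abs. hit_time Y l \<omega> = Beyond} = Q) \<and>
      (s r = \<infinity> \<longrightarrow>
         consistent_family {l<..<y} (cond_restr Q Y r) \<and>
         is_extension {l<..<y} (cond_restr Q Y r) (P y) \<and>
         (\<forall>R. is_extension {l<..<y} (cond_restr Q Y r) R \<longrightarrow> R = P y))"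
proof (cases "s r = \<infinity>")
  case False
  note * = conditioned_on_never_hitting[OF False]
  have "s r < \<infinity>" using False by (simp add: less_top[symmetric] top_ereal_def)
  then show ?thesis using * False by simp
next
  case r_inf: True
  note null = never_hits_l_null[OF r_inf]
  note up = conditioned_family[OF sets_P[OF y'] Q_prob sets_Q, of "{y<..<r}" l]
  have up_eq: "emeasure (uniform_measure (P y) {\<omega> \<in> C_abs. hit_time Y a \<omega> \<le> hit_time Y l \<omega>}) A = emeasure Q A"
    if "a \<in> {y<..<r}" "A \<in> sets (stopped_alg (hit_time Y a))" for a A
    using conditioned_on_hitting_above[OF r_inf] that by simp
  note down = conditioned_family[OF sets_Q prob[OF y'] sets_P[OF y'], of "{l<..<y}" r]
  have down_eq: "emeasure (uniform_measure Q {\<omega> \<in> C_abs. hit_time Y a \<omega> \<le> hit_time Y r \<omega>}) A = emeasure (P y) A"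
    if "a \<in> {l<..<y}" "A \<in> sets (stopped_alg (hit_time Y a))" for a A
    using conditioned_back[OF r_inf] that by simp
  have up': "consistent_family {y<..<r} (cond_restr (P y) Y l)" "is_extension {y<..<r} (cond_restr (P y) Y l) Q"
    "\<And>a. sets (cond_restr (P y) Y l a) = sets (stopped_alg (hit_time Y a))"
    "\<And>a A. a \<in> {y<..<r} \<Longrightarrow> A \<in> sets (stopped_alg (hit_time Y a)) \<Longrightarrow> emeasure (cond_restr (P y) Y l a) A = emeasure Q A"
    by (rule up; (assumption | (rule up_eq; assumption)))+
  have down': "consistent_family {l<..<y} (cond_restr Q Y r)" "is_extension {l<..<y} (cond_restr Q Y r) (P y)"
    "\<And>a. sets (cond_restr Q Y r a) = sets (stopped_alg (hit_time Y a))"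
    "\<And>a A. a \<in> {l<..<y} \<Longrightarrow> A \<in> sets (stopped_alg (hit_time Y a)) \<Longrightarrow> emeasure (cond_restr Q Y r a) A = emeasure (P y) A"
    by (rule down; (assumption | (rule down_eq; assumption)))+
  have uniqQ: "R = Q" if R: "is_extension {y<..<r} (cond_restr (P y) Y l) R" for R
  proof -
    have yr: "y < r" using y by simp
    obtain b where b: "\<And>n. b n < r" "\<And>n. y < b n" "b \<longlonglongrightarrow> r" using approaching_from_below[OF yr] by blast
    show ?thesis
    proof (rule extension_unique[of r b y])
      show "prob_space R" "sets R = sets path_alg" using R by (auto simp: is_extension_def)
      show "emeasure R A = emeasure Q A" if "A \<in> sets (stopped_alg (hit_time Y (b n)))" for n A
      proof -
        have I: "b n \<in> {y<..<r}" using b(1,2)[of n] by simp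
        have "A \<in> sets (cond_restr (P y) Y l (b n))" unfolding up'(3) by (rule that)
        then have "emeasure R A = emeasure (cond_restr (P y) Y l (b n)) A"
          using R I unfolding is_extension_def by blast
        also have "\<dots> = emeasure Q A" by (rule up'(4)[OF I that])
        finally show ?thesis .
      qed
      show "AE \<omega> in Q. \<forall>n. hit_time Y (b n) \<omega> < Time \<infinity>"
        unfolding AE_all_countable using Q_hits_above[OF r_inf b(2,1)] by blast
    qed (use b Q_prob sets_Q Q_start in auto)
  qed
  have uniqP: "R = P y" if R: "is_extension {l<..<y} (cond_restr Q Y r) R" for R
  proof -
    have ly: "l < y" using y by simp
    obtain a where a: "\<And>n. l < a n" "\<And>n. a n < y" "a \<longlonglongrightarrow> l" using approaching_from_above[OF ly] by blast
    show ?thesis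
    proof (rule extension_unique[of l a y])
      show "prob_space R" "sets R = sets path_alg" using R by (auto simp: is_extension_def)
      show "emeasure R A = emeasure (P y) A" if "A \<in> sets (stopped_alg (hit_time Y (a n)))" for n A
      proof -
        have I: "a n \<in> {l<..<y}" using a(1,2)[of n] by simp
        have "A \<in> sets (cond_restr Q Y r (a n))" unfolding down'(3) by (rule that)
        then have "emeasure R A = emeasure (cond_restr Q Y r (a n)) A"
          using R I unfolding is_extension_def by blast
        also have "\<dots> = emeasure (P y) A" by (rule down'(4)[OF I that])
        finally show ?thesis .
      qed
      show "AE \<omega> in P y. \<forall>n. hit_time Y (a n) \<omega> < Time \<infinity>"
        unfolding AE_all_countable using P_hits_below[OF r_inf a(1,2)] by blast
    qed (use a prob[OF y'] sets_P[OF y'] start[OF y'] in auto)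
  qed
  let ?m = "measure (P y) {\<omega> \<in> C_abs. hit_time Y l \<omega> = Beyond}"
  show ?thesis
  proof (intro conjI impI allI)
    show "?m = 0 \<longleftrightarrow> s r = \<infinity>" "0 < ?m \<longleftrightarrow> s r < \<infinity>" using null r_inf by simp_all
    show "\<exists>R. is_extension {y<..<r} (cond_restr (P y) Y l) R" by (rule exI, rule up'(2))
    show "uniform_measure (P y) {\<omega> \<in> C_abs. hit_time Y l \<omega> = Beyond} = Q" if "0 < ?m"
      using that null by simp
    show "consistent_family {y<..<r} (cond_restr (P y) Y l)" by (rule up'(1))
    show "consistent_family {l<..<y} (cond_restr Q Y r)" "is_extension {l<..<y} (cond_restr Q Y r) (P y)"
      by (rule down')+
  qed (erule uniqQ uniqP)+
qed

end

section \<open>The two normalizations\<close>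

lemma uminus_image_Ioo: "{- b<..<- a} = uminus ` {a<..<b}" for a b :: ereal
proof (intro set_eqI iffI)
  fix x assume "x \<in> {- b<..<- a}"
  then have "- x \<in> {a<..<b}" by (simp only: uminus_Ioo)
  then show "x \<in> uminus ` {a<..<b}" by (intro image_eqI[of _ _ "- x"]) simp_all
qed auto

lemma consistent_family_uminus:
  "consistent_family {- b<..<- a} (\<lambda>x. \<mu> (- x)) \<longleftrightarrow> consistent_family {a<..<b} \<mu>"
  unfolding consistent_family_def uminus_image_Ioo by simp

lemma is_extension_uminus:
  "is_extension {- b<..<- a} (\<lambda>x. \<mu> (- x)) R \<longleftrightarrow> is_extension {a<..<b} \<mu> R"
  unfolding is_extension_def uminus_image_Ioo by simp

lemma cond_restr_uminus:
  "cond_restr M (\<lambda>t \<omega>. - Y t \<omega>) b = (\<lambda>a. cond_restr M Y (- b) (- a))"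
  unfolding cond_restr_def hit_time_uminus[abs_def] ..

text \<open>For \<open>v = 0\<close> and \<open>u \<noteq> 0\<close> this fails: the quotient is then infinite with the sign of \<open>u\<close>.\<close>

lemma ratio_uminus: "v \<noteq> 0 \<Longrightarrow> ratio (- u) (- v) = ratio u v"
  unfolding ratio_def by (cases u; cases v) auto

theorem corollary3p4:
  fixes l r y :: ereal
    and Y :: process
    and P Q :: "ereal \<Rightarrow> path measure"
    and s :: "ereal \<Rightarrow> ereal"
  assumes diff: "regular_diffusion l r Y P"
    and alg: "sets path_alg = sets (stopped_alg (\<lambda>\<omega>. min (hit_time Y l \<omega>) (hit_time Y r \<omega>)))"
    and scale: "scale_function l r Y P s"
    and foellmer: "\<And>x. x \<in> {l..r} \<Longrightarrow> foellmer_measure (P x) (\<lambda>t \<omega>. ratio (s (Y t \<omega>)) (s x)) (Q x)"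
    and y: "y \<in> {l<..<r}"
  shows "(s l = 0 \<longrightarrow>
      (measure (P y) {\<omega> \<in> C_abs. hit_time Y l \<omega> = Beyond} = 0 \<longleftrightarrow> s r = \<infinity>) \<and>
      (measure (P y) {\<omega> \<in> C_abs. hit_time Y l \<omega> = Beyond} = 0 \<longrightarrow>
         consistent_family {y<..<r} (cond_restr (P y) Y l) \<and>
         (\<exists>R. is_extension {y<..<r} (cond_restr (P y) Y l) R) \<and>
         (\<forall>R. is_extension {y<..<r} (cond_restr (P y) Y l) R \<longrightarrow> R = Q y)) \<and>
      (measure (P y) {\<omega> \<in> C_abs. hit_time Y l \<omega> = Beyond} > 0 \<longleftrightarrow> s r < \<infinity>) \<and>
      (measure (P y) {\<omega> \<in> C_abs. hit_time Y l \<omega> = Beyond} > 0 \<longrightarrow>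
         uniform_measure (P y) {\<omega> \<in> C_abs. hit_time Y l \<omega> = Beyond} = Q y) \<and>
      (s r = \<infinity> \<longrightarrow>
         consistent_family {l<..<y} (cond_restr (Q y) Y r) \<and>
         is_extension {l<..<y} (cond_restr (Q y) Y r) (P y) \<and>
         (\<forall>R. is_extension {l<..<y} (cond_restr (Q y) Y r) R \<longrightarrow> R = P y))) \<and>
    (s r = 0 \<longrightarrow>
      (measure (P y) {\<omega> \<in> C_abs. hit_time Y r \<omega> = Beyond} = 0 \<longleftrightarrow> s l = - \<infinity>) \<and>
      (measure (P y) {\<omega> \<in> C_abs. hit_time Y r \<omega> = Beyond} = 0 \<longrightarrow>
         consistent_family {l<..<y} (cond_restr (P y) Y r) \<and>
         (\<exists>R. is_extension {l<..<y} (cond_restr (P y) Y r) R) \<and>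
         (\<forall>R. is_extension {l<..<y} (cond_restr (P y) Y r) R \<longrightarrow> R = Q y)) \<and>
      (measure (P y) {\<omega> \<in> C_abs. hit_time Y r \<omega> = Beyond} > 0 \<longleftrightarrow> s l > - \<infinity>) \<and>
      (measure (P y) {\<omega> \<in> C_abs. hit_time Y r \<omega> = Beyond} > 0 \<longrightarrow>
         uniform_measure (P y) {\<omega> \<in> C_abs. hit_time Y r \<omega> = Beyond} = Q y) \<and>
      (s l = - \<infinity> \<longrightarrow>
         consistent_family {y<..<r} (cond_restr (Q y) Y l) \<and>
         is_extension {y<..<r} (cond_restr (Q y) Y l) (P y) \<and>
         (\<forall>R. is_extension {y<..<r} (cond_restr (Q y) Y l) R \<longrightarrow> R = P y)))"
proof -
  let "(_ \<longrightarrow> ?L) \<and> (_ \<longrightarrow> ?R)" = ?thesis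
  have base: "scaled_laws l r Y P s"
    by (intro scaled_laws.intro regular_laws.intro scaled_laws_axioms.intro diff scale)
  interpret scaled_laws l r Y P s by (rule base)
  have paths: "absorbed_paths l r Y" by (rule absorbed_paths_axioms)
  have yI: "y \<in> {l..r}" using y by auto
  show ?thesis
  proof (intro conjI[of "s l = 0 \<longrightarrow> ?L"] impI)
    assume l_zero: "s l = 0"
    interpret L: foellmer_laws l r Y P s y "Q y"
      by (intro foellmer_laws.intro base absorbed_information.intro paths absorbed_information_axioms.intro
          alg foellmer_laws_axioms.intro y l_zero foellmer[OF yI])
    show ?L by (rule L.case_L)
  next
    assume r_zero: "s r = 0"
    have sy: "s y \<noteq> 0" using s_less_r[OF y] r_zero by auto
    interpret R: foellmer_laws "- r" "- l" "\<lambda>t \<omega>. - Y t \<omega>" "\<lambda>x. P (- x)" "\<lambda>x. - s (- x)" "- y" "Q y"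
    proof (intro foellmer_laws.intro absorbed_information.intro absorbed_information_axioms.intro foellmer_laws_axioms.intro)
      show refl: "scaled_laws (- r) (- l) (\<lambda>t \<omega>. - Y t \<omega>) (\<lambda>x. P (- x)) (\<lambda>x. - s (- x))" by (rule reflected_laws)
      then interpret R0: scaled_laws "- r" "- l" "\<lambda>t \<omega>. - Y t \<omega>" "\<lambda>x. P (- x)" "\<lambda>x. - s (- x)" .
      show "absorbed_paths (- r) (- l) (\<lambda>t \<omega>. - Y t \<omega>)" by (rule R0.absorbed_paths_axioms)
      show "sets path_alg = sets (stopped_alg (\<lambda>\<omega>. min (hit_time (\<lambda>t \<omega>. - Y t \<omega>) (- r) \<omega>) (hit_time (\<lambda>t \<omega>. - Y t \<omega>) (- l) \<omega>)))"
        unfolding hit_time_uminus ereal_uminus_uminus using alg by (simp only: min.commute)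
      show "- y \<in> {- r<..<- l}" using y by simp
      show "- s (- (- r)) = 0" using r_zero by simp
      show "foellmer_measure (P (- (- y))) (\<lambda>t \<omega>. ratio (- s (- (- Y t \<omega>))) (- s (- (- y)))) (Q y)"
        unfolding ereal_uminus_uminus ratio_uminus[OF sy] by (rule foellmer[OF yI])
    qed
    have fin: "- s l = \<infinity> \<longleftrightarrow> s l = - \<infinity>" "- s l < \<infinity> \<longleftrightarrow> s l > - \<infinity>"
      by (cases "s l"; simp)+
    show ?R
      using R.case_L unfolding cond_restr_uminus hit_time_uminus ereal_uminus_uminus
        consistent_family_uminus is_extension_uminus fin .
  qed
qed

end
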